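(* Let $n\in\mathbb{N}$, $a<b$, $a_i<b_i$ for $i=1,\ldots,n$, $\Omega=\prod_{i=1}^n[a_i,b_i]$, $P=[a,b]\times\Omega$. Let $\alpha,\beta:[a,b]^2\to(0,1)$ and $\alpha_i,\beta_i:[a_i,b_i]^2\to(0,1)$ for $i=1,\ldots,n$, let $\gamma=(\gamma_1,\gamma_2)$ and $\gamma^i=(\gamma^i_1,\gamma^i_2)$, $i=1,\ldots,n$, be vectors in $[0,1]^2$, let $L:P\times\mathbb{R}^{n+3}\to\mathbb{R}$ be of class $C^1$, let $g:\partial P\to\mathbb{R}$ be a given function and $z_a\in\mathbb{R}$. Consider the problem of determining $x\in C^1(P)$, with $$x(t,s)=g(t,s)\quad\text{for all }(t,s)\in\partial P,$$ and $T\in[a,b]$ that give an extremum (minimum or maximum) to $z(T)=z[x,T]$, where $z$ is determined by $x$ through $$\dot z(t)=\int_\Omega L\left([x,z](t,s)\right)d^ns,\quad t\in[a,b],\qquad z(a)=z_a,$$ with $d^ns=ds_1\cdots ds_n$ and $$[x,z](t,s)=\left(t,s,x(t,s),{}^{C}D_\gamma^{\alpha(\cdot,\cdot),\beta(\cdot,\cdot)}x(t,s),{}^{C}D_{\gamma^1}^{\alpha_1(\cdot,\cdot),\beta_1(\cdot,\cdot)}x(t,s),\ldots,{}^{C}D_{\gamma^n}^{\alpha_n(\cdot,\cdot),\beta_n(\cdot,\cdot)}x(t,s),z(t)\right),$$ all these combined Caputo derivatives being assumed to exist and to be continuous functions. Put $$\lambda(t)=\exp\left(-\int_a^t\int_\Omega\partial_{2n+4}L([x,z](\tau,s))\,d^ns\,d\tau\right).$$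 Suppose that $(x,z)$ (with final time $T\in[a,b]$) is an extremizer of this problem, and that the Riemann–Liouville fractional derivatives (including the dual derivatives $D_{\overline\gamma}$ and $D_{\overline\gamma^i}$) of $\lambda(t)\partial_{n+3}L([x,z](t,s))$ and $\lambda(t)\partial_{n+3+i}L([x,z](t,s))$ appearing below, together with ${}_aD_t^{\beta(\cdot,\cdot)}\left(\lambda(t)\partial_{n+3}L([x,z](t,s))\right)$ on $[a,b]\times\Omega$, exist and are continuous on the sets where they are considered. Then $(x,z)$ satisfies $$\partial_{n+2}L([x,z](t,s))\,\lambda(t)+D_{\overline\gamma}^{\beta(\cdot,\cdot),\alpha(\cdot,\cdot)}\left(\lambda(t)\partial_{n+3}L([x,z](t,s))\right)+\sum_{i=1}^nD_{\overline\gamma^i}^{\beta_i(\cdot,\cdot),\alpha_i(\cdot,\cdot)}\left(\lambda(t)\partial_{n+3+i}L([x,z](t,s))\right)=0$$ on $[a,T]\times\Omega$, and $$\gamma_2\left({}_aD_t^{\beta(\cdot,\cdot)}\left(\lambda(t)\partial_{n+3}L([x,z](t,s))\right)-{}_TD_t^{\beta(\cdot,\cdot)}\left(\lambda(t)\partial_{n+3}L([x,z](t,s))\right)\right)=0$$ on $[T,b]\times\Omega$. Moreover, $(x,z)$ satisfies the transversality condition $$\left[\gamma_1\,{}_tI_T^{1-\alpha(\cdot,\cdot)}\left(\lambda(t)\partial_{n+3}L([x,z](t,s))\right)-\gamma_2\,{}_TI_t^{1-\beta(\cdot,\cdot)}\left(\lambda(t)\partial_{n+3}L([x,z](t,s))\right)\right]_{t=T}=0,\quad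 s\in\Omega.$$ If $T<b$, then $\displaystyle\int_\Omega L([x,z](T,s))\,d^ns=0$.
   Context: $\partial_iL$ denotes the partial derivative of $L$ with respect to its $i$th scalar argument, the arguments being ordered as $t,s_1,\ldots,s_n$, then $x$ (position $n+2$), then the combined Caputo derivative in $t$ (position $n+3$), then the combined Caputo derivatives in $s_1,\ldots,s_n$ (positions $n+4,\ldots,2n+3$), then $z$ (position $2n+4$). $\partial P$ is the boundary of $P$. Fractional operators of variable order in one real variable. Let $[A,B]$ be an interval, $\alpha:[A,B]^2\to(0,1)$ a function, $c\le d$ points of $[A,B]$, and $y$ a real function on $[c,d]$ ($\Gamma$ is the Gamma function). Left and right Riemann–Liouville fractional integrals of order $\alpha(\cdot,\cdot)$: $${}_cI_t^{\alpha(\cdot,\cdot)}y(t)=\int_c^t\frac{(t-\tau)^{\alpha(t,\tau)-1}}{\Gamma(\alpha(t,\tau))}y(\tau)\,d\tau,\qquad {}_tI_d^{\alpha(\cdot,\cdot)}y(t)=\int_t^d\frac{(\tau-t)^{\alpha(\tau,t)-1}}{\Gamma(\alpha(\tau,t))}y(\tau)\,d\tau .$$ The symbols ${}_cI_t^{1-\alpha(\cdot,\cdot)}$, ${}_tI_d^{1-\alpha(\cdot,\cdot)}$ mean the same with $\alpha$ replaced by $1-\alpha$. Left and right Riemann–Liouville fractional derivatives: $${}_cD_t^{\alpha(\cdot,\cdot)}y(t)=\frac{d}{dt}\int_c^t\frac{(t-\tau)^{-\alpha(t,\tau)}}{\Gamma(1-\alpha(t,\tau))}y(\tau)\,d\tau,\qquad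 {}_tD_d^{\alpha(\cdot,\cdot)}y(t)=\frac{d}{dt}\int_t^d\frac{-(\tau-t)^{-\alpha(\tau,t)}}{\Gamma(1-\alpha(\tau,t))}y(\tau)\,d\tau .$$ Left and right Caputo fractional derivatives: $${}^C_cD_t^{\alpha(\cdot,\cdot)}y(t)=\int_c^t\frac{(t-\tau)^{-\alpha(t,\tau)}}{\Gamma(1-\alpha(t,\tau))}y'(\tau)\,d\tau,\qquad {}^C_tD_d^{\alpha(\cdot,\cdot)}y(t)=\int_t^d\frac{-(\tau-t)^{-\alpha(\tau,t)}}{\Gamma(1-\alpha(\tau,t))}y'(\tau)\,d\tau .$$ For functions of $(t,s)\in P$ these operators are applied in one variable with the others held fixed. The combined Caputo derivative with respect to $t$ is $${}^{C}D_\gamma^{\alpha(\cdot,\cdot),\beta(\cdot,\cdot)}x(t,s)=\gamma_1\,{}^C_aD_t^{\alpha(\cdot,\cdot)}x(t,s)+\gamma_2\,{}^C_tD_b^{\beta(\cdot,\cdot)}x(t,s),$$ and the one with respect to $s_i$ is $${}^{C}D_{\gamma^i}^{\alpha_i(\cdot,\cdot),\beta_i(\cdot,\cdot)}x(t,s)=\gamma^i_1\,{}^C_{a_i}D_{s_i}^{\alpha_i(\cdot,\cdot)}x(t,s)+\gamma^i_2\,{}^C_{s_i}D_{b_i}^{\beta_i(\cdot,\cdot)}x(t,s).$$ Dual derivatives: with $\overline\gamma=(\gamma_2,\gamma_1)$, $\overline\gamma^i=(\gamma^i_2,\gamma^i_1)$, and $T$ the final time of the problem, $$D_{\overline\gamma}^{\beta(\cdot,\cdot),\alpha(\cdot,\cdot)}=\gamma_2\,{}_aD_t^{\beta(\cdot,\cdot)}+\gamma_1\,{}_tD_T^{\alpha(\cdot,\cdot)},\qquad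 D_{\overline\gamma^i}^{\beta_i(\cdot,\cdot),\alpha_i(\cdot,\cdot)}=\gamma^i_2\,{}_{a_i}D_{s_i}^{\beta_i(\cdot,\cdot)}+\gamma^i_1\,{}_{s_i}D_{b_i}^{\alpha_i(\cdot,\cdot)}.$$
   Formalization: The orders α, β, α_i, β_i are assumed Lebesgue measurable on their squares (else false under CH); the combined Caputo derivatives are assumed to exist and be continuous for every C¹ function equal to g on ∂P; existence of derivatives on [a,T] entails a<T, and the [T,b] equation is for T<b. *)

theory Defs
  imports "HOL-Analysis.Analysis"
begin

section \<open>Fractional operators of variable order in one variable\<close>

text \<open>
  Throughout, \<open>y\<close> is a real function on \<open>{c..d}\<close> and only its values there matter. Integrals
  exist in the sense of Lebesgue, i.e. as \<^const>\<open>absolutely_integrable_on\<close>, in which case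
  \<^const>\<open>integral\<close> is the Lebesgue integral. On the diagonal the kernels take the value 0
  (as \<open>0 powr r = 0\<close>), which affects a null set only.
\<close>

text \<open>
  A variable order on \<open>{A..B}\<close>: a function with values in the open unit interval, Lebesgue
  measurable so that the kernels below can be integrated.
\<close>

definition variable_order :: "real \<Rightarrow> real \<Rightarrow> (real \<Rightarrow> real \<Rightarrow> real) \<Rightarrow> bool" where
  "variable_order A B \<alpha> \<longleftrightarrow>
     (\<forall>t\<in>{A..B}. \<forall>\<tau>\<in>{A..B}. 0 < \<alpha> t \<tau> \<and> \<alpha> t \<tau> < 1) \<and>
     (\<lambda>(t, \<tau>). \<alpha> t \<tau>) \<in> borel_measurable (lebesgue_on ({A..B} \<times> {A..B}))"

definition rl_left_integral ::
    "(real \<Rightarrow> real \<Rightarrow> real) \<Rightarrow> real \<Rightarrow> (real \<Rightarrow> real) \<Rightarrow> real \<Rightarrow> real" where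
  "rl_left_integral \<alpha> c y t =
     integral {c..t} (\<lambda>\<tau>. (t - \<tau>) powr (\<alpha> t \<tau> - 1) / Gamma (\<alpha> t \<tau>) * y \<tau>)"

definition rl_right_integral ::
    "(real \<Rightarrow> real \<Rightarrow> real) \<Rightarrow> real \<Rightarrow> (real \<Rightarrow> real) \<Rightarrow> real \<Rightarrow> real" where
  "rl_right_integral \<alpha> d y t =
     integral {t..d} (\<lambda>\<tau>. (\<tau> - t) powr (\<alpha> \<tau> t - 1) / Gamma (\<alpha> \<tau> t) * y \<tau>)"

text \<open>
  In the Riemann--Liouville derivatives \<open>d/dt\<close> is taken relative to \<open>{c..d}\<close>, hence is one-sided
  at \<open>c\<close> and \<open>d\<close>.
\<close>

definition rl_left_deriv ::
    "(real \<Rightarrow> real \<Rightarrow> real) \<Rightarrow> real \<Rightarrow> real \<Rightarrow> (real \<Rightarrow> real) \<Rightarrow> real \<Rightarrow> real" where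
  "rl_left_deriv \<alpha> c d y t =
     vector_derivative
       (\<lambda>r. integral {c..r} (\<lambda>\<tau>. (r - \<tau>) powr (- \<alpha> r \<tau>) / Gamma (1 - \<alpha> r \<tau>) * y \<tau>))
       (at t within {c..d})"

definition rl_right_deriv ::
    "(real \<Rightarrow> real \<Rightarrow> real) \<Rightarrow> real \<Rightarrow> real \<Rightarrow> (real \<Rightarrow> real) \<Rightarrow> real \<Rightarrow> real" where
  "rl_right_deriv \<alpha> c d y t =
     vector_derivative
       (\<lambda>r. integral {r..d} (\<lambda>\<tau>. - ((\<tau> - r) powr (- \<alpha> \<tau> r)) / Gamma (1 - \<alpha> \<tau> r) * y \<tau>))
       (at t within {c..d})"

text \<open>
  Existence of these derivatives on all of \<open>{c..d}\<close>. On a one-point interval there is nothing to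
  differentiate (although \<^const>\<open>differentiable\<close> holds vacuously there), so a derivative exists
  only if \<open>c < d\<close>.
\<close>

definition rl_left_deriv_exists ::
    "(real \<Rightarrow> real \<Rightarrow> real) \<Rightarrow> real \<Rightarrow> real \<Rightarrow> (real \<Rightarrow> real) \<Rightarrow> bool" where
  "rl_left_deriv_exists \<alpha> c d y \<longleftrightarrow> c < d \<and>
     (\<forall>t\<in>{c..d}.
        (\<lambda>\<tau>. (t - \<tau>) powr (- \<alpha> t \<tau>) / Gamma (1 - \<alpha> t \<tau>) * y \<tau>) absolutely_integrable_on {c..t} \<and>
        (\<lambda>r. integral {c..r} (\<lambda>\<tau>. (r - \<tau>) powr (- \<alpha> r \<tau>) / Gamma (1 - \<alpha> r \<tau>) * y \<tau>))
          differentiable (at t within {c..d}))"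

definition rl_right_deriv_exists ::
    "(real \<Rightarrow> real \<Rightarrow> real) \<Rightarrow> real \<Rightarrow> real \<Rightarrow> (real \<Rightarrow> real) \<Rightarrow> bool" where
  "rl_right_deriv_exists \<alpha> c d y \<longleftrightarrow> c < d \<and>
     (\<forall>t\<in>{c..d}.
        (\<lambda>\<tau>. - ((\<tau> - t) powr (- \<alpha> \<tau> t)) / Gamma (1 - \<alpha> \<tau> t) * y \<tau>) absolutely_integrable_on {t..d} \<and>
        (\<lambda>r. integral {r..d} (\<lambda>\<tau>. - ((\<tau> - r) powr (- \<alpha> \<tau> r)) / Gamma (1 - \<alpha> \<tau> r) * y \<tau>))
          differentiable (at t within {c..d}))"

definition caputo_left ::
    "(real \<Rightarrow> real \<Rightarrow> real) \<Rightarrow> real \<Rightarrow> real \<Rightarrow> (real \<Rightarrow> real) \<Rightarrow> real \<Rightarrow> real" where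
  "caputo_left \<alpha> c d y t =
     integral {c..t} (\<lambda>\<tau>. (t - \<tau>) powr (- \<alpha> t \<tau>) / Gamma (1 - \<alpha> t \<tau>)
                            * vector_derivative y (at \<tau> within {c..d}))"

definition caputo_right ::
    "(real \<Rightarrow> real \<Rightarrow> real) \<Rightarrow> real \<Rightarrow> real \<Rightarrow> (real \<Rightarrow> real) \<Rightarrow> real \<Rightarrow> real" where
  "caputo_right \<alpha> c d y t =
     integral {t..d} (\<lambda>\<tau>. - ((\<tau> - t) powr (- \<alpha> \<tau> t)) / Gamma (1 - \<alpha> \<tau> t)
                            * vector_derivative y (at \<tau> within {c..d}))"

text \<open>
  The combined operators, for a weight vector \<open>\<gamma> = (\<gamma>\<^sub>1, \<gamma>\<^sub>2)\<close>. The dual derivative belonging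
  to weights \<open>\<gamma>\<close> and orders \<open>\<alpha>, \<beta>\<close> is \<open>rl_combined (prod.swap \<gamma>) \<beta> \<alpha>\<close>.
\<close>

definition combined_caputo ::
    "real \<times> real \<Rightarrow> (real \<Rightarrow> real \<Rightarrow> real) \<Rightarrow> (real \<Rightarrow> real \<Rightarrow> real) \<Rightarrow> real \<Rightarrow> real
      \<Rightarrow> (real \<Rightarrow> real) \<Rightarrow> real \<Rightarrow> real" where
  "combined_caputo \<gamma> \<alpha> \<beta> c d y t =
     fst \<gamma> * caputo_left \<alpha> c d y t + snd \<gamma> * caputo_right \<beta> c d y t"

definition combined_caputo_exists ::
    "(real \<Rightarrow> real \<Rightarrow> real) \<Rightarrow> (real \<Rightarrow> real \<Rightarrow> real) \<Rightarrow> real \<Rightarrow> real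
      \<Rightarrow> (real \<Rightarrow> real) \<Rightarrow> real \<Rightarrow> bool" where
  "combined_caputo_exists \<alpha> \<beta> c d y t \<longleftrightarrow>
     (\<lambda>\<tau>. (t - \<tau>) powr (- \<alpha> t \<tau>) / Gamma (1 - \<alpha> t \<tau>)
            * vector_derivative y (at \<tau> within {c..d})) absolutely_integrable_on {c..t} \<and>
     (\<lambda>\<tau>. - ((\<tau> - t) powr (- \<beta> \<tau> t)) / Gamma (1 - \<beta> \<tau> t)
            * vector_derivative y (at \<tau> within {c..d})) absolutely_integrable_on {t..d}"

definition rl_combined ::
    "real \<times> real \<Rightarrow> (real \<Rightarrow> real \<Rightarrow> real) \<Rightarrow> (real \<Rightarrow> real \<Rightarrow> real) \<Rightarrow> real \<Rightarrow> real
      \<Rightarrow> (real \<Rightarrow> real) \<Rightarrow> real \<Rightarrow> real" where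
  "rl_combined \<gamma> \<alpha> \<beta> c d y t =
     fst \<gamma> * rl_left_deriv \<alpha> c d y t + snd \<gamma> * rl_right_deriv \<beta> c d y t"


section \<open>Functions of \<open>(t, s)\<close>\<close>

text \<open>Class \<open>C\<^sup>1\<close> on a set, with derivatives relative to the set at its boundary points.\<close>

definition C1_on :: "'a::real_normed_vector set \<Rightarrow> ('a \<Rightarrow> real) \<Rightarrow> bool" where
  "C1_on S f \<longleftrightarrow>
     (\<exists>f' :: 'a \<Rightarrow> 'a \<Rightarrow>\<^sub>L real.
        (\<forall>p\<in>S. (f has_derivative blinfun_apply (f' p)) (at p within S)) \<and> continuous_on S f')"

definition slice_t :: "(real \<times> (real ^ 'n) \<Rightarrow> real) \<Rightarrow> real ^ 'n \<Rightarrow> real \<Rightarrow> real" where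
  "slice_t f s = (\<lambda>\<tau>. f (\<tau>, s))"

definition slice_s :: "'n \<Rightarrow> (real \<times> (real ^ 'n) \<Rightarrow> real) \<Rightarrow> real \<Rightarrow> real ^ 'n \<Rightarrow> real \<Rightarrow> real" where
  "slice_s i f t s = (\<lambda>\<sigma>. f (t, \<chi> j. if j = i then \<sigma> else s $ j))"

text \<open>
  The arguments of the Lagrangian: \<open>t\<close>, \<open>s\<^sub>1, \<dots>, s\<^sub>n\<close>, the value of \<open>x\<close>, the combined Caputo
  derivative in \<open>t\<close>, those in \<open>s\<^sub>1, \<dots>, s\<^sub>n\<close>, and the value of \<open>z\<close>.
\<close>

type_synonym 'n lagrangian_arg = "real \<times> (real ^ 'n) \<times> real \<times> real \<times> (real ^ 'n) \<times> real"

text \<open>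
  The partial derivatives \<open>\<partial>\<^sub>n\<^sub>+\<^sub>2\<close>, \<open>\<partial>\<^sub>n\<^sub>+\<^sub>3\<close>, \<open>\<partial>\<^sub>n\<^sub>+\<^sub>3\<^sub>+\<^sub>i\<close>, \<open>\<partial>\<^sub>2\<^sub>n\<^sub>+\<^sub>4\<close>; each of these arguments ranges over
  all of \<open>\<real>\<close>.
\<close>

definition partial_x :: "(('n::finite) lagrangian_arg \<Rightarrow> real) \<Rightarrow> ('n::finite) lagrangian_arg \<Rightarrow> real" where
  "partial_x L = (\<lambda>(t, s, x, u, v, z). deriv (\<lambda>r. L (t, s, r, u, v, z)) x)"

definition partial_Dt :: "(('n::finite) lagrangian_arg \<Rightarrow> real) \<Rightarrow> ('n::finite) lagrangian_arg \<Rightarrow> real" where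
  "partial_Dt L = (\<lambda>(t, s, x, u, v, z). deriv (\<lambda>r. L (t, s, x, r, v, z)) u)"

definition partial_Ds :: "'n \<Rightarrow> (('n::finite) lagrangian_arg \<Rightarrow> real) \<Rightarrow> ('n::finite) lagrangian_arg \<Rightarrow> real" where
  "partial_Ds i L = (\<lambda>(t, s, x, u, v, z).
     deriv (\<lambda>r. L (t, s, x, u, (\<chi> j. if j = i then r else v $ j), z)) (v $ i))"

definition partial_z :: "(('n::finite) lagrangian_arg \<Rightarrow> real) \<Rightarrow> ('n::finite) lagrangian_arg \<Rightarrow> real" where
  "partial_z L = (\<lambda>(t, s, x, u, v, z). deriv (\<lambda>r. L (t, s, x, u, v, r)) z)"


section \<open>The Herglotz problem\<close>

text \<open>
  The argument \<open>[x, z](t, s)\<close> of the Lagrangian on \<open>{a..b} \<times> cbox lo hi\<close>, where the coordinates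
  of the box are indexed by the finite type \<open>'n\<close>.
\<close>

definition herglotz_arg ::
    "real \<Rightarrow> real \<Rightarrow> real ^ 'n \<Rightarrow> real ^ 'n \<Rightarrow> real \<times> real \<Rightarrow> ('n \<Rightarrow> real \<times> real)
      \<Rightarrow> (real \<Rightarrow> real \<Rightarrow> real) \<Rightarrow> (real \<Rightarrow> real \<Rightarrow> real)
      \<Rightarrow> ('n \<Rightarrow> real \<Rightarrow> real \<Rightarrow> real) \<Rightarrow> ('n \<Rightarrow> real \<Rightarrow> real \<Rightarrow> real)
      \<Rightarrow> (real \<times> (real ^ 'n) \<Rightarrow> real) \<Rightarrow> (real \<Rightarrow> real) \<Rightarrow> real \<times> (real ^ 'n) \<Rightarrow> 'n lagrangian_arg" where
  "herglotz_arg a b lo hi \<gamma> \<gamma>s \<alpha> \<beta> \<alpha>s \<beta>s x z = (\<lambda>(t, s).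
     (t, s, x (t, s),
      combined_caputo \<gamma> \<alpha> \<beta> a b (slice_t x s) t,
      (\<chi> i. combined_caputo (\<gamma>s i) (\<alpha>s i) (\<beta>s i) (lo $ i) (hi $ i) (slice_s i x t s) (s $ i)),
      z t))"

text \<open>The combined Caputo derivatives of \<open>x\<close> all exist and are continuous.\<close>

definition caputo_regular ::
    "real \<Rightarrow> real \<Rightarrow> real ^ 'n \<Rightarrow> real ^ 'n \<Rightarrow> real \<times> real \<Rightarrow> ('n \<Rightarrow> real \<times> real)
      \<Rightarrow> (real \<Rightarrow> real \<Rightarrow> real) \<Rightarrow> (real \<Rightarrow> real \<Rightarrow> real)
      \<Rightarrow> ('n \<Rightarrow> real \<Rightarrow> real \<Rightarrow> real) \<Rightarrow> ('n \<Rightarrow> real \<Rightarrow> real \<Rightarrow> real)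
      \<Rightarrow> (real \<times> (real ^ 'n) \<Rightarrow> real) \<Rightarrow> bool" where
  "caputo_regular a b lo hi \<gamma> \<gamma>s \<alpha> \<beta> \<alpha>s \<beta>s x \<longleftrightarrow>
     (\<forall>t\<in>{a..b}. \<forall>s\<in>cbox lo hi. combined_caputo_exists \<alpha> \<beta> a b (slice_t x s) t) \<and>
     continuous_on ({a..b} \<times> cbox lo hi)
       (\<lambda>(t, s). combined_caputo \<gamma> \<alpha> \<beta> a b (slice_t x s) t) \<and>
     (\<forall>i. (\<forall>t\<in>{a..b}. \<forall>s\<in>cbox lo hi.
             combined_caputo_exists (\<alpha>s i) (\<beta>s i) (lo $ i) (hi $ i) (slice_s i x t s) (s $ i)) \<and>
          continuous_on ({a..b} \<times> cbox lo hi)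
            (\<lambda>(t, s). combined_caputo (\<gamma>s i) (\<alpha>s i) (\<beta>s i) (lo $ i) (hi $ i)
                         (slice_s i x t s) (s $ i)))"

text \<open>
  The following definitions are given for an arbitrary assignment \<open>br\<close> of \<open>[x, z]\<close> to \<open>x\<close> and
  \<open>z\<close>, used with \<^const>\<open>herglotz_arg\<close>. A trajectory is a competitor \<open>x\<close> together with the
  function \<open>z\<close> on all of \<open>{a..b}\<close> that it determines.
\<close>

definition herglotz_trajectory ::
    "('n lagrangian_arg \<Rightarrow> real)
      \<Rightarrow> ((real \<times> (real ^ 'n) \<Rightarrow> real) \<Rightarrow> (real \<Rightarrow> real) \<Rightarrow> real \<times> (real ^ 'n) \<Rightarrow> 'n lagrangian_arg)
      \<Rightarrow> real \<Rightarrow> real \<Rightarrow> (real ^ 'n) set \<Rightarrow> (real \<times> (real ^ 'n) \<Rightarrow> real) \<Rightarrow> real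
      \<Rightarrow> (real \<times> (real ^ 'n) \<Rightarrow> real) \<Rightarrow> (real \<Rightarrow> real) \<Rightarrow> bool" where
  "herglotz_trajectory L br a b \<Omega> g za x z \<longleftrightarrow>
     C1_on ({a..b} \<times> \<Omega>) x \<and>
     (\<forall>p\<in>frontier ({a..b} \<times> \<Omega>). x p = g p) \<and>
     (\<forall>t\<in>{a..b}. (z has_real_derivative integral \<Omega> (\<lambda>s. L (br x z (t, s)))) (at t within {a..b})) \<and>
     z a = za"

text \<open>The extremum is over all trajectories and all final times.\<close>

definition herglotz_extremizer ::
    "('n lagrangian_arg \<Rightarrow> real)
      \<Rightarrow> ((real \<times> (real ^ 'n) \<Rightarrow> real) \<Rightarrow> (real \<Rightarrow> real) \<Rightarrow> real \<times> (real ^ 'n) \<Rightarrow> 'n lagrangian_arg)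
      \<Rightarrow> real \<Rightarrow> real \<Rightarrow> (real ^ 'n) set \<Rightarrow> (real \<times> (real ^ 'n) \<Rightarrow> real) \<Rightarrow> real
      \<Rightarrow> (real \<times> (real ^ 'n) \<Rightarrow> real) \<Rightarrow> (real \<Rightarrow> real) \<Rightarrow> real \<Rightarrow> bool" where
  "herglotz_extremizer L br a b \<Omega> g za x z T \<longleftrightarrow>
     herglotz_trajectory L br a b \<Omega> g za x z \<and> T \<in> {a..b} \<and>
     ((\<forall>y w S. herglotz_trajectory L br a b \<Omega> g za y w \<and> S \<in> {a..b} \<longrightarrow> z T \<le> w S) \<or>
      (\<forall>y w S. herglotz_trajectory L br a b \<Omega> g za y w \<and> S \<in> {a..b} \<longrightarrow> w S \<le> z T))"

text \<open>\<open>\<lambda>(t)\<close>, for \<open>A (t, s) = [x, z](t, s)\<close>.\<close>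

definition herglotz_multiplier ::
    "('n lagrangian_arg \<Rightarrow> real) \<Rightarrow> (real \<times> (real ^ 'n) \<Rightarrow> 'n lagrangian_arg)
      \<Rightarrow> real \<Rightarrow> (real ^ 'n) set \<Rightarrow> real \<Rightarrow> real" where
  "herglotz_multiplier L A a \<Omega> t =
     exp (- integral {a..t} (\<lambda>\<tau>. integral \<Omega> (\<lambda>s. partial_z L (A (\<tau>, s)))))"

end

theory Submission
  imports Defs
begin

text \<open>
  Along the variation \<open>x + r h\<close> the function \<open>z\<close> is perturbed, to first order, by the solution \<open>\<theta>\<close> of
  the linear equation obtained by differentiating the Herglotz equation. The integrating factor \<open>\<lambda>\<close>
  turns \<open>\<lambda>(T) \<theta>(T)\<close> into an integral that is linear in \<open>h\<close> and its Caputo derivatives and must vanish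
  at an extremizer. Fractional integration by parts moves the derivatives to the other factor. The right
  Caputo derivative of \<open>h\<close> at times before \<open>T\<close> involves \<open>h'\<close> on all of \<open>{t..b}\<close>, which is the origin of
  the second equation, on \<open>{T..b}\<close>; the two boundary terms at \<open>T\<close> cancel. The fundamental lemma, applied
  with bump functions, gives the two equations.

  The integration by parts rests on Fubini's theorem for the kernel \<open>(t - \<tau>) powr (- \<alpha> t \<tau>)\<close>, which
  need not be integrable on the square when \<open>\<alpha>\<close> is only measurable. It becomes so because all admissible
  functions have a continuous combined Caputo derivative, by the uniform boundedness principle.

  The transversality condition is an identity: both integrals extend over \<open>{T..T}\<close>.
\<close>

section \<open>Integration of kernels in two variables\<close>

text \<open>The main obstacle is to get a uniform bound from pointwise information. The assumption
  \<open>caputo\<close> speaks of competitors only, but the difference of two competitors can be any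
  C1 function that vanishes on the boundary of the box. Products of one-variable functions, with all
  factors but one frozen at an interior point, reduce this to one interval: every C1 function
  vanishing at both ends has a continuous combined Caputo derivative. The derivatives of such
  functions are the continuous functions of mean zero. The mean is corrected by a hat function far
  from the point of evaluation, where the kernel is bounded. Uniform boundedness then controls the
  weighted mass of the kernel over each section, which is what Tonelli's theorem asks for. A second
  obstacle is that \<open>L\<close> is only C1, so the perturbed equation for \<open>z\<close> is
  only locally Lipschitz and its solution might not reach \<open>b\<close>. The equation is
  truncated near \<open>z\<close>; for small parameters the solution stays where the truncation
  changes nothing. Optimality in the final time is a separate matter: along the fixed trajectory,
  \<open>T\<close> is an extremum of \<open>z\<close> itself.\<close>

lemma has_integral_AE_UNIV:
  fixes f g :: "'a::euclidean_space \<Rightarrow> 'b::banach"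
  assumes "AE x in lborel. f x = g x" and "(g has_integral y) UNIV"
  shows "(f has_integral y) UNIV"
proof -
  obtain N where "{x. f x \<noteq> g x} \<subseteq> N" "N \<in> null_sets lborel"
    using assms(1) by (auto elim!: AE_E simp: null_sets_def)
  then show ?thesis
    using assms(2) by (intro has_integral_spike[of N UNIV f g])
      (auto simp: negligible_iff_null_sets intro: null_sets_completionI)
qed

text \<open>A Borel version \<open>w'\<close> of \<open>w\<close> differs from it on a null set
  \<open>N\<close>, and almost every section of \<open>N\<close> is null in both directions. Tonelli
  with the bound \<open>B\<close> makes \<open>w'\<close> integrable on the product, and its
  iterated integrals agree with those of \<open>w\<close> almost everywhere. The sections where
  \<open>integral\<close> takes a default value form a null set.\<close>

lemma fubini_bounded_sections:
  fixes w :: "'a::euclidean_space \<times> 'b::euclidean_space \<Rightarrow> real"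
  assumes meas: "w \<in> borel_measurable lebesgue"
    and sec: "\<And>t. (\<lambda>u. w (t, u)) absolutely_integrable_on UNIV"
    and bd: "\<And>t. integral UNIV (\<lambda>u. \<bar>w (t, u)\<bar>) \<le> B t"
    and B: "integrable lborel B"
  obtains I where "((\<lambda>t. integral UNIV (\<lambda>u. w (t, u))) has_integral I) UNIV"
    and "((\<lambda>u. integral UNIV (\<lambda>t. w (t, u))) has_integral I) UNIV"
proof -
  obtain w' where w'[measurable]: "w' \<in> borel_measurable borel" and "AE p in lborel. w p = w' p"
    using completion_ex_borel_measurable_real[OF meas] by auto
  then obtain N where N: "{p. w p \<noteq> w' p} \<subseteq> N" "N \<in> null_sets lborel"
    by (auto elim!: AE_E simp: null_sets_def)
  then have Nm: "N \<in> sets (lborel \<Otimes>\<^sub>M lborel)"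
    by (metis lborel_prod null_setsD2)
  have AEN: "AE p in lborel \<Otimes>\<^sub>M lborel. p \<notin> N"
    using N by (metis lborel_prod AE_not_in)
  have w'2[measurable]: "w' \<in> borel_measurable (lborel \<Otimes>\<^sub>M lborel)"
    using w' by (simp add: lborel_prod borel_prod)
  have AE1: "AE t in lborel. AE u in lborel. (t, u) \<notin> N"
    using lborel_pair.AE_pair[OF AEN] .
  have mN: "{p \<in> space (lborel \<Otimes>\<^sub>M lborel). (fst p, snd p) \<notin> N} \<in> sets (lborel \<Otimes>\<^sub>M lborel)"
    using sets.compl_sets[OF Nm] by (simp only: prod.collapse set_diff_eq)
  have AE2: "AE u in lborel. AE t in lborel. (t, u) \<notin> N"
    by (rule iffD1[OF lborel_pair.AE_commute[OF mN] AE1])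
  have nn: "AE t in lborel. (\<integral>\<^sup>+u. ennreal (norm (w' (t, u))) \<partial>lborel) \<le> ennreal (B t)"
    using AE1
  proof (rule AE_mp, intro AE_I2 impI)
    fix t assume *: "AE u in lborel. (t, u) \<notin> N"
    have "(\<integral>\<^sup>+u. ennreal (norm (w' (t, u))) \<partial>lborel) = (\<integral>\<^sup>+u. ennreal \<bar>w (t, u)\<bar> \<partial>lborel)"
      using * N(1) by (intro nn_integral_cong_AE) force
    also have "\<dots> = ennreal (integral UNIV (\<lambda>u. \<bar>w (t, u)\<bar>))"
      using nn_integral_has_integral_lebesgue[of UNIV "\<lambda>u. \<bar>w (t, u)\<bar>"]
        sec[of t] by (auto simp: absolutely_integrable_on_def integrable_integral)
    finally show "(\<integral>\<^sup>+u. ennreal (norm (w' (t, u))) \<partial>lborel) \<le> ennreal (B t)"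
      using bd[of t] by (simp add: ennreal_leI)
  qed
  have int: "integrable (lborel \<Otimes>\<^sub>M lborel) w'"
  proof (rule integrableI_bounded[OF w'2])
    have "(\<integral>\<^sup>+p. ennreal (norm (w' p)) \<partial>(lborel \<Otimes>\<^sub>M lborel))
        = (\<integral>\<^sup>+t. \<integral>\<^sup>+u. ennreal (norm (w' (t, u))) \<partial>lborel \<partial>lborel)"
      by (subst lborel.nn_integral_fst) auto
    also have "\<dots> \<le> (\<integral>\<^sup>+t. ennreal (B t) \<partial>lborel)"
      by (rule nn_integral_mono_AE[OF nn])
    also have "\<dots> < \<infinity>"
      using B integrableD(2)[OF B] by (simp add: less_top)
    finally show "(\<integral>\<^sup>+p. ennreal (norm (w' p)) \<partial>(lborel \<Otimes>\<^sub>M lborel)) < \<infinity>" .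
  qed
  have i1: "AE t in lborel. integral UNIV (\<lambda>u. w (t, u)) = (LINT u|lborel. w' (t, u))"
    using AE_conjI[OF AE1 lborel_pair.AE_integrable_fst'[OF int]]
  proof (rule AE_mp, intro AE_I2 impI)
    fix t assume *: "(AE u in lborel. (t, u) \<notin> N) \<and> integrable lborel (\<lambda>u. w' (t, u))"
    have "AE u in lborel. w (t, u) = w' (t, u)"
      using * N(1) by force
    then have "((\<lambda>u. w (t, u)) has_integral (LINT u|lborel. w' (t, u))) UNIV"
      by (rule has_integral_AE_UNIV[OF _ has_integral_integral_lborel]) (use * in simp)
    then show "integral UNIV (\<lambda>u. w (t, u)) = (LINT u|lborel. w' (t, u))"
      by (rule integral_unique)
  qed
  have int': "integrable (lborel \<Otimes>\<^sub>M lborel) (\<lambda>(x, y). w' (y, x))"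
    using lborel_pair.integrable_product_swap[OF int] .
  have i2: "AE u in lborel. integral UNIV (\<lambda>t. w (t, u)) = (LINT t|lborel. w' (t, u))"
    using AE_conjI[OF AE2 lborel_pair.AE_integrable_fst'[OF int']]
  proof (rule AE_mp, intro AE_I2 impI)
    fix u assume *: "(AE t in lborel. (t, u) \<notin> N) \<and> integrable lborel (\<lambda>t. case (u, t) of (x, y) \<Rightarrow> w' (y, x))"
    have "AE t in lborel. w (t, u) = w' (t, u)"
      using * N(1) by force
    then have "((\<lambda>t. w (t, u)) has_integral (LINT t|lborel. w' (t, u))) UNIV"
      by (rule has_integral_AE_UNIV[OF _ has_integral_integral_lborel]) (use * in simp)
    then show "integral UNIV (\<lambda>t. w (t, u)) = (LINT t|lborel. w' (t, u))"
      by (rule integral_unique)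
  qed
  show thesis
  proof
    have "((\<lambda>t. LINT u|lborel. w' (t, u)) has_integral (LINT p|(lborel \<Otimes>\<^sub>M lborel). w' p)) UNIV"
      using has_integral_integral_lborel[OF lborel_pair.integrable_fst'[OF int]]
      by (simp add: lborel_pair.integral_fst'[OF int])
    then show "((\<lambda>t. integral UNIV (\<lambda>u. w (t, u))) has_integral (LINT p|(lborel \<Otimes>\<^sub>M lborel). w' p)) UNIV"
      by (rule has_integral_AE_UNIV[OF i1])
    have "(LINT p|(lborel \<Otimes>\<^sub>M lborel). w' p) = (LINT p|(lborel \<Otimes>\<^sub>M lborel). (case p of (x, y) \<Rightarrow> w' (y, x)))"
      using lborel_pair.integral_product_swap[of w'] by simp
    then have "((\<lambda>u. LINT t|lborel. w' (t, u)) has_integral (LINT p|(lborel \<Otimes>\<^sub>M lborel). w' p)) UNIV"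
      using has_integral_integral_lborel[OF lborel_pair.integrable_fst'[OF int']]
      using lborel_pair.integral_fst'[OF int'] by simp
    then show "((\<lambda>u. integral UNIV (\<lambda>t. w (t, u))) has_integral (LINT p|(lborel \<Otimes>\<^sub>M lborel). w' p)) UNIV"
      by (rule has_integral_AE_UNIV[OF i2])
  qed
qed

section \<open>Uniform boundedness\<close>

text \<open>Banach and Steinhaus: the closed sets \<open>A n\<close> cover the space, so by Baire
  one of them contains a ball of radius \<open>r\<close>. Each vector is a multiple of a vector of
  norm \<open>r / 2\<close>, a difference of two points of the ball, whose image has norm at most
  \<open>2 n\<close>; hence the constant \<open>4 n / r\<close>.\<close>

lemma uniform_boundedness:
  fixes f :: "'i \<Rightarrow> 'a::{real_normed_vector, complete_space} \<Rightarrow> 'b::real_normed_vector"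
  assumes lin: "\<And>i. i \<in> I \<Longrightarrow> bounded_linear (f i)"
    and pt: "\<And>x. \<exists>M. \<forall>i\<in>I. norm (f i x) \<le> M"
  obtains C where "\<And>i x. i \<in> I \<Longrightarrow> norm (f i x) \<le> C * norm x"
proof -
  define A where "A n = {x. \<forall>i\<in>I. norm (f i x) \<le> real n}" for n
  have closed_A: "closed (A n)" for n
  proof -
    have "A n = (\<Inter>i\<in>I. {x. norm (f i x) \<le> real n})"
      by (auto simp: A_def)
    moreover have "closed {x. norm (f i x) \<le> real n}" if "i \<in> I" for i
      using lin[OF that]
      by (intro closed_Collect_le continuous_intros) (auto intro: linear_continuous_on)
    ultimately show ?thesis
      by auto
  qed
  have UN: "\<Union>(range A) = UNIV"
  proof -
    have "\<exists>n. x \<in> A n" for x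
    proof -
      obtain M where "\<forall>i\<in>I. norm (f i x) \<le> M" using pt by blast
      moreover obtain n where "M \<le> real n" using real_arch_simple by blast
      ultimately show ?thesis unfolding A_def by (blast intro: order_trans)
    qed
    then show ?thesis by blast
  qed
  have "\<exists>n. interior (A n) \<noteq> {}"
  proof (rule ccontr)
    assume "\<nexists>n. interior (A n) \<noteq> {}"
    then have "Met_TC.mtopology interior_of \<Union>(range A) = {}"
      using closed_A by (intro Met_TC.metric_Baire_category_alt) (auto simp: complete_UNIV)
    then show False
      using UN by simp
  qed
  then obtain n x0 where "x0 \<in> interior (A n)" by blast
  then obtain r where r: "r > 0" "ball x0 r \<subseteq> A n"
    by (metis mem_interior)
  show thesis
  proof
    fix i x assume i: "i \<in> I"
    interpret bounded_linear "f i" using lin[OF i] .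
    show "norm (f i x) \<le> (4 * real n / r) * norm x"
    proof (cases "x = 0")
      case True then show ?thesis by (simp add: zero)
    next
      case False
      define y where "y = (r / (2 * norm x)) *\<^sub>R x"
      have "norm y = r / 2" using False r by (simp add: y_def)
      then have "x0 + y \<in> A n" "x0 \<in> A n"
        using r by (auto simp: dist_norm subset_iff)
      then have "norm (f i (x0 + y)) \<le> n" "norm (f i x0) \<le> n"
        using i by (auto simp: A_def)
      moreover have "f i y = f i (x0 + y) - f i x0"
        by (simp add: add)
      ultimately have "norm (f i y) \<le> 2 * real n"
        using norm_triangle_ineq4[of "f i (x0 + y)" "f i x0"] by simp
      moreover have "norm (f i y) = r / (2 * norm x) * norm (f i x)"
        using r by (simp add: y_def scaleR)
      ultimately show ?thesis
        using False r by (simp add: field_simps)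
    qed
  qed
qed

lemma absolutely_integrable_mult_continuous:
  fixes k f :: "real \<Rightarrow> real"
  assumes "k absolutely_integrable_on {a..b}" "continuous_on {a..b} f"
  shows "(\<lambda>x. k x * f x) absolutely_integrable_on {a..b}"
proof -
  have "(\<lambda>x. f x * k x) absolutely_integrable_on {a..b}"
    using assms
    by (intro absolutely_integrable_bounded_measurable_product_real)
       (auto intro!: continuous_imp_measurable_on_sets_lebesgue compact_imp_bounded compact_continuous_image)
  then show ?thesis by (simp add: mult.commute)
qed

text \<open>
  The signs of the two parts are opposite, so a continuous function close to the sign of \<open>t - u\<close>
  tests their total mass; a uniform bound on the functionals therefore bounds both parts.
\<close>

lemma two_sided_kernel_bound:
  fixes k1 k2 :: "real \<Rightarrow> real \<Rightarrow> real"
  assumes int1: "\<And>t. t \<in> {c..d} \<Longrightarrow> k1 t absolutely_integrable_on {c..t}"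
    and int2: "\<And>t. t \<in> {c..d} \<Longrightarrow> k2 t absolutely_integrable_on {t..d}"
    and nn1: "\<And>t u. c \<le> u \<Longrightarrow> u \<le> t \<Longrightarrow> t \<le> d \<Longrightarrow> 0 \<le> k1 t u"
    and nn2: "\<And>t u. c \<le> t \<Longrightarrow> t \<le> u \<Longrightarrow> u \<le> d \<Longrightarrow> 0 \<le> k2 t u"
    and diag: "\<And>t. k1 t t = 0" "\<And>t. k2 t t = 0"
    and pt: "\<And>f. continuous_on UNIV f \<Longrightarrow>
      \<exists>M. \<forall>t\<in>{c..d}. \<bar>integral {c..t} (\<lambda>u. k1 t u * f u) - integral {t..d} (\<lambda>u. k2 t u * f u)\<bar> \<le> M"
  obtains K where "\<And>t. t \<in> {c..d} \<Longrightarrow> integral {c..t} (k1 t) \<le> K"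
    and "\<And>t. t \<in> {c..d} \<Longrightarrow> integral {t..d} (k2 t) \<le> K"
proof -
  have i1: "(\<lambda>u. k1 t u * f u) integrable_on {c..t}"
    and i2: "(\<lambda>u. k2 t u * f u) integrable_on {t..d}"
    if "t \<in> {c..d}" "continuous_on UNIV f" for t f
    using absolutely_integrable_mult_continuous[OF int1[OF that(1)]] absolutely_integrable_mult_continuous[OF int2[OF that(1)]] that(2)
    by (meson continuous_on_subset set_lebesgue_integral_eq_integral(1) subset_UNIV)+
  \<comment> \<open>The functionals live on the bounded continuous functions on the line, a Banach
    space available as a type; this is why \<open>pt\<close> tests functions continuous on all of
    \<open>UNIV\<close>.\<close>
  define \<mu> where "\<mu> t f = integral {c..t} (\<lambda>u. k1 t u * apply_bcontfun f u)
      - integral {t..d} (\<lambda>u. k2 t u * apply_bcontfun f u)" for t and f :: "real \<Rightarrow>\<^sub>C real"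
  have lin: "bounded_linear (\<mu> t)" if t: "t \<in> {c..d}" for t
  proof (rule bounded_linear_intro[where K = "integral {c..t} (k1 t) + integral {t..d} (k2 t)"])
    fix f g :: "real \<Rightarrow>\<^sub>C real" and r :: real
    show "\<mu> t (f + g) = \<mu> t f + \<mu> t g"
      using t by (simp add: \<mu>_def plus_bcontfun.rep_eq distrib_left integral_add i1 i2)
    show "\<mu> t (r *\<^sub>R f) = r *\<^sub>R \<mu> t f"
      by (simp add: \<mu>_def scaleR_bcontfun.rep_eq mult.left_commute[of _ r] right_diff_distrib)
    have "norm (integral {c..t} (\<lambda>u. k1 t u * apply_bcontfun f u)) \<le> integral {c..t} (\<lambda>u. k1 t u * norm f)"
      using t norm_bounded[of f] by (intro integral_norm_bound_integral i1)
        (auto simp: abs_mult nn1 intro!: mult_left_mono)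
    moreover have "norm (integral {t..d} (\<lambda>u. k2 t u * apply_bcontfun f u)) \<le> integral {t..d} (\<lambda>u. k2 t u * norm f)"
      using t norm_bounded[of f] by (intro integral_norm_bound_integral i2)
        (auto simp: abs_mult nn2 intro!: mult_left_mono)
    ultimately show "norm (\<mu> t f) \<le> norm f * (integral {c..t} (k1 t) + integral {t..d} (k2 t))"
      by (simp add: \<mu>_def algebra_simps)
  qed
  have "\<exists>M. \<forall>t\<in>{c..d}. norm (\<mu> t f) \<le> M" for f
    using pt[of "apply_bcontfun f"] by (simp add: \<mu>_def)
  then obtain C where C: "\<And>t f. t \<in> {c..d} \<Longrightarrow> norm (\<mu> t f) \<le> C * norm f"
    using uniform_boundedness[of "{c..d}" \<mu>] lin by metis
  have main: "integral {c..t} (k1 t) + integral {t..d} (k2 t) \<le> \<bar>C\<bar>" if t: "t \<in> {c..d}" for t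
  proof -
    have eventually_one_le_mult: "\<forall>\<^sub>F n in sequentially. 1 \<le> real n * y" if "0 < y" for y
    proof -
      obtain N where "1 / y \<le> real N" using real_arch_simple by blast
      then have "1 \<le> real n * y" if "N \<le> n" for n
        using that \<open>0 < y\<close> by (simp add: field_simps)
           (meson mult_left_mono of_nat_le_iff order_less_imp_le order_trans)
      then show ?thesis by (auto simp: eventually_sequentially)
    qed
    \<comment> \<open>Ramps of slope \<open>n\<close> converge to the sign of \<open>t - u\<close>
      off the diagonal. On the diagonal they are 0, which agrees with the limit claimed below
      because both kernels vanish there.\<close>
    define h where "h n u = max (-1) (min 1 (real n * (t - u)))" for n u
    have hc: "continuous_on UNIV (h n)" for n
      unfolding h_def by (intro continuous_intros)
    have hb: "\<bar>h n u\<bar> \<le> 1" for n u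
      by (auto simp: h_def)
    have "integral {c..t} (\<lambda>u. k1 t u * h n u) - integral {t..d} (\<lambda>u. k2 t u * h n u) \<le> \<bar>C\<bar>" for n
    proof -
      have "h n \<in> bcontfun"
        using hc hb unfolding bcontfun_def by (auto intro!: boundedI[where B = 1])
      then have ap: "apply_bcontfun (Bcontfun (h n)) = h n"
        by (simp add: Bcontfun_inverse)
      have "norm (Bcontfun (h n)) \<le> 1"
        using hb by (intro norm_bound) (simp add: ap)
      then have "C * norm (Bcontfun (h n)) \<le> \<bar>C\<bar>"
        by (metis abs_ge_self abs_mult abs_norm_cancel mult.right_neutral mult_left_mono order.trans abs_ge_zero)
      then show ?thesis
        using C[OF t, of "Bcontfun (h n)"] by (simp add: \<mu>_def ap)
    qed
    moreover have "(\<lambda>n. integral {c..t} (\<lambda>u. k1 t u * h n u)) \<longlonglongrightarrow> integral {c..t} (k1 t)"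
    proof (rule dominated_convergence(2)[where h = "k1 t"])
      fix n u assume u: "u \<in> {c..t}"
      then show "norm (k1 t u * h n u) \<le> k1 t u"
        using hb[of n u] nn1[of u t] t by (auto simp: abs_mult intro: mult_left_le)
    next
      fix u assume u: "u \<in> {c..t}"
      show "(\<lambda>n. k1 t u * h n u) \<longlonglongrightarrow> k1 t u"
      proof (cases "u = t")
        case False
        then have "\<forall>\<^sub>F n in sequentially. h n u = 1"
          using eventually_one_le_mult[of "t - u"] u by (auto simp: h_def elim!: eventually_mono)
        then have "\<forall>\<^sub>F n in sequentially. k1 t u * h n u = k1 t u"
          by (rule eventually_mono) simp
        then show ?thesis by (rule tendsto_eventually)
      qed (simp add: diag)
    qed (use t hc i1 int1 in \<open>auto simp: absolutely_integrable_on_def\<close>)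
    moreover have "(\<lambda>n. integral {t..d} (\<lambda>u. k2 t u * h n u)) \<longlonglongrightarrow> integral {t..d} (\<lambda>u. - k2 t u)"
    proof (rule dominated_convergence(2)[where h = "k2 t"])
      fix n u assume u: "u \<in> {t..d}"
      then show "norm (k2 t u * h n u) \<le> k2 t u"
        using hb[of n u] nn2[of t u] t by (auto simp: abs_mult intro: mult_left_le)
    next
      fix u assume u: "u \<in> {t..d}"
      show "(\<lambda>n. k2 t u * h n u) \<longlonglongrightarrow> - k2 t u"
      proof (cases "u = t")
        case False
        then have "\<forall>\<^sub>F n in sequentially. h n u = -1"
          using eventually_one_le_mult[of "u - t"] u
          by (auto simp: h_def algebra_simps elim!: eventually_mono)
        then have "\<forall>\<^sub>F n in sequentially. k2 t u * h n u = - k2 t u"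
          by (rule eventually_mono) simp
        then show ?thesis by (rule tendsto_eventually)
      qed (simp add: diag)
    qed (use t hc i2 int2 in \<open>auto simp: absolutely_integrable_on_def\<close>)
    ultimately have "integral {c..t} (k1 t) - integral {t..d} (\<lambda>u. - k2 t u) \<le> \<bar>C\<bar>"
      by (intro LIMSEQ_le_const2[OF tendsto_diff]) auto
    then show ?thesis by simp
  qed
  show thesis
  proof
    fix t assume t: "t \<in> {c..d}"
    have "0 \<le> integral {c..t} (k1 t)" "0 \<le> integral {t..d} (k2 t)"
      using t nn1 nn2 int1 int2 by (auto intro!: integral_nonneg simp: absolutely_integrable_on_def)
    then show "integral {c..t} (k1 t) \<le> \<bar>C\<bar>" "integral {t..d} (k2 t) \<le> \<bar>C\<bar>"
      using main[OF t] by auto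
  qed
qed

section \<open>Kernels of variable order\<close>

abbreviation has_deriv_on :: "real \<Rightarrow> real \<Rightarrow> (real \<Rightarrow> real) \<Rightarrow> (real \<Rightarrow> real) \<Rightarrow> bool" where
  "has_deriv_on c d y y' \<equiv> \<forall>u\<in>{c..d}. (y has_vector_derivative y' u) (at u within {c..d})"

text \<open>The common kernel of the left Caputo and Riemann-Liouville derivatives. The right
  operators use it as \<open>vo_kernel \<beta> u t\<close>, with arguments exchanged and the minus
  sign outside the integral, so one set of estimates serves both sides.\<close>

definition vo_kernel :: "(real \<Rightarrow> real \<Rightarrow> real) \<Rightarrow> real \<Rightarrow> real \<Rightarrow> real" where
  "vo_kernel \<alpha> t u = (t - u) powr (- \<alpha> t u) / Gamma (1 - \<alpha> t u)"

lemma vo_kernel_diag [simp]: "vo_kernel \<alpha> t t = 0"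
  by (simp add: vo_kernel_def)

lemma variable_orderD:
  "variable_order A B \<alpha> \<Longrightarrow> t \<in> {A..B} \<Longrightarrow> u \<in> {A..B} \<Longrightarrow> 0 < \<alpha> t u \<and> \<alpha> t u < 1"
  by (auto simp: variable_order_def)

lemma vo_kernel_nonneg:
  assumes "variable_order A B \<alpha>" "t \<in> {A..B}" "u \<in> {A..B}"
  shows "0 \<le> vo_kernel \<alpha> t u"
  using variable_orderD[OF assms] by (simp add: vo_kernel_def Gamma_real_pos less_imp_le)

text \<open>The exponent lies between -1 and 0, so the power is at most
  \<open>max 1 (1 / \<rho>)\<close>, and the reciprocal Gamma function is continuous, hence bounded
  on \<open>{0..1}\<close>. The bound depends on \<open>\<rho>\<close> alone and is the same for all
  orders.\<close>

lemma vo_kernel_bound_off_diagonal: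
  assumes "0 < (\<rho>::real)"
  obtains B where "\<And>\<alpha> c d t u. variable_order c d \<alpha> \<Longrightarrow> t \<in> {c..d} \<Longrightarrow> u \<in> {c..d} \<Longrightarrow> \<rho> \<le> t - u \<Longrightarrow>
    vo_kernel \<alpha> t u \<le> B" "0 \<le> B"
proof -
  have "bounded (rGamma ` {0..1::real})"
    by (intro compact_imp_bounded compact_continuous_image continuous_intros) auto
  then obtain G where "\<forall>x\<in>{0..1::real}. \<bar>rGamma x\<bar> \<le> G"
    by (auto simp: bounded_iff)
  then have G: "\<bar>rGamma x\<bar> \<le> G" if "x \<in> {0..1::real}" for x
    using that by blast
  show thesis
  proof
    show "0 \<le> max 1 (1 / \<rho>) * G"
      using G[of 0] by (auto intro: mult_nonneg_nonneg)
    fix \<alpha> and c d t u :: real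
    assume \<alpha>: "variable_order c d \<alpha>" "t \<in> {c..d}" "u \<in> {c..d}" and \<rho>: "\<rho> \<le> t - u"
    define p where "p = \<alpha> t u"
    have p: "0 < p" "p < 1" using variable_orderD[OF \<alpha>] by (auto simp: p_def)
    have "(t - u) powr (- p) \<le> max 1 (1 / \<rho>)"
    proof (cases "1 \<le> t - u")
      case True
      then have "(t - u) powr (- p) \<le> (t - u) powr 0" using p by (intro powr_mono) auto
      then show ?thesis using True by simp
    next
      case False
      then have "(t - u) powr (- p) \<le> (t - u) powr (- 1)"
        using p assms \<rho> by (intro powr_mono') auto
      also have "\<dots> = 1 / (t - u)" using assms \<rho> by (simp add: powr_minus_divide)
      also have "\<dots> \<le> 1 / \<rho>" using assms \<rho> by (simp add: frac_le)
      finally show ?thesis by simp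
    qed
    moreover have "inverse (Gamma (1 - p)) \<le> G"
      using G[of "1 - p"] p by (simp add: rGamma_inverse_Gamma)
    ultimately show "vo_kernel \<alpha> t u \<le> max 1 (1 / \<rho>) * G"
      unfolding vo_kernel_def p_def[symmetric] divide_inverse
      using p by (intro mult_mono) (auto simp: Gamma_real_pos less_imp_le)
  qed
qed

text \<open>On a nondegenerate interval the derivative relative to the interval is unique, so an
  explicit \<open>y'\<close> may replace \<open>vector_derivative\<close>. All later arguments
  (linearity, Fubini, the fundamental theorem of calculus) work with this form.\<close>

lemma caputo_left_eq:
  assumes "c < d" "t \<in> {c..d}"
    and "has_deriv_on c d y y'"
  shows "caputo_left \<alpha> c d y t = integral {c..t} (\<lambda>u. vo_kernel \<alpha> t u * y' u)"
  unfolding caputo_left_def vo_kernel_def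
  by (intro integral_cong) (use assms in \<open>simp add: vector_derivative_within_closed_interval\<close>)

lemma caputo_right_eq:
  assumes "c < d" "t \<in> {c..d}"
    and "has_deriv_on c d y y'"
  shows "caputo_right \<beta> c d y t = - integral {t..d} (\<lambda>u. vo_kernel \<beta> u t * y' u)"
  unfolding caputo_right_def vo_kernel_def integral_neg[symmetric]
  by (intro integral_cong) (use assms in \<open>simp add: vector_derivative_within_closed_interval\<close>)

lemma combined_caputo_exists_eq:
  assumes "c < d" "t \<in> {c..d}"
    and "has_deriv_on c d y y'"
  shows "combined_caputo_exists \<alpha> \<beta> c d y t \<longleftrightarrow>
    (\<lambda>u. vo_kernel \<alpha> t u * y' u) absolutely_integrable_on {c..t} \<and>
    (\<lambda>u. vo_kernel \<beta> u t * y' u) absolutely_integrable_on {t..d}"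
proof -
  have vd: "vector_derivative y (at u within {c..d}) = y' u" if "u \<in> {c..d}" for u
    using assms that by (auto intro: vector_derivative_within_closed_interval)
  have "(\<lambda>u. (t - u) powr (- \<alpha> t u) / Gamma (1 - \<alpha> t u) * vector_derivative y (at u within {c..d}))
      absolutely_integrable_on {c..t} \<longleftrightarrow> (\<lambda>u. vo_kernel \<alpha> t u * y' u) absolutely_integrable_on {c..t}"
    using assms(2) by (intro set_integrable_cong) (auto simp: vo_kernel_def vd)
  moreover have "(\<lambda>u. - ((u - t) powr (- \<beta> u t)) / Gamma (1 - \<beta> u t) * vector_derivative y (at u within {c..d}))
      absolutely_integrable_on {t..d} \<longleftrightarrow> (\<lambda>u. (-1) * (vo_kernel \<beta> u t * y' u)) absolutely_integrable_on {t..d}"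
    using assms(2) by (intro set_integrable_cong) (auto simp: vo_kernel_def vd)
  moreover have "\<dots> \<longleftrightarrow> (\<lambda>u. vo_kernel \<beta> u t * y' u) absolutely_integrable_on {t..d}"
    using set_integrable_mult_right_iff[of "-1::real" lebesgue "{t..d}" "\<lambda>u. vo_kernel \<beta> u t * y' u"] by simp
  ultimately show ?thesis
    by (simp add: combined_caputo_exists_def)
qed

text \<open>Linearity of the integral; the two absolute integrability conditions hidden in
  \<open>combined_caputo_exists\<close> justify splitting it. The identity for \<open>h\<close> is
  only asked on \<open>{c..d}\<close>, because variations are controlled only on the box.\<close>

lemma combined_caputo_linear:
  assumes cd: "c < d" and t: "t \<in> {c..d}"
    and f: "has_deriv_on c d f f'"
    and g: "has_deriv_on c d g g'"
    and ex: "combined_caputo_exists \<alpha> \<beta> c d f t" "combined_caputo_exists \<alpha> \<beta> c d g t"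
    and h: "\<And>u. u \<in> {c..d} \<Longrightarrow> h u = p * f u + q * g u"
  shows "combined_caputo_exists \<alpha> \<beta> c d h t"
    and "combined_caputo \<gamma> \<alpha> \<beta> c d h t = p * combined_caputo \<gamma> \<alpha> \<beta> c d f t + q * combined_caputo \<gamma> \<alpha> \<beta> c d g t"
proof -
  have hd: "has_deriv_on c d h (\<lambda>u. p * f' u + q * g' u)"
  proof (intro ballI, rule has_vector_derivative_transform)
    fix u assume u: "u \<in> {c..d}"
    show "((\<lambda>u. p * f u + q * g u) has_vector_derivative (p * f' u + q * g' u)) (at u within {c..d})"
      using f g u by (auto intro!: derivative_eq_intros)
  qed (use h in auto)
  define a where "a = vo_kernel \<alpha> t"
  define b where "b u = vo_kernel \<beta> u t" for u
  have af: "(\<lambda>u. a u * f' u) absolutely_integrable_on {c..t}" "(\<lambda>u. a u * g' u) absolutely_integrable_on {c..t}"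
    and bf: "(\<lambda>u. b u * f' u) absolutely_integrable_on {t..d}" "(\<lambda>u. b u * g' u) absolutely_integrable_on {t..d}"
    using ex unfolding combined_caputo_exists_eq[OF cd t f] combined_caputo_exists_eq[OF cd t g] a_def b_def
    by blast+
  have eqa: "(\<lambda>u. a u * (p * f' u + q * g' u)) = (\<lambda>u. p * (a u * f' u) + q * (a u * g' u))"
    and eqb: "(\<lambda>u. b u * (p * f' u + q * g' u)) = (\<lambda>u. p * (b u * f' u) + q * (b u * g' u))"
    by (auto simp: algebra_simps)
  show "combined_caputo_exists \<alpha> \<beta> c d h t"
    unfolding combined_caputo_exists_eq[OF cd t hd] a_def[symmetric] b_def[symmetric] eqa eqb
    using af bf by (intro conjI set_integral_add set_integrable_mult_right) auto
  have ia: "integral {c..t} (\<lambda>u. p * (a u * f' u) + q * (a u * g' u))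
      = p * integral {c..t} (\<lambda>u. a u * f' u) + q * integral {c..t} (\<lambda>u. a u * g' u)"
    using af by (subst integral_add) (auto simp: absolutely_integrable_on_def intro!: integrable_on_mult_right)
  have ib: "integral {t..d} (\<lambda>u. p * (b u * f' u) + q * (b u * g' u))
      = p * integral {t..d} (\<lambda>u. b u * f' u) + q * integral {t..d} (\<lambda>u. b u * g' u)"
    using bf by (subst integral_add) (auto simp: absolutely_integrable_on_def intro!: integrable_on_mult_right)
  show "combined_caputo \<gamma> \<alpha> \<beta> c d h t = p * combined_caputo \<gamma> \<alpha> \<beta> c d f t + q * combined_caputo \<gamma> \<alpha> \<beta> c d g t"
    unfolding combined_caputo_def
      caputo_left_eq[OF cd t hd] caputo_left_eq[OF cd t f] caputo_left_eq[OF cd t g]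
      caputo_right_eq[OF cd t hd] caputo_right_eq[OF cd t f] caputo_right_eq[OF cd t g]
      a_def[symmetric] b_def[symmetric] eqa eqb ia ib
    by (simp add: algebra_simps)
qed

text \<open>At 0 the difference quotient is squeezed between \<open>- \<bar>h\<bar>\<close> and
  \<open>\<bar>h\<bar>\<close>; elsewhere the function is locally a square or zero. The derivative
  being continuous, squared positive parts are C1, which yields the bump functions below.\<close>

lemma has_real_derivative_max_0_power2:
  "((\<lambda>x::real. (max 0 x)\<^sup>2) has_real_derivative 2 * max 0 x) (at x)"
proof (cases "x = 0")
  case True
  have "((\<lambda>h. max 0 h * max 0 h / h) \<longlongrightarrow> 0) (at (0::real))"
  proof (rule tendsto_sandwich[of "\<lambda>h. - \<bar>h\<bar>" _ _ "\<lambda>h. \<bar>h\<bar>"])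
    show "((\<lambda>h. - \<bar>h\<bar>) \<longlongrightarrow> 0) (at (0::real))" "((\<lambda>h. \<bar>h\<bar>) \<longlongrightarrow> 0) (at (0::real))"
      by (auto intro!: tendsto_eq_intros)
  qed (auto intro!: always_eventually simp: max_def)
  then show ?thesis
    using True by (simp add: DERIV_def power2_eq_square)
next
  case False
  show ?thesis
  proof (cases "x > 0")
    case True
    have "((\<lambda>x::real. x\<^sup>2) has_real_derivative 2 * max 0 x) (at x)"
      using True by (auto intro!: derivative_eq_intros)
    then show ?thesis
      by (rule has_field_derivative_transform_within_open[where S = "{0<..}"]) (use True in auto)
  next
    case F: False
    then have "((\<lambda>x::real. 0) has_real_derivative 2 * max 0 x) (at x)"
      using False by (auto intro!: derivative_eq_intros)
    then show ?thesis
      by (rule has_field_derivative_transform_within_open[where S = "{..<0}"]) (use F False in auto)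
  qed
qed

section \<open>Integrability and uniform mass of the kernels\<close>

lemma integrable_mult_continuous:
  fixes k f :: "real \<Rightarrow> real"
  assumes "k absolutely_integrable_on {a..b}" "continuous_on {a..b} f"
  shows "(\<lambda>x. k x * f x) integrable_on {a..b}"
  using absolutely_integrable_mult_continuous[OF assms] by (simp add: absolutely_integrable_on_def)

text \<open>The mass is bounded only after multiplication by the weight: with weight 0 the combined
  derivative says nothing about the size of the corresponding kernel. Integrability is free of the
  weights because \<open>combined_caputo_exists\<close> asks for both one-sided integrals.\<close>

definition bounded_kernels ::
    "real \<times> real \<Rightarrow> (real \<Rightarrow> real \<Rightarrow> real) \<Rightarrow> (real \<Rightarrow> real \<Rightarrow> real) \<Rightarrow> real \<Rightarrow> real \<Rightarrow> real \<Rightarrow> bool" where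
  "bounded_kernels \<gamma> \<alpha> \<beta> c d K \<longleftrightarrow> (\<forall>t\<in>{c..d}.
     vo_kernel \<alpha> t absolutely_integrable_on {c..t} \<and>
     (\<lambda>u. vo_kernel \<beta> u t) absolutely_integrable_on {t..d} \<and>
     fst \<gamma> * integral {c..t} (vo_kernel \<alpha> t) \<le> K \<and>
     snd \<gamma> * integral {t..d} (\<lambda>u. vo_kernel \<beta> u t) \<le> K)"

text \<open>The functional \<open>\<mu> t\<close>, applied to \<open>\<phi>'\<close>, is the
  combined Caputo derivative of \<open>\<phi>\<close> at \<open>t\<close>. Since
  \<open>\<phi>\<close> vanishes at both ends, \<open>reg\<close> bounds it only on continuous
  functions of mean zero. Subtracting a multiple of a hat removes this restriction: the hat sits at
  the end of the interval away from \<open>t\<close>, where the kernel is bounded off the diagonal.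
  After that \<open>two_sided_kernel_bound\<close> applies.\<close>

lemma caputo_kernel_bound:
  fixes \<gamma> :: "real \<times> real"
  assumes cd: "c < d" and \<alpha>: "variable_order c d \<alpha>" and \<beta>: "variable_order c d \<beta>"
    and \<gamma>: "0 \<le> fst \<gamma>" "0 \<le> snd \<gamma>"
    and reg: "\<And>\<phi> \<phi>'. \<lbrakk>has_deriv_on c d \<phi> \<phi>';
        continuous_on {c..d} \<phi>'; \<phi> c = 0; \<phi> d = 0\<rbrakk>
      \<Longrightarrow> (\<forall>t\<in>{c..d}. combined_caputo_exists \<alpha> \<beta> c d \<phi> t) \<and>
          (\<exists>M. \<forall>t\<in>{c..d}. \<bar>combined_caputo \<gamma> \<alpha> \<beta> c d \<phi> t\<bar> \<le> M)"
  shows "\<exists>K. bounded_kernels \<gamma> \<alpha> \<beta> c d K"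
proof -
  define m where "m = (c + d) / 2"
  \<comment> \<open>Integrability of the kernels themselves is recovered from two test derivatives
    without a common zero: \<open>f1\<close> vanishes only at the midpoint, where \<open>f2\<close>
    is negative. Both are derivatives of polynomials that vanish at \<open>c\<close> and
    \<open>d\<close>, and the continuous functions \<open>g1\<close>, \<open>g2\<close> satisfy
    \<open>f1 g1 + f2 g2 = 1\<close>.\<close>
  define f1 where "f1 u = u - m" for u
  define f2 where "f2 u = 3 * (u - m)\<^sup>2 - ((d - c) / 2)\<^sup>2" for u
  define g1 where "g1 u = f1 u / ((f1 u)\<^sup>2 + (f2 u)\<^sup>2)" for u
  define g2 where "g2 u = f2 u / ((f1 u)\<^sup>2 + (f2 u)\<^sup>2)" for u
  have pos: "(f1 u)\<^sup>2 + (f2 u)\<^sup>2 \<noteq> 0" for u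
    using cd by (auto simp: f1_def f2_def sum_power2_eq_zero_iff)
  have cf: "continuous_on A f1" "continuous_on A f2" for A
    unfolding f1_def f2_def by (intro continuous_intros)+
  have cg: "continuous_on A g1" "continuous_on A g2" for A
    unfolding g1_def g2_def using pos cf by (auto intro!: continuous_intros)
  have fg: "f1 u * g1 u + f2 u * g2 u = 1" for u
    using pos[of u] by (simp add: g1_def g2_def add_divide_distrib[symmetric] power2_eq_square)
  define \<Phi>1 where "\<Phi>1 u = ((u - m)\<^sup>2 - ((d - c) / 2)\<^sup>2) / 2" for u
  define \<Phi>2 where "\<Phi>2 u = (u - m) * ((u - m)\<^sup>2 - ((d - c) / 2)\<^sup>2)" for u
  have ends: "c - m = - ((d - c) / 2)" "d - m = (d - c) / 2"
    by (auto simp: m_def field_simps)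
  have d1: "has_deriv_on c d \<Phi>1 f1"
    unfolding \<Phi>1_def f1_def has_real_derivative_iff_has_vector_derivative[symmetric]
    by (auto intro!: derivative_eq_intros simp: field_simps)
  have "((\<lambda>u. (u - m) * ((u - m)\<^sup>2 - e)) has_real_derivative 3 * (u - m)\<^sup>2 - e) (at u within A)" for e u A
    by (auto intro!: derivative_eq_intros simp: algebra_simps power2_eq_square)
  then have d2: "has_deriv_on c d \<Phi>2 f2"
    unfolding \<Phi>2_def f2_def has_real_derivative_iff_has_vector_derivative[symmetric] by blast
  have r1: "\<forall>t\<in>{c..d}. combined_caputo_exists \<alpha> \<beta> c d \<Phi>1 t"
    using reg[OF d1 cf(1)] by (simp only: \<Phi>1_def ends) simp
  have r2: "\<forall>t\<in>{c..d}. combined_caputo_exists \<alpha> \<beta> c d \<Phi>2 t"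
    using reg[OF d2 cf(2)] by (simp only: \<Phi>2_def ends) simp
  have split: "k absolutely_integrable_on {p..q}"
    if "(\<lambda>u. k u * f1 u) absolutely_integrable_on {p..q}" "(\<lambda>u. k u * f2 u) absolutely_integrable_on {p..q}"
    for k p q
  proof -
    have "(\<lambda>u. k u * f1 u * g1 u + k u * f2 u * g2 u) absolutely_integrable_on {p..q}"
      by (intro set_integral_add(1) absolutely_integrable_mult_continuous[OF that(1) cg(1)] absolutely_integrable_mult_continuous[OF that(2) cg(2)])
    moreover have "(\<lambda>u. k u * f1 u * g1 u + k u * f2 u * g2 u) = k"
    proof
      fix u
      have "k u * f1 u * g1 u + k u * f2 u * g2 u = k u * (f1 u * g1 u + f2 u * g2 u)"
        by (simp add: algebra_simps)
      then show "k u * f1 u * g1 u + k u * f2 u * g2 u = k u" by (simp add: fg)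
    qed
    ultimately show ?thesis by simp
  qed
  have ka: "(\<lambda>u. vo_kernel \<alpha> t u) absolutely_integrable_on {c..t}"
    and kb: "(\<lambda>u. vo_kernel \<beta> u t) absolutely_integrable_on {t..d}" if t: "t \<in> {c..d}" for t
    using combined_caputo_exists_eq[OF cd t d1] combined_caputo_exists_eq[OF cd t d2] r1 r2 t
    by (blast intro: split)+
  define \<mu> where "\<mu> t f = fst \<gamma> * integral {c..t} (\<lambda>u. vo_kernel \<alpha> t u * f u)
      - snd \<gamma> * integral {t..d} (\<lambda>u. vo_kernel \<beta> u t * f u)" for t f
  have ia: "(\<lambda>u. vo_kernel \<alpha> t u * f u) integrable_on {c..t}"
    and ib: "(\<lambda>u. vo_kernel \<beta> u t * f u) integrable_on {t..d}"
    if "t \<in> {c..d}" "continuous_on {c..d} f" for t f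
    using that ka[OF that(1)] kb[OF that(1)]
    by (auto intro!: integrable_mult_continuous elim!: continuous_on_subset)
  \<comment> \<open>The primitive of a function of mean zero vanishes at both ends, so it is one of
    the functions covered by \<open>reg\<close>.\<close>
  have mean0: "\<exists>M. \<forall>t\<in>{c..d}. \<bar>\<mu> t f\<bar> \<le> M" if f: "continuous_on {c..d} f" "integral {c..d} f = 0" for f
  proof -
    define \<phi> where "\<phi> u = integral {c..u} f" for u
    have d\<phi>: "has_deriv_on c d \<phi> f"
      unfolding \<phi>_def using f by (auto intro: integral_has_vector_derivative)
    have "\<exists>M. \<forall>t\<in>{c..d}. \<bar>combined_caputo \<gamma> \<alpha> \<beta> c d \<phi> t\<bar> \<le> M"
      using reg[OF d\<phi> f(1)] f by (simp add: \<phi>_def)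
    moreover have "combined_caputo \<gamma> \<alpha> \<beta> c d \<phi> t = \<mu> t f" if t: "t \<in> {c..d}" for t
      unfolding combined_caputo_def caputo_left_eq[OF cd t d\<phi>] caputo_right_eq[OF cd t d\<phi>]
      by (simp add: \<mu>_def)
    ultimately show ?thesis by auto
  qed
  have lin: "\<mu> t (\<lambda>u. f u + r * h u) = \<mu> t f + r * \<mu> t h"
    if "t \<in> {c..d}" "continuous_on {c..d} f" "continuous_on {c..d} h" for t r f h
  proof -
    have "integral {c..t} (\<lambda>u. vo_kernel \<alpha> t u * (f u + r * h u))
      = integral {c..t} (\<lambda>u. vo_kernel \<alpha> t u * f u) + r * integral {c..t} (\<lambda>u. vo_kernel \<alpha> t u * h u)"
      using that ia by (simp add: distrib_left mult.left_commute[of _ r] integral_add integrable_on_mult_right)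
    moreover have "integral {t..d} (\<lambda>u. vo_kernel \<beta> u t * (f u + r * h u))
      = integral {t..d} (\<lambda>u. vo_kernel \<beta> u t * f u) + r * integral {t..d} (\<lambda>u. vo_kernel \<beta> u t * h u)"
      using that ib by (simp add: distrib_left mult.left_commute[of _ r] integral_add integrable_on_mult_right)
    ultimately show ?thesis by (simp add: \<mu>_def algebra_simps)
  qed
  \<comment> \<open>With a quarter of the length, the support of \<open>h1\<close> in
    \<open>{c..c + \<rho>}\<close> keeps distance at least \<open>\<rho>\<close> from every
    \<open>t\<close> in the right half, and that of \<open>h2\<close> from every \<open>t\<close> in
    the left half. Each hat is used for the opposite half only.\<close>
  define \<rho> where "\<rho> = (d - c) / 4"
  have \<rho>: "0 < \<rho>" using cd by (simp add: \<rho>_def)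
  define h1 where "h1 u = max 0 (c + \<rho> - u)" for u
  define h2 where "h2 u = max 0 (u - (d - \<rho>))" for u
  have ch: "continuous_on A h1" "continuous_on A h2" for A
    unfolding h1_def h2_def by (intro continuous_intros)+
  have pos_int: "integral {c..d} h \<noteq> 0"
    if "\<And>A. continuous_on A h" "\<And>u. 0 \<le> h u" "u \<in> {c..d}" "h u \<noteq> 0" for h :: "real \<Rightarrow> real" and u
  proof
    assume "integral {c..d} h = 0"
    then have "(h has_integral 0) (cbox c d)"
      using integrable_integral[OF integrable_continuous_real[OF that(1)], of c d] by simp
    then have "h u = 0"
      using has_integral_0_cbox_imp_0[of c d h u] that cd by auto
    then show False using that(4) by simp
  qed
  have h1int: "integral {c..d} h1 \<noteq> 0"
    by (rule pos_int[OF ch(1), of c]) (use cd \<rho> in \<open>auto simp: h1_def\<close>)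
  have h2int: "integral {c..d} h2 \<noteq> 0"
    by (rule pos_int[OF ch(2), of d]) (use cd \<rho> in \<open>auto simp: h2_def\<close>)
  obtain B where B: "\<And>\<alpha> c d t u. variable_order c d \<alpha> \<Longrightarrow> t \<in> {c..d} \<Longrightarrow> u \<in> {c..d} \<Longrightarrow> \<rho> \<le> t - u \<Longrightarrow>
    vo_kernel \<alpha> t u \<le> B" and B0: "0 \<le> B"
    using vo_kernel_bound_off_diagonal[OF \<rho>] by blast
  have off: "\<bar>integral {p..q} (\<lambda>u. k u * h u)\<bar> \<le> B * \<rho> * (d - c)"
    if pq: "c \<le> p" "p \<le> q" "q \<le> d" and int: "(\<lambda>u. k u * h u) integrable_on {p..q}"
      and k: "\<And>u. u \<in> {p..q} \<Longrightarrow> 0 \<le> k u \<and> (h u \<noteq> 0 \<longrightarrow> k u \<le> B) \<and> \<bar>h u\<bar> \<le> \<rho>"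
    for k h :: "real \<Rightarrow> real" and p q
  proof -
    have "norm (integral {p..q} (\<lambda>u. k u * h u)) \<le> integral {p..q} (\<lambda>u. B * \<rho>)"
    proof (rule integral_norm_bound_integral[OF int])
      fix u assume "u \<in> {p..q}"
      from k[OF this] show "norm (k u * h u) \<le> B * \<rho>"
        using B0 \<rho> by (cases "h u = 0") (auto simp: abs_mult intro!: mult_mono)
    qed auto
    also have "\<dots> = B * \<rho> * (q - p)" using pq by simp
    also have "\<dots> \<le> B * \<rho> * (d - c)" using pq B0 \<rho> by (intro mult_left_mono) auto
    finally show ?thesis by simp
  qed
  have \<mu>h1: "\<bar>\<mu> t h1\<bar> \<le> fst \<gamma> * (B * \<rho> * (d - c))" if t: "t \<in> {m..d}" for t
  proof -
    have t': "t \<in> {c..d}" and mt: "m \<le> t" using t cd by (auto simp: m_def)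
    have "integral {t..d} (\<lambda>u. vo_kernel \<beta> u t * h1 u) = integral {t..d} (\<lambda>u. 0)"
      using mt cd by (intro integral_cong) (auto simp: h1_def \<rho>_def m_def field_simps)
    moreover have "\<bar>integral {c..t} (\<lambda>u. vo_kernel \<alpha> t u * h1 u)\<bar> \<le> B * \<rho> * (d - c)"
    proof (rule off[OF _ _ _ ia[OF t' ch(1)]])
      fix u assume u: "u \<in> {c..t}"
      then have u': "u \<in> {c..d}" using t' by auto
      have "h1 u \<noteq> 0 \<longrightarrow> u \<le> c + \<rho>" by (auto simp: h1_def max_def)
      then have "h1 u \<noteq> 0 \<longrightarrow> \<rho> \<le> t - u" using mt by (auto simp: \<rho>_def m_def field_simps)
      moreover have "\<bar>h1 u\<bar> \<le> \<rho>" using u \<rho> by (auto simp: h1_def)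
      ultimately show "0 \<le> vo_kernel \<alpha> t u \<and> (h1 u \<noteq> 0 \<longrightarrow> vo_kernel \<alpha> t u \<le> B) \<and> \<bar>h1 u\<bar> \<le> \<rho>"
        using vo_kernel_nonneg[OF \<alpha> t' u'] B[OF \<alpha> t' u'] by blast
    qed (use t' in auto)
    ultimately show ?thesis
      using \<gamma> by (auto simp: \<mu>_def abs_mult intro!: mult_left_mono)
  qed
  have \<mu>h2: "\<bar>\<mu> t h2\<bar> \<le> snd \<gamma> * (B * \<rho> * (d - c))" if t: "t \<in> {c..m}" for t
  proof -
    have t': "t \<in> {c..d}" and mt: "t \<le> m" using t cd by (auto simp: m_def)
    have "integral {c..t} (\<lambda>u. vo_kernel \<alpha> t u * h2 u) = integral {c..t} (\<lambda>u. 0)"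
      using mt cd by (intro integral_cong) (auto simp: h2_def \<rho>_def m_def field_simps)
    moreover have "\<bar>integral {t..d} (\<lambda>u. vo_kernel \<beta> u t * h2 u)\<bar> \<le> B * \<rho> * (d - c)"
    proof (rule off[OF _ _ _ ib[OF t' ch(2)]])
      fix u assume u: "u \<in> {t..d}"
      then have u': "u \<in> {c..d}" using t' by auto
      have "h2 u \<noteq> 0 \<longrightarrow> d - \<rho> \<le> u" by (auto simp: h2_def max_def)
      then have "h2 u \<noteq> 0 \<longrightarrow> \<rho> \<le> u - t" using mt by (auto simp: \<rho>_def m_def field_simps)
      moreover have "\<bar>h2 u\<bar> \<le> \<rho>" using u \<rho> by (auto simp: h2_def)
      ultimately show "0 \<le> vo_kernel \<beta> u t \<and> (h2 u \<noteq> 0 \<longrightarrow> vo_kernel \<beta> u t \<le> B) \<and> \<bar>h2 u\<bar> \<le> \<rho>"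
        using vo_kernel_nonneg[OF \<beta> u' t'] B[OF \<beta> u' t'] by blast
    qed (use t' in auto)
    ultimately show ?thesis
      using \<gamma> by (auto simp: \<mu>_def abs_mult intro!: mult_left_mono)
  qed
  have half: "\<exists>M. \<forall>t\<in>A. \<bar>\<mu> t f\<bar> \<le> M"
    if A: "A \<subseteq> {c..d}" and f: "continuous_on {c..d} f" and h: "\<And>A. continuous_on A h" "integral {c..d} h \<noteq> 0"
      and bd: "\<And>t. t \<in> A \<Longrightarrow> \<bar>\<mu> t h\<bar> \<le> N" for A f h N
  proof -
    \<comment> \<open>This multiple of the hat \<open>h\<close> carries the whole mean of
      \<open>f\<close>, so \<open>f - r h\<close> falls under \<open>mean0\<close>.\<close>
    define r where "r = integral {c..d} f / integral {c..d} h"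
    have "integral {c..d} (\<lambda>u. f u + (- r) * h u) = integral {c..d} f + (- r) * integral {c..d} h"
      using f h by (subst integral_add) (auto intro!: integrable_continuous_real continuous_intros)
    also have "\<dots> = 0" using h by (simp add: r_def)
    finally have i0: "integral {c..d} (\<lambda>u. f u + (- r) * h u) = 0" .
    have "continuous_on {c..d} (\<lambda>u. f u + (- r) * h u)"
      by (intro continuous_intros f h)
    then obtain M where M: "\<forall>t\<in>{c..d}. \<bar>\<mu> t (\<lambda>u. f u + (- r) * h u)\<bar> \<le> M"
      using mean0 i0 by blast
    have "\<bar>\<mu> t f\<bar> \<le> M + \<bar>r\<bar> * N" if t: "t \<in> A" for t
    proof -
      have t': "t \<in> {c..d}" using t A by blast
      have "\<mu> t f = \<mu> t (\<lambda>u. f u + (- r) * h u) + r * \<mu> t h"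
        using lin[OF t' f h(1), of "- r"] by simp
      moreover have "\<bar>r * \<mu> t h\<bar> \<le> \<bar>r\<bar> * N"
        using bd[OF t] by (auto simp: abs_mult intro!: mult_left_mono)
      ultimately show ?thesis using M t' by (smt (verit))
    qed
    then show ?thesis by blast
  qed
  have pt: "\<exists>M. \<forall>t\<in>{c..d}. \<bar>\<mu> t f\<bar> \<le> M" if f: "continuous_on UNIV f" for f
  proof -
    have f': "continuous_on {c..d} f" using f continuous_on_subset by blast
    have sub: "{c..m} \<subseteq> {c..d}" "{m..d} \<subseteq> {c..d}" using cd by (auto simp: m_def)
    obtain M1 where M1: "\<forall>t\<in>{c..m}. \<bar>\<mu> t f\<bar> \<le> M1"
      using half[OF sub(1) f' ch(2) h2int \<mu>h2] by blast
    obtain M2 where M2: "\<forall>t\<in>{m..d}. \<bar>\<mu> t f\<bar> \<le> M2"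
      using half[OF sub(2) f' ch(1) h1int \<mu>h1] by blast
    have "\<bar>\<mu> t f\<bar> \<le> max M1 M2" if "t \<in> {c..d}" for t
      using M1 M2 that by (cases "t \<le> m") (auto simp: le_max_iff_disj)
    then show ?thesis by blast
  qed
  \<comment> \<open>The weights are absorbed into the two kernels; being nonnegative, they preserve
    the opposite signs on which the separation of the two parts relies.\<close>
  obtain K where K: "\<And>t. t \<in> {c..d} \<Longrightarrow> integral {c..t} (\<lambda>u. fst \<gamma> * vo_kernel \<alpha> t u) \<le> K"
    "\<And>t. t \<in> {c..d} \<Longrightarrow> integral {t..d} (\<lambda>u. snd \<gamma> * vo_kernel \<beta> u t) \<le> K"
  proof (rule two_sided_kernel_bound[of c d "\<lambda>t u. fst \<gamma> * vo_kernel \<alpha> t u" "\<lambda>t u. snd \<gamma> * vo_kernel \<beta> u t"])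
    fix f :: "real \<Rightarrow> real" assume "continuous_on UNIV f"
    from pt[OF this] show "\<exists>M. \<forall>t\<in>{c..d}. \<bar>integral {c..t} (\<lambda>u. fst \<gamma> * vo_kernel \<alpha> t u * f u)
        - integral {t..d} (\<lambda>u. snd \<gamma> * vo_kernel \<beta> u t * f u)\<bar> \<le> M"
      by (simp add: \<mu>_def mult.assoc)
  qed (use ka kb \<gamma> in \<open>auto intro!: set_integrable_mult_right mult_nonneg_nonneg vo_kernel_nonneg[OF \<alpha>] vo_kernel_nonneg[OF \<beta>]\<close>)
  show ?thesis
    unfolding bounded_kernels_def using ka kb K by (intro exI[of _ K]) auto
qed

section \<open>Joint measurability of the kernels and Fubini's theorem with continuous
  factors\<close>

text \<open>Exchanging the variables is measurable for the Borel sets and preserves the product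
  measure, hence null sets; so it carries over to the completion by way of a Borel version. The
  right-sided kernel is the left-sided one with variables exchanged.\<close>

lemma lebesgue_measurable_swap:
  fixes w :: "'a::euclidean_space \<times> 'b::euclidean_space \<Rightarrow> real"
  assumes "w \<in> borel_measurable lebesgue"
  shows "(\<lambda>(x, y). w (y, x)) \<in> borel_measurable lebesgue"
proof -
  obtain w' where w'[measurable]: "w' \<in> borel_measurable borel" and AE: "AE p in lborel. w p = w' p"
    using completion_ex_borel_measurable_real[OF assms] by auto
  have w'2[measurable]: "w' \<in> borel_measurable (borel \<Otimes>\<^sub>M borel)"
    by (simp add: borel_prod)
  have "(\<lambda>(x, y). w' (y, x)) \<in> borel_measurable (borel \<Otimes>\<^sub>M borel)"
    by measurable
  then have 1: "(\<lambda>(x, y). w' (y, x)) \<in> borel_measurable lebesgue"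
    by (intro measurable_completion) (simp add: borel_prod)
  have swap: "(\<lambda>(x, y). (y, x)) \<in> (lborel \<Otimes>\<^sub>M lborel) \<rightarrow>\<^sub>M (lborel \<Otimes>\<^sub>M (lborel :: 'b measure) :: ('a \<times> 'b) measure)"
    by measurable
  have "AE p in lborel \<Otimes>\<^sub>M lborel. w p = w' p"
    using AE by (simp only: lborel_prod)
  then have "AE p in distr (lborel \<Otimes>\<^sub>M lborel) (lborel \<Otimes>\<^sub>M lborel) (\<lambda>(x::'b, y::'a). (y, x)). w p = w' p"
    by (subst (asm) lborel_pair.distr_pair_swap)
  from AE_distrD[OF swap this] have "AE p in lborel. (\<lambda>(x, y). w (y, x)) p = (\<lambda>(x, y). w' (y, x)) p"
    unfolding lborel_prod by (simp only: case_prod_beta')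
  then have "AE p in lebesgue. (\<lambda>(x, y). w' (y, x)) p = (\<lambda>(x, y). w (y, x)) p"
    by (intro AE_completion) (simp add: eq_commute)
  from borel_measurable_AE[OF 1 this] show ?thesis .
qed

text \<open>Through the continuous function \<open>rGamma\<close> the kernel is a measurable
  expression in the variables and the order. The cut-off to the triangle turns integrals over
  \<open>{c..t}\<close> into integrals over the whole of \<open>{c..d}\<close>, as Fubini's theorem
  wants them.\<close>

lemma vo_kernel_measurable_triangle:
  assumes "variable_order c d \<alpha>"
  shows "(\<lambda>p. if snd p \<le> fst p \<and> p \<in> {c..d} \<times> {c..d} then vo_kernel \<alpha> (fst p) (snd p) else 0) \<in> borel_measurable lebesgue"
proof -
  let ?S = "{c..d} \<times> {c..d}"
  have S: "?S \<in> sets lebesgue"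
    by (metis cbox_Pair_eq cbox_interval lmeasurable_cbox fmeasurableD)
  have \<alpha>[measurable]: "(\<lambda>p. \<alpha> (fst p) (snd p)) \<in> borel_measurable (lebesgue_on ?S)"
    using assms by (simp add: variable_order_def case_prod_beta')
  have [measurable]: "fst \<in> borel_measurable (lebesgue_on ?S)" "snd \<in> borel_measurable (lebesgue_on ?S)"
    by (auto intro!: continuous_imp_measurable_on_sets_lebesgue S continuous_intros)
  have rG[measurable]: "(rGamma :: real \<Rightarrow> real) \<in> borel_measurable borel"
    by (intro borel_measurable_continuous_onI continuous_intros)
  have "(\<lambda>p. (fst p - snd p) powr (- \<alpha> (fst p) (snd p)) * rGamma (1 - \<alpha> (fst p) (snd p)))
      \<in> borel_measurable (lebesgue_on ?S)"
    by measurable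
  then have "(\<lambda>p. vo_kernel \<alpha> (fst p) (snd p)) \<in> borel_measurable (lebesgue_on ?S)"
    by (simp add: vo_kernel_def rGamma_inverse_Gamma divide_inverse)
  then have "(\<lambda>p. if p \<in> ?S then vo_kernel \<alpha> (fst p) (snd p) else 0) \<in> borel_measurable lebesgue"
    by (rule iffD2[OF borel_measurable_if[OF S]])
  moreover have "closed {p::real \<times> real. snd p \<le> fst p}"
    by (intro closed_Collect_le continuous_intros)
  then have "{p::real \<times> real. snd p \<le> fst p} \<in> sets lebesgue"
    by (simp add: borel_closed)
  ultimately have "(\<lambda>p. indicator {p. snd p \<le> fst p} p * (if p \<in> ?S then vo_kernel \<alpha> (fst p) (snd p) else 0))
      \<in> borel_measurable lebesgue"
    by (intro borel_measurable_times borel_measurable_indicator)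
  moreover have "(\<lambda>p. indicator {p. snd p \<le> fst p} p * (if p \<in> ?S then vo_kernel \<alpha> (fst p) (snd p) else 0))
      = (\<lambda>p. if snd p \<le> fst p \<and> p \<in> ?S then vo_kernel \<alpha> (fst p) (snd p) else 0)"
    by (auto simp: indicator_def)
  ultimately show ?thesis by simp
qed

text \<open>Extending \<open>u\<close> and \<open>v\<close> by zero gives a function
  \<open>w\<close> on the plane whose sections have mass at most \<open>U V K\<close> over
  \<open>{c..T}\<close> and 0 elsewhere. This bound is integrable because the interval is
  bounded.\<close>

lemma kernel_fubini:
  fixes k :: "real \<times> real \<Rightarrow> real" and u v :: "real \<Rightarrow> real"
  assumes k: "k \<in> borel_measurable lebesgue"
    and sec: "\<And>t. t \<in> {c..T} \<Longrightarrow> (\<lambda>r. k (t, r)) absolutely_integrable_on {c..d}"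
    and bd: "\<And>t. t \<in> {c..T} \<Longrightarrow> integral {c..d} (\<lambda>r. \<bar>k (t, r)\<bar>) \<le> K"
    and u: "continuous_on {c..T} u" and v: "continuous_on {c..d} v"
  obtains I where "((\<lambda>t. u t * integral {c..d} (\<lambda>r. k (t, r) * v r)) has_integral I) {c..T}"
    and "((\<lambda>r. v r * integral {c..T} (\<lambda>t. k (t, r) * u t)) has_integral I) {c..d}"
proof -
  define u0 where "u0 t = (if t \<in> {c..T} then u t else 0)" for t
  define v0 where "v0 t = (if t \<in> {c..d} then v t else 0)" for t
  have "u0 = (\<lambda>t. indicat_real {c..T} t *\<^sub>R u t)" "v0 = (\<lambda>t. indicat_real {c..d} t *\<^sub>R v t)"
    by (auto simp: u0_def v0_def)
  then have u0[measurable]: "u0 \<in> borel_measurable borel" and v0[measurable]: "v0 \<in> borel_measurable borel"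
    using borel_measurable_continuous_on_indicator[OF _ u] borel_measurable_continuous_on_indicator[OF _ v]
    by simp_all
  have [measurable]: "(\<lambda>p. u0 (fst p)) \<in> borel_measurable lebesgue" "(\<lambda>p. v0 (snd p)) \<in> borel_measurable lebesgue"
    by (auto intro!: measurable_completion simp: borel_prod[symmetric])
  define w where "w p = u0 (fst p) * (k p * v0 (snd p))" for p
  have wm: "w \<in> borel_measurable lebesgue"
    unfolding w_def using k by measurable
  have "bounded (u ` {c..T})" "bounded (v ` {c..d})"
    using u v by (auto intro!: compact_imp_bounded compact_continuous_image)
  then obtain U V where U: "\<forall>t\<in>{c..T}. \<bar>u t\<bar> \<le> U" "0 < U" and V: "\<forall>t\<in>{c..d}. \<bar>v t\<bar> \<le> V" "0 < V"
    by (force simp: bounded_pos)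
  have weq: "w (t, r) = (if r \<in> {c..d} then u0 t * (k (t, r) * v r) else 0)" for t r
    by (simp add: w_def v0_def)
  have weq2: "w (t, r) = (if t \<in> {c..T} then v0 r * (k (t, r) * u t) else 0)" for t r
    by (simp add: w_def u0_def)
  have kv: "(\<lambda>r. k (t, r) * v r) absolutely_integrable_on {c..d}" if "t \<in> {c..T}" for t
    using absolutely_integrable_mult_continuous[OF sec[OF that] v] .
  have ws: "(\<lambda>r. w (t, r)) absolutely_integrable_on UNIV" for t
  proof (cases "t \<in> {c..T}")
    case True
    show ?thesis
      unfolding weq absolutely_integrable_restrict_UNIV
      using set_integrable_mult_right[OF kv[OF True]] .
  next
    case False
    then have "u0 t = 0" by (auto simp: u0_def)
    with False show ?thesis by (simp add: w_def)
  qed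
  have wb: "integral UNIV (\<lambda>r. \<bar>w (t, r)\<bar>) \<le> U * V * K * indicator {c..T} t" for t
  proof (cases "t \<in> {c..T}")
    case True
    have "integral UNIV (\<lambda>r. \<bar>w (t, r)\<bar>) = integral {c..d} (\<lambda>r. \<bar>u t * (k (t, r) * v r)\<bar>)"
      using True by (subst integral_restrict_UNIV[symmetric]) (auto intro!: integral_cong simp: weq u0_def)
    also have "\<dots> \<le> integral {c..d} (\<lambda>r. U * V * \<bar>k (t, r)\<bar>)"
    proof (rule integral_le)
      show "(\<lambda>r. \<bar>u t * (k (t, r) * v r)\<bar>) integrable_on {c..d}"
        using set_integrable_mult_right[OF kv[OF True], of "u t"] by (auto simp: absolutely_integrable_on_def)
      show "(\<lambda>r. U * V * \<bar>k (t, r)\<bar>) integrable_on {c..d}"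
        using sec[OF True] by (auto simp: absolutely_integrable_on_def intro!: integrable_on_mult_right)
      fix r assume "r \<in> {c..d}"
      then have "\<bar>u t\<bar> * \<bar>v r\<bar> * \<bar>k (t, r)\<bar> \<le> U * V * \<bar>k (t, r)\<bar>"
        using U V True by (intro mult_right_mono mult_mono) auto
      then show "\<bar>u t * (k (t, r) * v r)\<bar> \<le> U * V * \<bar>k (t, r)\<bar>"
        by (simp add: abs_mult mult_ac)
    qed
    also have "\<dots> \<le> U * V * K"
      using bd[OF True] U V by (auto intro!: mult_left_mono)
    finally show ?thesis using True by simp
  next
    case False
    then have "u0 t = 0" by (auto simp: u0_def)
    with False show ?thesis by (simp add: w_def)
  qed
  have "integrable lborel (\<lambda>t. U * V * K * indicator {c..T} t)"
    by (intro integrable_mult_right) (use emeasure_bounded_finite[of "{c..T}"] in \<open>simp add: integrable_indicator_iff bounded_closed_interval del: emeasure_lborel_Icc_eq\<close>)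
  from fubini_bounded_sections[OF wm ws wb this] obtain I where
    I1: "((\<lambda>t. integral UNIV (\<lambda>r. w (t, r))) has_integral I) UNIV" and
    I2: "((\<lambda>r. integral UNIV (\<lambda>t. w (t, r))) has_integral I) UNIV"
    by blast
  show thesis
  proof (rule that)
    have "integral UNIV (\<lambda>r. w (t, r)) = (if t \<in> {c..T} then u t * integral {c..d} (\<lambda>r. k (t, r) * v r) else 0)" for t
      unfolding weq integral_restrict_UNIV by (simp add: u0_def)
    then show "((\<lambda>t. u t * integral {c..d} (\<lambda>r. k (t, r) * v r)) has_integral I) {c..T}"
      using I1 by (simp only: has_integral_restrict_UNIV)
    have "integral UNIV (\<lambda>t. w (t, r)) = (if r \<in> {c..d} then v r * integral {c..T} (\<lambda>t. k (t, r) * u t) else 0)" for r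
      unfolding weq2 integral_restrict_UNIV by (simp add: v0_def)
    then show "((\<lambda>r. v r * integral {c..T} (\<lambda>t. k (t, r) * u t)) has_integral I) {c..d}"
      using I2 by (simp only: has_integral_restrict_UNIV)
  qed
qed

section \<open>Fractional integration by parts\<close>

lemma rl_left_deriv_eq:
  "rl_left_deriv \<beta> c d y t = vector_derivative (\<lambda>r. integral {c..r} (\<lambda>u. vo_kernel \<beta> r u * y u)) (at t within {c..d})"
  by (simp add: rl_left_deriv_def vo_kernel_def)

lemma rl_left_deriv_existsD:
  assumes "rl_left_deriv_exists \<beta> c d y"
  shows "c < d"
    and "t \<in> {c..d} \<Longrightarrow> (\<lambda>u. vo_kernel \<beta> t u * y u) absolutely_integrable_on {c..t}"
    and "t \<in> {c..d} \<Longrightarrow> ((\<lambda>r. integral {c..r} (\<lambda>u. vo_kernel \<beta> r u * y u)) has_vector_derivative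
      rl_left_deriv \<beta> c d y t) (at t within {c..d})"
  using assms unfolding rl_left_deriv_exists_def rl_left_deriv_eq vector_derivative_works[symmetric]
  by (auto simp: vo_kernel_def)

text \<open>The integral from \<open>c\<close> to \<open>r\<close> does not see the right end of the
  interval; only the one-sidedness of the derivative at \<open>T\<close> changes, and relative to
  the nondegenerate \<open>{c..T}\<close> the derivative is unique.\<close>

lemma rl_left_deriv_subinterval:
  assumes "rl_left_deriv_exists \<beta> c d y" "c < T" "T \<le> d" "t \<in> {c..T}"
  shows "rl_left_deriv \<beta> c T y t = rl_left_deriv \<beta> c d y t"
proof -
  have "((\<lambda>r. integral {c..r} (\<lambda>u. vo_kernel \<beta> r u * y u)) has_vector_derivative
      rl_left_deriv \<beta> c d y t) (at t within {c..T})"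
    using assms by (intro has_vector_derivative_within_subset[OF rl_left_deriv_existsD(3)[OF assms(1)]]) auto
  then show ?thesis
    unfolding rl_left_deriv_eq[of \<beta> c T] using assms by (intro vector_derivative_within_closed_interval) auto
qed

lemma rl_right_deriv_existsD:
  assumes "rl_right_deriv_exists \<alpha> c d y" "t \<in> {c..d}"
  shows "((\<lambda>r. - integral {r..d} (\<lambda>u. vo_kernel \<alpha> u r * y u)) has_vector_derivative
      rl_right_deriv \<alpha> c d y t) (at t within {c..d})"
proof -
  have "(\<lambda>r. integral {r..d} (\<lambda>u. - ((u - r) powr (- \<alpha> u r)) / Gamma (1 - \<alpha> u r) * y u))
      = (\<lambda>r. - integral {r..d} (\<lambda>u. vo_kernel \<alpha> u r * y u))"
    by (simp add: vo_kernel_def)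
  then show ?thesis
    using assms by (simp only: rl_right_deriv_exists_def rl_right_deriv_def vector_derivative_works[symmetric])
qed

lemma absolutely_integrable_extend_zero:
  fixes k :: "real \<Rightarrow> real"
  assumes "k absolutely_integrable_on S" "S \<subseteq> {c..d}"
  shows "(\<lambda>u. if u \<in> S then k u else 0) absolutely_integrable_on {c..d}"
proof -
  have "(\<lambda>u. if u \<in> {c..d} then (if u \<in> S then k u else 0) else 0) = (\<lambda>u. if u \<in> S then k u else 0)"
    by (rule ext) (use assms(2) in auto)
  then show ?thesis
    using assms(1) absolutely_integrable_restrict_UNIV[of S k]
      absolutely_integrable_restrict_UNIV[of "{c..d}" "\<lambda>u. if u \<in> S then k u else 0"] by simp
qed

text \<open>Here \<open>k\<close> is the jointly measurable extension by zero of
  \<open>\<kappa>\<close> from the sections \<open>S t\<close>. In the second integral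
  \<open>k\<close> is kept: its sections in the other direction depend on the shape of the region
  and are worked out separately for the left and the right kernel.\<close>

lemma kernel_fubini_sections:
  fixes k :: "real \<times> real \<Rightarrow> real" and \<kappa> :: "real \<Rightarrow> real \<Rightarrow> real"
  assumes k: "k \<in> borel_measurable lebesgue"
    and S: "\<And>t. t \<in> {c..T} \<Longrightarrow> S t \<subseteq> {c..d}"
    and eq: "\<And>t u. t \<in> {c..T} \<Longrightarrow> k (t, u) = (if u \<in> S t then \<kappa> t u else 0)"
    and nn: "\<And>t u. t \<in> {c..T} \<Longrightarrow> u \<in> S t \<Longrightarrow> 0 \<le> \<kappa> t u"
    and int: "\<And>t. t \<in> {c..T} \<Longrightarrow> \<kappa> t absolutely_integrable_on S t"
    and K: "\<And>t. t \<in> {c..T} \<Longrightarrow> integral (S t) (\<kappa> t) \<le> K"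
    and u: "continuous_on {c..T} F" and v: "continuous_on {c..d} v"
  obtains I where "((\<lambda>t. F t * integral (S t) (\<lambda>u. \<kappa> t u * v u)) has_integral I) {c..T}"
    and "((\<lambda>u. v u * integral {c..T} (\<lambda>t. k (t, u) * F t)) has_integral I) {c..d}"
proof -
  have restr: "integral {c..d} (\<lambda>u. if u \<in> S t then f u else 0) = integral (S t) f" if "t \<in> {c..T}" for t and f :: "real \<Rightarrow> real"
    unfolding Henstock_Kurzweil_Integration.integral_restrict_Int using S[OF that] by (simp only: Int_absorb2)
  obtain I where I: "((\<lambda>t. F t * integral {c..d} (\<lambda>u. k (t, u) * v u)) has_integral I) {c..T}"
    "((\<lambda>u. v u * integral {c..T} (\<lambda>t. k (t, u) * F t)) has_integral I) {c..d}"
  proof (rule kernel_fubini[OF k _ _ u v])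
    fix t assume t: "t \<in> {c..T}"
    show "(\<lambda>u. k (t, u)) absolutely_integrable_on {c..d}"
      unfolding eq[OF t] by (rule absolutely_integrable_extend_zero[OF int[OF t] S[OF t]])
    have "integral {c..d} (\<lambda>u. \<bar>k (t, u)\<bar>) = integral {c..d} (\<lambda>u. if u \<in> S t then \<kappa> t u else 0)"
      by (intro integral_cong) (simp add: eq[OF t] nn[OF t])
    then show "integral {c..d} (\<lambda>u. \<bar>k (t, u)\<bar>) \<le> K"
      using K[OF t] by (simp add: restr[OF t])
  qed
  have "F t * integral {c..d} (\<lambda>u. k (t, u) * v u) = F t * integral (S t) (\<lambda>u. \<kappa> t u * v u)" if t: "t \<in> {c..T}" for t
    unfolding restr[OF t, symmetric] by (intro arg_cong2[where f = "(*)"] refl integral_cong) (simp add: eq[OF t])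
  from that[OF has_integral_eq[OF this I(1)] I(2)] show thesis .
qed

text \<open>Fubini on the triangle turns the left side into the integral of \<open>- h' G\<close>,
  where \<open>G\<close> is a primitive of the right derivative of \<open>F\<close>. The product
  rule for \<open>h G\<close> then shifts the derivative. The boundary term at \<open>c\<close>
  vanishes by \<open>h c = 0\<close>, the one at \<open>T\<close> because \<open>G T\<close> is an
  integral over a single point; thus \<open>h T\<close> may be arbitrary.\<close>

lemma left_fractional_parts:
  assumes cT: "c < T" "T \<le> d" and \<alpha>: "variable_order c d \<alpha>"
    and ki: "\<And>t. t \<in> {c..d} \<Longrightarrow> (\<lambda>u. vo_kernel \<alpha> t u) absolutely_integrable_on {c..t}"
    and K: "\<And>t. t \<in> {c..d} \<Longrightarrow> integral {c..t} (\<lambda>u. vo_kernel \<alpha> t u) \<le> K"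
    and F: "continuous_on {c..T} F"
    and h: "has_deriv_on c d h h'"
    and h': "continuous_on {c..d} h'" and hc: "h c = 0"
    and ex: "rl_right_deriv_exists \<alpha> c T F"
  obtains I where "((\<lambda>t. F t * caputo_left \<alpha> c d h t) has_integral I) {c..T}"
    and "((\<lambda>t. h t * rl_right_deriv \<alpha> c T F t) has_integral I) {c..T}"
proof -
  define k where "k p = (if snd p \<le> fst p \<and> p \<in> {c..d} \<times> {c..d} then vo_kernel \<alpha> (fst p) (snd p) else 0)"
    for p :: "real \<times> real"
  have km: "k \<in> borel_measurable lebesgue"
    unfolding k_def by (rule vo_kernel_measurable_triangle[OF \<alpha>])
  have k1: "k (t, u) = (if u \<in> {c..t} then vo_kernel \<alpha> t u else 0)" if "t \<in> {c..T}" for t u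
    using that cT by (auto simp: k_def)
  have k2: "k (t, u) = (if t \<in> {u..T} then vo_kernel \<alpha> t u else 0)" if "t \<in> {c..T}" "u \<in> {c..d}" for t u
    using that cT by (auto simp: k_def)
  have cd: "c < d" using cT by simp
  obtain I where I1: "((\<lambda>t. F t * integral {c..t} (\<lambda>u. vo_kernel \<alpha> t u * h' u)) has_integral I) {c..T}"
    and I2: "((\<lambda>u. h' u * integral {c..T} (\<lambda>t. k (t, u) * F t)) has_integral I) {c..d}"
    by (rule kernel_fubini_sections[OF km _ k1 vo_kernel_nonneg[OF \<alpha>] ki K F h']) (use cT in auto)
  have 1: "((\<lambda>t. F t * caputo_left \<alpha> c d h t) has_integral I) {c..T}"
    by (rule has_integral_eq[OF _ I1]) (use cT in \<open>simp add: caputo_left_eq[OF cd _ h]\<close>)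
  define G where "G r = - integral {r..T} (\<lambda>u. vo_kernel \<alpha> u r * F u)" for r
  have G: "integral {c..T} (\<lambda>t. k (t, u) * F t) = (if u \<in> {c..T} then - G u else 0)" if u: "u \<in> {c..d}" for u
  proof -
    have "integral {c..T} (\<lambda>t. k (t, u) * F t) = integral {c..T} (\<lambda>t. if t \<in> {u..T} then vo_kernel \<alpha> t u * F t else 0)"
      using u by (intro integral_cong) (simp add: k2)
    also have "\<dots> = integral {u..T} (\<lambda>t. vo_kernel \<alpha> t u * F t)"
      unfolding Henstock_Kurzweil_Integration.integral_restrict_Int using u
      by (intro arg_cong2[where f = integral]) auto
    finally show ?thesis using u by (auto simp: G_def)
  qed
  have "((\<lambda>u. if u \<in> {c..T} then h' u * - G u else 0) has_integral I) {c..d}"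
    by (rule has_integral_eq[OF _ I2]) (auto simp: G)
  then have 2: "((\<lambda>u. h' u * - G u) has_integral I) {c..T}"
    by (subst (asm) has_integral_restrict) (use cT in auto)
  have "((\<lambda>t. h' t * G t + h t * rl_right_deriv \<alpha> c T F t) has_integral (h T * G T - h c * G c)) {c..T}"
  proof (rule fundamental_theorem_of_calculus)
    fix t assume t: "t \<in> {c..T}"
    have "(h has_vector_derivative h' t) (at t within {c..T})"
      by (rule has_vector_derivative_within_subset[OF bspec[OF h]]) (use t cT in auto)
    moreover have "(G has_vector_derivative rl_right_deriv \<alpha> c T F t) (at t within {c..T})"
      using rl_right_deriv_existsD[OF ex t] by (simp add: G_def[abs_def])
    ultimately show "((\<lambda>t. h t * G t) has_vector_derivative h' t * G t + h t * rl_right_deriv \<alpha> c T F t) (at t within {c..T})"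
      by (auto intro!: derivative_eq_intros)
  qed (use cT in auto)
  from has_integral_add[OF this 2]
  have "((\<lambda>t. h t * rl_right_deriv \<alpha> c T F t) has_integral I) {c..T}"
    by (simp add: hc G_def)
  with 1 show thesis by (rule that)
qed

text \<open>The region of integration is a trapezoid: \<open>t\<close> runs up to \<open>T\<close>,
  but \<open>u\<close> runs from \<open>t\<close> up to \<open>d\<close>. Integrating over
  \<open>t\<close> gives \<open>H u\<close> for \<open>u\<close> before \<open>T\<close> and
  \<open>H u - HT u\<close> after it, and the product rule is applied on the two pieces separately.
  The tail \<open>I2\<close> is what becomes the second equation of the theorem.\<close>

lemma right_fractional_parts:
  assumes cT: "c < T" "T \<le> d" and \<beta>: "variable_order c d \<beta>"
    and ki: "\<And>t. t \<in> {c..d} \<Longrightarrow> (\<lambda>u. vo_kernel \<beta> u t) absolutely_integrable_on {t..d}"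
    and K: "\<And>t. t \<in> {c..d} \<Longrightarrow> integral {t..d} (\<lambda>u. vo_kernel \<beta> u t) \<le> K"
    and F: "continuous_on {c..T} F"
    and h: "has_deriv_on c d h h'"
    and h': "continuous_on {c..d} h'" and hc: "h c = 0" and hd: "h d = 0"
    and ex: "rl_left_deriv_exists \<beta> c d F" and exT: "T < d \<Longrightarrow> rl_left_deriv_exists \<beta> T d F"
  obtains I1 I2 where "((\<lambda>t. F t * caputo_right \<beta> c d h t) has_integral (I1 + I2)) {c..T}"
    and "((\<lambda>t. h t * rl_left_deriv \<beta> c T F t) has_integral I1) {c..T}"
    and "((\<lambda>t. h t * (rl_left_deriv \<beta> c d F t - rl_left_deriv \<beta> T d F t)) has_integral I2) {T..d}"
proof -
  define k0 where "k0 p = (if snd p \<le> fst p \<and> p \<in> {c..d} \<times> {c..d} then vo_kernel \<beta> (fst p) (snd p) else 0)"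
    for p :: "real \<times> real"
  define k where "k = (\<lambda>(t, u). k0 (u, t))"
  have km0: "k0 \<in> borel_measurable lebesgue"
    unfolding k0_def by (rule vo_kernel_measurable_triangle[OF \<beta>])
  have km: "k \<in> borel_measurable lebesgue"
    unfolding k_def by (rule lebesgue_measurable_swap[OF km0])
  have k1: "k (t, u) = (if u \<in> {t..d} then vo_kernel \<beta> u t else 0)" if "t \<in> {c..T}" for t u
    using that cT by (auto simp: k0_def k_def)
  have k2: "k (t, u) = (if t \<in> {c..u} then vo_kernel \<beta> u t else 0)" if "t \<in> {c..T}" "u \<in> {c..d}" for t u
    using that cT by (auto simp: k0_def k_def)
  have cd: "c < d" using cT by simp
  obtain I where I1: "((\<lambda>t. F t * integral {t..d} (\<lambda>u. vo_kernel \<beta> u t * h' u)) has_integral I) {c..T}"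
    and I2: "((\<lambda>u. h' u * integral {c..T} (\<lambda>t. k (t, u) * F t)) has_integral I) {c..d}"
    by (rule kernel_fubini_sections[OF km _ k1 vo_kernel_nonneg[OF \<beta>] ki K F h']) (use cT in auto)
  have 1: "((\<lambda>t. F t * caputo_right \<beta> c d h t) has_integral - I) {c..T}"
    by (rule has_integral_eq[OF _ has_integral_neg[OF I1]]) (use cT in \<open>simp add: caputo_right_eq[OF cd _ h]\<close>)
  define H where "H r = integral {c..r} (\<lambda>u. vo_kernel \<beta> r u * F u)" for r
  define HT where "HT r = integral {T..r} (\<lambda>u. vo_kernel \<beta> r u * F u)" for r
  have J1: "integral {c..T} (\<lambda>t. k (t, u) * F t) = H u" if u: "u \<in> {c..T}" for u
  proof -
    have "integral {c..T} (\<lambda>t. k (t, u) * F t) = integral {c..T} (\<lambda>t. if t \<in> {c..u} then vo_kernel \<beta> u t * F t else 0)"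
      using u cT by (intro integral_cong) (simp add: k2)
    also have "\<dots> = H u"
      unfolding Henstock_Kurzweil_Integration.integral_restrict_Int H_def using u
      by (intro arg_cong2[where f = integral]) auto
    finally show ?thesis .
  qed
  \<comment> \<open>Beyond \<open>T\<close> the variable \<open>t\<close> stops at \<open>T\<close>
    and not at \<open>u\<close>; \<open>HT\<close> removes from \<open>H\<close> the part over
    \<open>{T..u}\<close>. The splitting is legitimate because the existence of the left derivative
    includes integrability on \<open>{c..u}\<close>.\<close>
  have J2: "integral {c..T} (\<lambda>t. k (t, u) * F t) = H u - HT u" if u: "u \<in> {T..d}" for u
  proof -
    have "integral {c..T} (\<lambda>t. k (t, u) * F t) = integral {c..T} (\<lambda>t. vo_kernel \<beta> u t * F t)"
      using u cT by (intro integral_cong) (simp add: k2)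
    moreover have "(\<lambda>t. vo_kernel \<beta> u t * F t) integrable_on {c..u}"
      using rl_left_deriv_existsD(2)[OF ex, of u] u cT by (auto simp: absolutely_integrable_on_def)
    then have "integral {c..T} (\<lambda>t. vo_kernel \<beta> u t * F t) + HT u = H u"
      unfolding H_def HT_def using u cT by (intro Henstock_Kurzweil_Integration.integral_combine) auto
    ultimately show ?thesis by simp
  qed
  define J where "J u = integral {c..T} (\<lambda>t. k (t, u) * F t)" for u
  have int: "(\<lambda>u. h' u * J u) integrable_on {c..d}" using I2 by (auto simp: J_def)
  have IJ: "integral {c..T} (\<lambda>u. h' u * J u) + integral {T..d} (\<lambda>u. h' u * J u) = I"
    using Henstock_Kurzweil_Integration.integral_combine[OF _ _ int] cT integral_unique[OF I2] by (simp add: J_def)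
  have A: "((\<lambda>u. h' u * H u) has_integral integral {c..T} (\<lambda>u. h' u * J u)) {c..T}"
    by (rule has_integral_eq[OF _ integrable_integral[OF integrable_on_subinterval[OF int]]])
       (use cT in \<open>auto simp: J_def J1\<close>)
  have B: "((\<lambda>u. h' u * (H u - HT u)) has_integral integral {T..d} (\<lambda>u. h' u * J u)) {T..d}"
    by (rule has_integral_eq[OF _ integrable_integral[OF integrable_on_subinterval[OF int]]])
       (use cT in \<open>auto simp: J_def J2\<close>)
  have C: "((\<lambda>t. h' t * H t + h t * rl_left_deriv \<beta> c T F t) has_integral (h T * H T - h c * H c)) {c..T}"
  proof (rule fundamental_theorem_of_calculus)
    fix t assume t: "t \<in> {c..T}"
    have "(h has_vector_derivative h' t) (at t within {c..T})"
      by (rule has_vector_derivative_within_subset[OF bspec[OF h]]) (use t cT in auto)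
    moreover have "(H has_vector_derivative rl_left_deriv \<beta> c T F t) (at t within {c..T})"
      unfolding rl_left_deriv_subinterval[OF ex cT t] using t cT
      by (intro has_vector_derivative_within_subset[OF rl_left_deriv_existsD(3)[OF ex, folded H_def]]) auto
    ultimately show "((\<lambda>t. h t * H t) has_vector_derivative h' t * H t + h t * rl_left_deriv \<beta> c T F t) (at t within {c..T})"
      by (auto intro!: derivative_eq_intros)
  qed (use cT in auto)
  have D: "((\<lambda>t. h' t * (H t - HT t) + h t * (rl_left_deriv \<beta> c d F t - rl_left_deriv \<beta> T d F t))
      has_integral (h d * (H d - HT d) - h T * (H T - HT T))) {T..d}"
  proof (cases "T < d")
    case True
    show ?thesis
    proof (rule fundamental_theorem_of_calculus)
      fix t assume t: "t \<in> {T..d}"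
      have "(h has_vector_derivative h' t) (at t within {T..d})"
        by (rule has_vector_derivative_within_subset[OF bspec[OF h]]) (use t cT in auto)
      moreover have "(H has_vector_derivative rl_left_deriv \<beta> c d F t) (at t within {T..d})"
        using t cT
        by (intro has_vector_derivative_within_subset[OF rl_left_deriv_existsD(3)[OF ex, folded H_def]]) auto
      moreover have "(HT has_vector_derivative rl_left_deriv \<beta> T d F t) (at t within {T..d})"
        using rl_left_deriv_existsD(3)[OF exT[OF True] t] by (simp add: HT_def[abs_def])
      ultimately show "((\<lambda>t. h t * (H t - HT t)) has_vector_derivative
          h' t * (H t - HT t) + h t * (rl_left_deriv \<beta> c d F t - rl_left_deriv \<beta> T d F t)) (at t within {T..d})"
        by (auto intro!: derivative_eq_intros)
    qed (use cT in auto)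
  next
    case False
    then have "T = d" using cT by simp
    then show ?thesis
      using has_integral_refl(2)[of _ d] by (simp add: hd)
  qed
  show thesis
  proof (rule that)
    \<comment> \<open>The term \<open>h T * H T\<close> enters here with a plus sign and in the tail
      with a minus sign, since \<open>HT T = 0\<close>; the sum \<open>I1 + I2\<close> is free of
      it.\<close>
    show "((\<lambda>t. h t * rl_left_deriv \<beta> c T F t) has_integral (h T * H T - integral {c..T} (\<lambda>u. h' u * J u))) {c..T}"
      using has_integral_diff[OF C A] by (simp add: hc)
    show "((\<lambda>t. h t * (rl_left_deriv \<beta> c d F t - rl_left_deriv \<beta> T d F t)) has_integral
        (- h T * H T - integral {T..d} (\<lambda>u. h' u * J u))) {T..d}"
      using has_integral_diff[OF D B] by (simp add: hd HT_def)
    show "((\<lambda>t. F t * caputo_right \<beta> c d h t) has_integral (h T * H T - integral {c..T} (\<lambda>u. h' u * J u)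
        + (- h T * H T - integral {T..d} (\<lambda>u. h' u * J u)))) {c..T}"
      using 1 IJ[symmetric] by simp
  qed
qed

lemma combined_fractional_parts:
  fixes \<gamma> :: "real \<times> real"
  assumes cT: "c < T" "T \<le> d" and \<alpha>: "variable_order c d \<alpha>" and \<beta>: "variable_order c d \<beta>"
    and \<gamma>: "0 \<le> fst \<gamma>" "0 \<le> snd \<gamma>"
    and bk: "bounded_kernels \<gamma> \<alpha> \<beta> c d K"
    and F: "continuous_on {c..T} F"
    and h: "has_deriv_on c d h h'"
    and h': "continuous_on {c..d} h'" and hc: "h c = 0" and hd: "h d = 0"
    and exl: "rl_left_deriv_exists \<beta> c d F" and exT: "T < d \<Longrightarrow> rl_left_deriv_exists \<beta> T d F"
    and exr: "rl_right_deriv_exists \<alpha> c T F"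
  shows "integral {c..T} (\<lambda>t. F t * combined_caputo \<gamma> \<alpha> \<beta> c d h t) =
      integral {c..T} (\<lambda>t. h t * rl_combined (prod.swap \<gamma>) \<beta> \<alpha> c T F t) +
      integral {T..d} (\<lambda>t. h t * (snd \<gamma> * (rl_left_deriv \<beta> c d F t - rl_left_deriv \<beta> T d F t)))"
proof -
  have ka: "(\<lambda>u. vo_kernel \<alpha> t u) absolutely_integrable_on {c..t}"
    and kb: "(\<lambda>u. vo_kernel \<beta> u t) absolutely_integrable_on {t..d}"
    and Ka: "fst \<gamma> * integral {c..t} (\<lambda>u. vo_kernel \<alpha> t u) \<le> K"
    and Kb: "snd \<gamma> * integral {t..d} (\<lambda>u. vo_kernel \<beta> u t) \<le> K" if "t \<in> {c..d}" for t
    using bk that by (auto simp: bounded_kernels_def)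
  obtain I where I: "((\<lambda>t. fst \<gamma> * (F t * caputo_left \<alpha> c d h t)) has_integral I) {c..T}"
    "((\<lambda>t. fst \<gamma> * (h t * rl_right_deriv \<alpha> c T F t)) has_integral I) {c..T}"
  \<comment> \<open>A zero weight leaves the kernel without a mass bound, so the previous lemma is
    not applied; both weighted integrals are then 0. For a positive weight the bound is
    \<open>K\<close> divided by it.\<close>
  proof (cases "fst \<gamma> = 0")
    case False
    then have "integral {c..t} (\<lambda>u. vo_kernel \<alpha> t u) \<le> K / fst \<gamma>" if "t \<in> {c..d}" for t
      using Ka[OF that] \<gamma> by (simp add: field_simps)
    from left_fractional_parts[OF cT \<alpha> ka this F h h' hc exr] obtain J where
      "((\<lambda>t. F t * caputo_left \<alpha> c d h t) has_integral J) {c..T}"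
      "((\<lambda>t. h t * rl_right_deriv \<alpha> c T F t) has_integral J) {c..T}"
      by blast
    from this[THEN has_integral_mult_right, of "fst \<gamma>"] show thesis
      by (rule that)
  qed (use that[of 0] in simp)
  obtain I1 I2 where I': "((\<lambda>t. snd \<gamma> * (F t * caputo_right \<beta> c d h t)) has_integral (I1 + I2)) {c..T}"
    "((\<lambda>t. snd \<gamma> * (h t * rl_left_deriv \<beta> c T F t)) has_integral I1) {c..T}"
    "((\<lambda>t. snd \<gamma> * (h t * (rl_left_deriv \<beta> c d F t - rl_left_deriv \<beta> T d F t))) has_integral I2) {T..d}"
  proof (cases "snd \<gamma> = 0")
    case False
    then have "integral {t..d} (\<lambda>u. vo_kernel \<beta> u t) \<le> K / snd \<gamma>" if "t \<in> {c..d}" for t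
      using Kb[OF that] \<gamma> by (simp add: field_simps)
    from right_fractional_parts[OF cT \<beta> kb this F h h' hc hd exl exT] obtain J1 J2 where
      "((\<lambda>t. F t * caputo_right \<beta> c d h t) has_integral (J1 + J2)) {c..T}"
      "((\<lambda>t. h t * rl_left_deriv \<beta> c T F t) has_integral J1) {c..T}"
      "((\<lambda>t. h t * (rl_left_deriv \<beta> c d F t - rl_left_deriv \<beta> T d F t)) has_integral J2) {T..d}"
      by blast
    from this[THEN has_integral_mult_right, of "snd \<gamma>"] that[of "snd \<gamma> * J1" "snd \<gamma> * J2"] show thesis
      by (simp add: distrib_left)
  qed (use that[of 0 0] in simp)
  have "integral {c..T} (\<lambda>t. F t * combined_caputo \<gamma> \<alpha> \<beta> c d h t) = I + (I1 + I2)"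
    using integral_unique[OF has_integral_add[OF I(1) I'(1)]]
    by (simp add: combined_caputo_def algebra_simps)
  moreover have "integral {c..T} (\<lambda>t. h t * rl_combined (prod.swap \<gamma>) \<beta> \<alpha> c T F t) = I + I1"
    using integral_unique[OF has_integral_add[OF I(2) I'(2)]]
    by (simp add: rl_combined_def algebra_simps)
  moreover have "integral {T..d} (\<lambda>t. h t * (snd \<gamma> * (rl_left_deriv \<beta> c d F t - rl_left_deriv \<beta> T d F t))) = I2"
    using integral_unique[OF I'(3)] by (simp add: mult.left_commute)
  ultimately show ?thesis by simp
qed

section \<open>Functions on boxes\<close>

definition vec_upd :: "real ^ 'n \<Rightarrow> 'n \<Rightarrow> real \<Rightarrow> real ^ 'n" where
  "vec_upd s i r = (\<chi> j. if j = i then r else s $ j)"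

lemma vec_upd_nth [simp]: "vec_upd s i r $ j = (if j = i then r else s $ j)"
  by (simp add: vec_upd_def)

lemma vec_upd_triv [simp]: "vec_upd s i (s $ i) = s"
  by (simp add: vec_eq_iff)

lemma vec_upd_eq: "vec_upd s i r = s + (r - s $ i) *\<^sub>R axis i 1"
  by (auto simp: vec_eq_iff axis_def)

lemma vec_upd_in_cbox:
  "s \<in> cbox lo hi \<Longrightarrow> r \<in> {lo $ i..hi $ i} \<Longrightarrow> vec_upd s i r \<in> cbox lo hi"
  by (auto simp: mem_box_cart)

lemma continuous_on_vec_upd [continuous_intros]:
  "continuous_on S f \<Longrightarrow> continuous_on S g \<Longrightarrow> continuous_on S (\<lambda>x. vec_upd (f x) i (g x))"
  unfolding vec_upd_eq by (intro continuous_intros) 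

text \<open>The map \<open>\<Phi>\<close> exchanging the \<open>i\<close>-th coordinate with the
  extra one is a continuous involution that sends boxes to boxes and permutes their edge lengths, so
  it preserves volume. The box in question has the same edge in both slots and is mapped to
  itself.\<close>

lemma has_integral_swap_coordinate:
  fixes f :: "(real ^ 'n) \<times> real \<Rightarrow> real"
  assumes "(f has_integral I) (cbox (lo, lo $ i) (hi, hi $ i))"
  shows "((\<lambda>(s, r). f (vec_upd s i r, s $ i)) has_integral I) (cbox (lo, lo $ i) (hi, hi $ i))"
proof -
  define \<Phi> :: "(real ^ 'n) \<times> real \<Rightarrow> (real ^ 'n) \<times> real" where "\<Phi> = (\<lambda>(s, r). (vec_upd s i r, s $ i))"
  have inv: "\<Phi> (\<Phi> p) = p" for p
    by (auto simp: \<Phi>_def vec_eq_iff split: prod.splits)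
  have mem: "\<Phi> p \<in> cbox (\<Phi> u) (\<Phi> v)" if "p \<in> cbox u v" for p u v
    using that by (auto simp: \<Phi>_def cbox_Pair_eq mem_box_cart split: prod.splits)
  have im: "\<Phi> ` cbox u v = cbox (\<Phi> u) (\<Phi> v)" for u v
  proof
    show "cbox (\<Phi> u) (\<Phi> v) \<subseteq> \<Phi> ` cbox u v"
    proof
      fix p assume "p \<in> cbox (\<Phi> u) (\<Phi> v)"
      from mem[OF this] have "\<Phi> p \<in> cbox u v" by (simp add: inv)
      then show "p \<in> \<Phi> ` cbox u v" using inv[of p] by (metis imageI)
    qed
  qed (use mem in blast)
  have "measure lborel (\<Phi> ` cbox u v) = 1 * measure lborel (cbox u v)" for u v
  proof (cases "cbox u v = {}")
    case True then show ?thesis by simp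
  next
    case False
    obtain s r s' r' where uv: "u = (s, r)" "v = (s', r')" by (meson surj_pair)
    have ne: "cbox s s' \<noteq> {}" "cbox r r' \<noteq> {}" 
      using False by (auto simp: uv cbox_Pair_eq)
    have "cbox (\<Phi> u) (\<Phi> v) \<noteq> {}" using False im[of u v] by blast
    then have ne': "cbox (vec_upd s i r) (vec_upd s' i r') \<noteq> {}" "cbox (s $ i) (s' $ i) \<noteq> {}"
      by (auto simp: uv cbox_Pair_eq \<Phi>_def)
    have P: "(\<Prod>j\<in>UNIV. vec_upd s' i r' $ j - vec_upd s i r $ j) = (r' - r) * (\<Prod>j\<in>UNIV - {i}. s' $ j - s $ j)"
      by (subst prod.remove[of _ i]) auto
    have Q: "(\<Prod>j\<in>UNIV. s' $ j - s $ j) = (s' $ i - s $ i) * (\<Prod>j\<in>UNIV - {i}. s' $ j - s $ j)"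
      by (subst prod.remove[of _ i]) auto
    have c: "measure lborel (cbox r r') = r' - r" "measure lborel (cbox (s $ i) (s' $ i)) = s' $ i - s $ i"
      using ne ne' by auto
    show ?thesis
      unfolding im unfolding uv \<Phi>_def prod.case content_Pair content_cbox_cart[OF ne(1)] content_cbox_cart[OF ne'(1)] c P Q
      by simp
  qed
  moreover have "continuous (at x) \<Phi>" for x
    unfolding \<Phi>_def case_prod_beta' vec_upd_eq by (intro continuous_intros)
  ultimately have "((\<lambda>x. f (\<Phi> x)) has_integral (1 / 1) *\<^sub>R I) (\<Phi> ` cbox (lo, lo $ i) (hi, hi $ i))"
  proof (intro has_integral_twiddle[where h = \<Phi>])
    show "\<exists>w z. \<Phi> ` cbox u v = cbox w z" for u v
      using im by blast
    show "\<exists>w z. \<Phi> ` cbox u v = cbox w z" for u v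
      using im by blast
  qed (use assms inv in auto)
  then show ?thesis
    by (simp add: im) (simp add: \<Phi>_def case_prod_beta')
qed

text \<open>
  Exchanging the \<open>i\<close>-th coordinate with an additional variable shows that averaging over the
  \<open>i\<close>-th coordinate does not change an integral.
\<close>

lemma integral_cbox_eq_0_if_slices:
  fixes f :: "real ^ 'n \<Rightarrow> real"
  assumes cont: "continuous_on (cbox lo hi) f" and i: "lo $ i < hi $ i"
    and slice: "\<And>s. s \<in> cbox lo hi \<Longrightarrow> integral {lo $ i..hi $ i} (\<lambda>r. f (vec_upd s i r)) = 0"
  shows "integral (cbox lo hi) f = 0"
proof -
  let ?B = "cbox (lo, lo $ i) (hi, hi $ i)"
  have B: "?B = cbox lo hi \<times> {lo $ i..hi $ i}" by (simp add: cbox_Pair_eq)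
  have c1: "continuous_on ?B (\<lambda>(s, r). f s)"
    unfolding B case_prod_beta' by (intro continuous_on_compose2[OF cont] continuous_intros) auto
  have c2: "continuous_on ?B (\<lambda>(s, r). f (vec_upd s i r))"
    unfolding B case_prod_beta'
    by (intro continuous_on_compose2[OF cont] continuous_intros) (auto intro: vec_upd_in_cbox)
  have "((\<lambda>(s, r). f (vec_upd s i r)) has_integral integral ?B (\<lambda>(s, r). f s)) ?B"
    using has_integral_swap_coordinate[OF integrable_integral[OF integrable_continuous[OF c1]]] by simp
  then have "integral ?B (\<lambda>(s, r). f s) = integral ?B (\<lambda>(s, r). f (vec_upd s i r))"
    by (simp add: integral_unique)
  also have "\<dots> = integral (cbox lo hi) (\<lambda>s. integral {lo $ i..hi $ i} (\<lambda>r. f (vec_upd s i r)))"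
    using integral_prod_continuous[OF c2] by simp
  also have "\<dots> = integral (cbox lo hi) (\<lambda>s. 0)"
    by (intro integral_cong slice)
  finally have "integral ?B (\<lambda>(s, r). f s) = 0" by simp
  moreover have "integral ?B (\<lambda>(s, r). f s) = (hi $ i - lo $ i) * integral (cbox lo hi) f"
    using integral_prod_continuous[OF c1] i by simp
  ultimately show ?thesis using i by simp
qed

section \<open>Calculus of C1 functions relative to a set\<close>

lemma C1_on_const: "C1_on S (\<lambda>p. c)"
  unfolding C1_on_def by (intro exI[of _ "\<lambda>p. 0"]) (auto intro!: derivative_eq_intros)

lemma C1_on_add:
  assumes "C1_on S f" "C1_on S g"
  shows "C1_on S (\<lambda>p. f p + g p)"
proof -
  obtain f' g' where *: "\<forall>p\<in>S. (f has_derivative blinfun_apply (f' p)) (at p within S)" "continuous_on S f'"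
    "\<forall>p\<in>S. (g has_derivative blinfun_apply (g' p)) (at p within S)" "continuous_on S g'"
    using assms unfolding C1_on_def by blast
  show ?thesis unfolding C1_on_def
    using * by (intro exI[of _ "\<lambda>p. f' p + g' p"])
      (auto intro!: continuous_intros has_derivative_eq_rhs[OF has_derivative_add] simp: blinfun.add_left)
qed

lemma C1_on_mult:
  assumes "C1_on S f" "C1_on S g"
  shows "C1_on S (\<lambda>p. f p * g p)"
proof -
  obtain f' g' where *: "\<forall>p\<in>S. (f has_derivative blinfun_apply (f' p)) (at p within S)" "continuous_on S f'"
    "\<forall>p\<in>S. (g has_derivative blinfun_apply (g' p)) (at p within S)" "continuous_on S g'"
    using assms unfolding C1_on_def by blast
  then have "continuous_on S f" "continuous_on S g"
    by (auto intro!: has_derivative_continuous_on)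
  then show ?thesis unfolding C1_on_def
    using * by (intro exI[of _ "\<lambda>p. f p *\<^sub>R g' p + g p *\<^sub>R f' p"])
      (auto intro!: continuous_intros has_derivative_eq_rhs[OF has_derivative_mult]
        simp: blinfun.add_left blinfun.scaleR_left mult.commute)
qed

lemma C1_on_prod:
  "finite I \<Longrightarrow> (\<And>i. i \<in> I \<Longrightarrow> C1_on S (f i)) \<Longrightarrow> C1_on S (\<lambda>p. \<Prod>i\<in>I. f i p)"
  by (induction I rule: finite_induct) (auto intro: C1_on_const C1_on_mult)

text \<open>The chain rule relative to sets: the derivative of \<open>\<phi>\<close> is known only
  within \<open>{c..d}\<close>, so it is first restricted to the image of \<open>S\<close> under
  \<open>l\<close>. With \<open>l\<close> a coordinate this lifts one-variable functions to the
  box.\<close>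

lemma C1_on_compose_linear:
  fixes \<phi> :: "real \<Rightarrow> real"
  assumes l: "bounded_linear l" and im: "\<And>p. p \<in> S \<Longrightarrow> l p \<in> {c..d}"
    and \<phi>: "has_deriv_on c d \<phi> \<phi>'"
    and \<phi>': "continuous_on {c..d} \<phi>'"
  shows "C1_on S (\<lambda>p. \<phi> (l p))"
  unfolding C1_on_def
proof (intro exI[of _ "\<lambda>p. \<phi>' (l p) *\<^sub>R Blinfun l"] conjI ballI)
  have cl: "continuous_on S l"
    using l by (simp add: linear_continuous_on)
  show "continuous_on S (\<lambda>p. \<phi>' (l p) *\<^sub>R Blinfun l)"
    by (intro continuous_intros continuous_on_compose2[OF \<phi>' cl]) (use im in auto)
  fix p assume p: "p \<in> S"
  have "(\<phi> has_derivative (\<lambda>x. x *\<^sub>R \<phi>' (l p))) (at (l p) within {c..d})"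
    using \<phi> im[OF p] by (simp add: has_vector_derivative_def)
  then have "(\<phi> has_derivative (\<lambda>x. x *\<^sub>R \<phi>' (l p))) (at (l p) within l ` S)"
    by (rule has_derivative_subset) (use im in blast)
  from diff_chain_within[OF bounded_linear_imp_has_derivative[OF l] this]
  show "((\<lambda>p. \<phi> (l p)) has_derivative blinfun_apply (\<phi>' (l p) *\<^sub>R Blinfun l)) (at p within S)"
    unfolding o_def
    by (rule has_derivative_eq_rhs) (use l in \<open>auto simp: blinfun.scaleR_left bounded_linear_Blinfun_apply mult.commute\<close>)
qed

text \<open>The velocity \<open>v\<close> is constant, so the derivative along the line inherits
  continuity directly from that of the differential. Coordinate lines give the slices of a C1
  function.\<close>

lemma C1_on_line:
  fixes f :: "'a::real_normed_vector \<Rightarrow> real"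
  assumes f: "C1_on S f" and im: "\<And>\<tau>. \<tau> \<in> {c..d} \<Longrightarrow> q \<tau> \<in> S"
    and q: "\<And>\<tau>. \<tau> \<in> {c..d} \<Longrightarrow> (q has_vector_derivative v) (at \<tau> within {c..d})"
  obtains f' where "has_deriv_on c d (\<lambda>\<tau>. f (q \<tau>)) f'"
    and "continuous_on {c..d} f'"
proof -
  obtain D where D: "\<And>p. p \<in> S \<Longrightarrow> (f has_derivative blinfun_apply (D p)) (at p within S)" "continuous_on S D"
    using f unfolding C1_on_def by blast
  have cq: "continuous_on {c..d} q"
    using q has_vector_derivative_continuous unfolding continuous_on_eq_continuous_within by blast
  show thesis
  proof (rule that[of "\<lambda>\<tau>. D (q \<tau>) v"])
    show "continuous_on {c..d} (\<lambda>\<tau>. D (q \<tau>) v)"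
      by (intro continuous_intros continuous_on_compose2[OF D(2) cq]) (use im in auto)
    show "\<forall>\<tau>\<in>{c..d}. ((\<lambda>\<tau>. f (q \<tau>)) has_vector_derivative D (q \<tau>) v) (at \<tau> within {c..d})"
    proof
      fix \<tau> assume \<tau>: "\<tau> \<in> {c..d}"
      have "(f has_derivative blinfun_apply (D (q \<tau>))) (at (q \<tau>) within q ` {c..d})"
        by (rule has_derivative_subset[OF D(1)[OF im[OF \<tau>]]]) (use im in auto)
      from vector_derivative_diff_chain_within[OF q[OF \<tau>] this]
      show "((\<lambda>\<tau>. f (q \<tau>)) has_vector_derivative D (q \<tau>) v) (at \<tau> within {c..d})"
        by (simp add: o_def)
    qed
  qed
qed

section \<open>Product test functions and the fundamental lemma\<close>

text \<open>Products serve twice: with all factors bumps they localise in the fundamental lemma, and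
  with one arbitrary factor they carry a one-variable function into the class of admissible
  variations, where restriction to a coordinate line recovers it up to a constant.\<close>

definition tensor :: "(real \<Rightarrow> real) \<Rightarrow> ('n::finite \<Rightarrow> real \<Rightarrow> real) \<Rightarrow> real \<times> (real ^ 'n) \<Rightarrow> real" where
  "tensor \<phi> \<psi> p = \<phi> (fst p) * (\<Prod>j\<in>UNIV. \<psi> j (snd p $ j))"

lemma C1_on_tensor:
  assumes \<phi>: "has_deriv_on a b \<phi> \<phi>'" "continuous_on {a..b} \<phi>'"
    and \<psi>: "\<And>i. has_deriv_on (lo $ i) (hi $ i) (\<psi> i) (\<psi>' i)"
      "\<And>i. continuous_on {lo $ i..hi $ i} (\<psi>' i)"
  shows "C1_on ({a..b} \<times> cbox lo hi) (tensor \<phi> \<psi>)"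
  unfolding tensor_def[abs_def]
proof (intro C1_on_mult C1_on_prod)
  show "C1_on ({a..b} \<times> cbox lo hi) (\<lambda>p. \<phi> (fst p))"
    by (rule C1_on_compose_linear[OF bounded_linear_fst _ \<phi>]) auto
  show "C1_on ({a..b} \<times> cbox lo hi) (\<lambda>p. \<psi> i (snd p $ i))" for i
    by (rule C1_on_compose_linear[OF bounded_linear_compose[OF bounded_linear_vec_nth bounded_linear_snd] _ \<psi>])
       (auto simp: mem_box_cart)
qed simp

lemma tensor_eq_0_on_frontier:
  assumes "p \<in> frontier ({a..b} \<times> cbox lo hi)"
    and "\<phi> a = 0" "\<phi> b = 0" "\<And>i. \<psi> i (lo $ i) = 0" "\<And>i. \<psi> i (hi $ i) = 0"
  shows "tensor \<phi> \<psi> p = 0"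
proof -
  have "closed ({a..b} \<times> cbox lo hi)" by (intro closed_Times) auto
  then have p: "p \<in> {a..b} \<times> cbox lo hi" "p \<notin> {a<..<b} \<times> box lo hi"
    using assms(1) by (auto simp: frontier_def interior_Times interior_cbox)
  then have "fst p = a \<or> fst p = b \<or> (\<exists>i. snd p $ i = lo $ i \<or> snd p $ i = hi $ i)"
    by (auto simp: mem_box_cart) (metis order_le_less)+
  then show ?thesis
    using assms(2-) by (auto simp: tensor_def prod_zero_iff) metis+
qed

text \<open>For \<open>l < u\<close> the product is positive exactly between \<open>l\<close> and
  \<open>u\<close>. Squaring its positive part makes the function C1 at the two ends; competitors
  are C1, so no more smoothness is called for.\<close>

definition bump :: "real \<Rightarrow> real \<Rightarrow> real \<Rightarrow> real" where
  "bump l u x = (max 0 ((x - l) * (u - x)))\<^sup>2"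

lemma bump_nonneg: "0 \<le> bump l u x"
  by (simp add: bump_def)

lemma bump_pos: "l < x \<Longrightarrow> x < u \<Longrightarrow> 0 < bump l u x"
  by (simp add: bump_def)

lemma bump_ends [simp]: "bump l u l = 0" "bump l u u = 0"
  by (simp_all add: bump_def)

lemma bump_eq_0: "l \<le> u \<Longrightarrow> x \<le> l \<or> u \<le> x \<Longrightarrow> bump l u x = 0"
  by (auto simp: bump_def mult_nonpos_nonneg mult_nonneg_nonpos max_absorb1)

definition bump' :: "real \<Rightarrow> real \<Rightarrow> real \<Rightarrow> real" where
  "bump' l u x = 2 * max 0 ((x - l) * (u - x)) * (l + u - 2 * x)"

lemma bump_has_derivative: "(bump l u has_vector_derivative bump' l u x) (at x within S)"
proof -
  have "((\<lambda>x. (max 0 ((x - l) * (u - x)))\<^sup>2) has_real_derivative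
      2 * max 0 ((x - l) * (u - x)) * (l + u - 2 * x)) (at x within S)"
    by (rule DERIV_chain2[OF has_real_derivative_max_0_power2]) (auto intro!: derivative_eq_intros)
  then show ?thesis
    by (simp add: has_real_derivative_iff_has_vector_derivative bump_def[abs_def] bump'_def)
qed

lemma continuous_on_bump [continuous_intros]: "continuous_on S f \<Longrightarrow> continuous_on S (\<lambda>x. bump l u (f x))"
  unfolding bump_def by (intro continuous_intros)

lemma continuous_on_bump': "continuous_on S (bump' l u)"
  unfolding bump'_def by (intro continuous_intros)

abbreviation box_bump :: "real \<Rightarrow> real \<Rightarrow> real ^ 'n \<Rightarrow> real ^ 'n \<Rightarrow> real \<times> (real ^ 'n) \<Rightarrow> real" where
  "box_bump l u L U \<equiv> tensor (bump l u) (\<lambda>i. bump (L $ i) (U $ i))"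

lemma continuous_on_box_bump: "continuous_on S (box_bump l u L U)"
  unfolding tensor_def by (intro continuous_intros)

text \<open>If \<open>E q\<close> is nonzero at an interior point, \<open>E\<close> keeps its sign
  on a small box around \<open>q\<close>, and a bump on that box makes the integrand of one sign and
  nonzero at \<open>q\<close>; a continuous function of this kind has nonzero integral. Points of
  the boundary follow by closure.\<close>

lemma fundamental_lemma_box:
  fixes E :: "real \<times> (real ^ 'n) \<Rightarrow> real"
  assumes cont: "continuous_on ({c..d} \<times> cbox lo hi) E" and cd: "c < d" and lohi: "\<And>i. lo $ i < hi $ i"
    and zero: "\<And>l u L U. \<lbrakk>c \<le> l; l < u; u \<le> d; \<And>i. lo $ i \<le> L $ i; \<And>i. L $ i < U $ i; \<And>i. U $ i \<le> hi $ i\<rbrakk>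
      \<Longrightarrow> integral ({c..d} \<times> cbox lo hi) (\<lambda>p. box_bump l u L U p * E p) = 0"
    and p: "p \<in> {c..d} \<times> cbox lo hi"
  shows "E p = 0"
proof -
  let ?S = "cbox (c, lo) (d, hi)"
  have S: "{c..d} \<times> cbox lo hi = ?S" by (simp add: cbox_Pair_eq)
  have box: "box (x, y) (x', y') = {x<..<x'} \<times> box y y'" for x x' :: real and y y' :: "real ^ 'n"
    using interior_cbox[of "(x, y)" "(x', y')"] by (simp add: cbox_Pair_eq interior_Times interior_cbox)
  have ne: "box lo hi \<noteq> {}" "box (c, lo) (d, hi) \<noteq> {}"
    using lohi cd unfolding box by (auto simp: interval_ne_empty_cart)
  have inner: "E q = 0" if q: "q \<in> box (c, lo) (d, hi)" for q
  proof (rule ccontr)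
    assume E: "E q \<noteq> 0"
    have qS: "q \<in> ?S" using q box_subset_cbox by blast
    obtain \<delta> where \<delta>: "0 < \<delta>" "\<And>p. p \<in> ?S \<Longrightarrow> dist p q < \<delta> \<Longrightarrow> dist (E p) (E q) < \<bar>E q\<bar>"
      using cont[unfolded S continuous_on_iff, rule_format, OF qS, of "\<bar>E q\<bar>"] E by auto
    have "open (box (c, lo) (d, hi) \<inter> ball q \<delta>)" "q \<in> box (c, lo) (d, hi) \<inter> ball q \<delta>"
      using q \<delta> by auto
    then obtain x y where xy: "q \<in> box x y" "cbox x y \<subseteq> box (c, lo) (d, hi) \<inter> ball q \<delta>"
      using open_contains_cbox by (metis (no_types, lifting))
    obtain l L where x: "x = (l, L)" by fastforce
    obtain u U where y: "y = (u, U)" by fastforce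
    have q': "l < fst q" "fst q < u" "\<And>i. L $ i < snd q $ i" "\<And>i. snd q $ i < U $ i"
      using xy(1) by (auto simp: x y box mem_box_cart)
    have lt: "l < u" "\<And>i. L $ i < U $ i" using q' order.strict_trans by blast+
    then have "x \<in> cbox x y" "y \<in> cbox x y"
      by (auto simp: x y cbox_Pair_eq mem_box_cart less_imp_le)
    then have xS: "x \<in> ?S" and yS: "y \<in> ?S" using xy(2) box_subset_cbox by blast+
    have b: "c \<le> l" "u \<le> d" "lo $ i \<le> L $ i" "U $ i \<le> hi $ i" for i
      using xS yS by (auto simp: x y cbox_Pair_eq mem_box_cart)
    have "integral ?S (\<lambda>p. box_bump l u L U p * E p) = 0"
      using zero[OF b(1) lt(1) b(2) b(3) lt(2) b(4)] unfolding S .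
    then have i0: "integral ?S (\<lambda>p. sgn (E q) * (box_bump l u L U p * E p)) = 0"
      by simp
    have c: "continuous_on ?S (\<lambda>p. sgn (E q) * (box_bump l u L U p * E p))"
      using cont unfolding S by (intro continuous_intros continuous_on_box_bump)
    have hi: "((\<lambda>p. sgn (E q) * (box_bump l u L U p * E p)) has_integral 0) ?S"
      using integrable_integral[OF integrable_continuous[OF c]] by (simp only: i0)
    have nn: "0 \<le> sgn (E q) * (box_bump l u L U p * E p)" if p: "p \<in> ?S" for p
    proof (cases "p \<in> cbox x y")
      case True
      then have "dist p q < \<delta>" using xy(2) by (auto simp: dist_commute)
      then have "dist (E p) (E q) < \<bar>E q\<bar>" using \<delta>(2) p by blast
      then have "0 \<le> sgn (E q) * E p" by (auto simp: dist_real_def sgn_if)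
      moreover have "0 \<le> box_bump l u L U p"
        by (simp add: tensor_def bump_nonneg prod_nonneg)
      ultimately have "0 \<le> box_bump l u L U p * (sgn (E q) * E p)" by (rule mult_nonneg_nonneg[rotated])
      then show ?thesis by (simp add: mult_ac)
    next
      case False
      then have "\<not> (l \<le> fst p \<and> fst p \<le> u) \<or> (\<exists>i. \<not> (L $ i \<le> snd p $ i \<and> snd p $ i \<le> U $ i))"
        by (cases p) (auto simp: x y cbox_Pair_eq mem_box_cart)
      then have "bump l u (fst p) = 0 \<or> (\<exists>i. bump (L $ i) (U $ i) (snd p $ i) = 0)"
        using lt by (metis bump_eq_0 less_imp_le linear)
      then have "box_bump l u L U p = 0" by (auto simp: tensor_def)
      then show ?thesis by simp
    qed
    have "sgn (E q) * (box_bump l u L U q * E q) = 0"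
      by (rule has_integral_0_cbox_imp_0[OF c _ hi ne(2) qS]) (use nn box_subset_cbox in blast)
    moreover have "0 < box_bump l u L U q"
      using q' by (auto simp: tensor_def intro!: mult_pos_pos prod_pos bump_pos)
    ultimately show False using E by (auto simp: sgn_if split: if_splits)
  qed
  have "closed {q \<in> ?S. E q = 0}"
    using cont unfolding S by (intro continuous_closed_preimage_constant) auto
  then have "closure (box (c, lo) (d, hi)) \<subseteq> {q \<in> ?S. E q = 0}"
    using inner box_subset_cbox by (intro closure_minimal) blast+
  then show ?thesis
    using p closure_box[OF ne(2)] by (auto simp: S)
qed

section \<open>Perturbation of ordinary differential equations\<close>

lemma continuous_on_clamped_indefinite_integral:
  fixes g :: "real \<Rightarrow> real"
  assumes "a \<le> b" "continuous_on {a..b} g"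
  shows "continuous_on S (\<lambda>t. integral {a..max a (min b t)} g)"
proof (rule continuous_on_compose2[where g = "\<lambda>t. integral {a..t} g" and t = "{a..b}"])
  show "continuous_on {a..b} (\<lambda>t. integral {a..t} g)"
    using assms by (intro indefinite_integral_continuous_1 integrable_continuous_real)
qed (use assms in \<open>auto intro!: continuous_intros\<close>)

text \<open>
  In the norm weighted by \<open>exp (- M (t - a))\<close> with \<open>M > K\<close> the Picard operator is a contraction on
  the whole interval. Functions on \<open>{a..b}\<close> are extended to the line by constants.
\<close>

lemma picard_lindeloef_global:
  fixes f :: "real \<Rightarrow> real \<Rightarrow> real"
  assumes ab: "a \<le> b" and K: "0 \<le> K"
    and cont: "continuous_on ({a..b} \<times> UNIV) (\<lambda>(t, y). f t y)"
    and lip: "\<And>t y y'. t \<in> {a..b} \<Longrightarrow> \<bar>f t y - f t y'\<bar> \<le> K * \<bar>y - y'\<bar>"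
  obtains w where "w a = w0"
    and "\<forall>t\<in>{a..b}. (w has_real_derivative f t (w t)) (at t within {a..b})"
proof -
  \<comment> \<open>Positive even for \<open>K = 0\<close> and larger than \<open>K\<close>, so that
    \<open>K / M\<close> is a contraction constant.\<close>
  define M where "M = 2 * K + 1"
  have M: "0 < M" "K / M < 1" "0 \<le> K / M" using K by (auto simp: M_def field_simps)
  define c where "c t = max a (min b t)" for t
  have c: "c t \<in> {a..b}" "t \<in> {a..b} \<Longrightarrow> c t = t" for t using ab by (auto simp: c_def)
  \<comment> \<open>The fixed point is sought for the rescaled unknown
    \<open>u t = exp (- M (t - a)) w t\<close>: the weighted norm of \<open>w\<close> is the plain
    sup norm of \<open>u\<close>, and the fixed point theorem applies in the type of bounded
    continuous functions.\<close>
  define g where "g u \<tau> = f \<tau> (exp (M * (\<tau> - a)) * u \<tau>)" for u \<tau>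
  define \<Phi> where "\<Phi> u t = exp (- M * (c t - a)) * (w0 + integral {a..c t} (g u))" for u :: "real \<Rightarrow> real" and t
  have cg: "continuous_on {a..b} (g u)" if "continuous_on {a..b} u" for u
  proof -
    have "continuous_on {a..b} (\<lambda>\<tau>. (\<lambda>(t, y). f t y) (\<tau>, exp (M * (\<tau> - a)) * u \<tau>))"
      by (rule continuous_on_compose2[OF cont]) (use that in \<open>auto intro!: continuous_intros\<close>)
    then show ?thesis by (simp add: g_def[abs_def])
  qed
  have c\<Phi>: "continuous_on S (\<Phi> u)" if "continuous_on {a..b} u" for S u
    unfolding \<Phi>_def c_def
    using continuous_on_clamped_indefinite_integral[OF ab cg[OF that]] by (intro continuous_intros)
  have b\<Phi>: "\<Phi> (apply_bcontfun u) \<in> bcontfun" for u :: "real \<Rightarrow>\<^sub>C real"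
  proof -
    have "\<Phi> u t = \<Phi> u (c t)" for t using c(1)[of t] by (simp add: \<Phi>_def c(2))
    then have "range (\<Phi> u) \<subseteq> \<Phi> u ` {a..b}" using c(1) by (metis image_eqI image_subsetI)
    moreover have "bounded (\<Phi> u ` {a..b})"
      by (intro compact_imp_bounded compact_continuous_image c\<Phi>) auto
    ultimately show ?thesis
      by (auto simp: bcontfun_def intro: c\<Phi> bounded_subset)
  qed
  define P where "P u = Bcontfun (\<Phi> (apply_bcontfun u))" for u
  have P: "apply_bcontfun (P u) = \<Phi> (apply_bcontfun u)" for u
    using b\<Phi> by (simp add: P_def Bcontfun_inverse)
  have "dist (P u) (P v) \<le> K / M * dist u v" for u v
  proof (rule dist_bound)
    fix t
    have ct: "a \<le> c t" "c t \<le> b" using c(1)[of t] by auto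
    have gi: "g (apply_bcontfun u) integrable_on {a..c t}" for u
      using ct by (intro integrable_continuous_real continuous_on_subset[OF cg]) auto
    have "((\<lambda>\<tau>. K * dist u v * exp (M * (\<tau> - a))) has_integral
        K * dist u v * exp (M * (c t - a)) / M - K * dist u v * exp (M * (a - a)) / M) {a..c t}"
      using ct M by (intro fundamental_theorem_of_calculus)
        (auto intro!: derivative_eq_intros simp: has_real_derivative_iff_has_vector_derivative[symmetric])
    then have hi: "((\<lambda>\<tau>. K * dist u v * exp (M * (\<tau> - a))) has_integral
        K / M * dist u v * (exp (M * (c t - a)) - 1)) {a..c t}"
      by (simp add: algebra_simps diff_divide_distrib)
    have "\<bar>integral {a..c t} (g u) - integral {a..c t} (g v)\<bar> = norm (integral {a..c t} (\<lambda>\<tau>. g u \<tau> - g v \<tau>))"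
      using gi by (simp add: integral_diff)
    also have "\<dots> \<le> integral {a..c t} (\<lambda>\<tau>. K * dist u v * exp (M * (\<tau> - a)))"
    proof (rule integral_norm_bound_integral)
      show "(\<lambda>\<tau>. g u \<tau> - g v \<tau>) integrable_on {a..c t}" using gi by (intro integrable_diff)
      show "(\<lambda>\<tau>. K * dist u v * exp (M * (\<tau> - a))) integrable_on {a..c t}" using hi by blast
      fix \<tau> assume "\<tau> \<in> {a..c t}"
      then have "\<tau> \<in> {a..b}" using ct by auto
      from lip[OF this] have "norm (g u \<tau> - g v \<tau>) \<le> K * \<bar>exp (M * (\<tau> - a)) * u \<tau> - exp (M * (\<tau> - a)) * v \<tau>\<bar>"
        by (simp add: g_def)
      also have "\<dots> = K * (exp (M * (\<tau> - a)) * dist (u \<tau>) (v \<tau>))"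
        by (simp add: right_diff_distrib[symmetric] abs_mult dist_real_def)
      also have "\<dots> \<le> K * (exp (M * (\<tau> - a)) * dist u v)"
        using K by (intro mult_left_mono dist_bounded) auto
      finally show "norm (g u \<tau> - g v \<tau>) \<le> K * dist u v * exp (M * (\<tau> - a))" by (simp add: mult_ac)
    qed
    also have "\<dots> = K / M * dist u v * (exp (M * (c t - a)) - 1)" using hi by (rule integral_unique)
    also have "\<dots> \<le> K / M * dist u v * exp (M * (c t - a))"
      using M by (intro mult_left_mono mult_nonneg_nonneg) auto
    finally have "exp (- M * (c t - a)) * \<bar>integral {a..c t} (g u) - integral {a..c t} (g v)\<bar>
        \<le> exp (- M * (c t - a)) * (K / M * dist u v * exp (M * (c t - a)))"
      by (intro mult_left_mono) auto
    also have "\<dots> = K / M * dist u v * (exp (- M * (c t - a)) * exp (M * (c t - a)))" by (simp only: mult_ac)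
    also have "exp (- M * (c t - a)) * exp (M * (c t - a)) = 1" by (simp add: mult_exp_exp)
    finally have "exp (- M * (c t - a)) * \<bar>integral {a..c t} (g u) - integral {a..c t} (g v)\<bar> \<le> K / M * dist u v" by simp
    then show "dist (P u t) (P v t) \<le> K / M * dist u v"
      by (simp add: P \<Phi>_def dist_real_def right_diff_distrib[symmetric] abs_mult)
  qed
  then obtain u where u: "P u = u"
    using banach_fix_type[of "K / M" P] M by blast
  define w where "w t = w0 + integral {a..t} (g u)" for t
  have uw: "exp (M * (t - a)) * u t = w t" if "t \<in> {a..b}" for t
  proof -
    have "u t = exp (- M * (t - a)) * w t"
      using P[of u] that unfolding u by (simp add: \<Phi>_def w_def c(2) fun_eq_iff)
    then have "exp (M * (t - a)) * u t = (exp (M * (t - a)) * exp (- M * (t - a))) * w t" by simp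
    also have "exp (M * (t - a)) * exp (- M * (t - a)) = 1" by (simp add: mult_exp_exp)
    finally show ?thesis by simp
  qed
  show thesis
  proof (rule that)
    show "w a = w0" by (simp add: w_def)
    show "\<forall>t\<in>{a..b}. (w has_real_derivative f t (w t)) (at t within {a..b})"
    proof
      fix t assume t: "t \<in> {a..b}"
      have "((\<lambda>t. integral {a..t} (g u)) has_vector_derivative g u t) (at t within {a..b})"
        by (rule integral_has_vector_derivative[OF cg t]) simp
      then have "(w has_real_derivative g u t) (at t within {a..b})"
        unfolding w_def[abs_def] has_real_derivative_iff_has_vector_derivative
        by (auto intro!: derivative_eq_intros)
      then show "(w has_real_derivative f t (w t)) (at t within {a..b})"
        using uw[OF t] by (simp add: g_def)
    qed
  qed
qed

section \<open>First-order dependence of a scalar equation on a parameter\<close>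

lemma nonincreasing_if_deriv_within_nonpos:
  fixes \<phi> :: "real \<Rightarrow> real"
  assumes d: "\<And>t. t \<in> {a..b} \<Longrightarrow> (\<phi> has_real_derivative \<phi>' t) (at t within {a..b})"
    and nonpos: "\<And>t. t \<in> {a..b} \<Longrightarrow> \<phi>' t \<le> 0" and T: "T \<in> {a..b}"
  shows "\<phi> T \<le> \<phi> a"
proof (cases "a = T")
  case False
  then have aT: "a < T" using T by simp
  have "continuous_on {a..b} \<phi>"
    by (rule DERIV_continuous_on[OF d])
  then have c: "continuous_on {a..T} \<phi>" using T by (auto intro: continuous_on_subset)
  show ?thesis
  proof (rule DERIV_nonpos_imp_decreasing_open[OF less_imp_le[OF aT] _ c])
    fix x assume x: "a < x" "x < T"
    then have "x \<in> {a..b}" "at x within {a..b} = at x" using T by (auto intro: at_within_Icc_at)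
    then show "\<exists>y. (\<phi> has_real_derivative y) (at x) \<and> y \<le> 0"
      using d[of x] nonpos[of x] by auto
  qed
qed simp

text \<open>The function \<open>\<psi> = \<Lambda> (w - z) - r (integral of \<Lambda> q)\<close> has
  as its derivative \<open>\<Lambda>\<close> times the remainder in \<open>lin\<close>. Hence
  \<open>\<psi>\<close> is of smaller order than \<open>r\<close> as soon as \<open>w - z\<close> is
  of order \<open>r\<close>. This is a Gronwall estimate, carried out for the square of
  \<open>w - z\<close>.\<close>

lemma ode_linearization:
  fixes f :: "real \<Rightarrow> real \<Rightarrow> real \<Rightarrow> real"
  assumes ab: "a < b" and K: "0 \<le> K"
    and cont: "\<And>r. \<bar>r\<bar> \<le> 1 \<Longrightarrow> continuous_on ({a..b} \<times> UNIV) (\<lambda>(t, y). f r t y)"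
    and lip: "\<And>r r' t y y'. \<lbrakk>\<bar>r\<bar> \<le> 1; \<bar>r'\<bar> \<le> 1; t \<in> {a..b}; \<bar>y - z t\<bar> \<le> 1; \<bar>y' - z t\<bar> \<le> 1\<rbrakk>
      \<Longrightarrow> \<bar>f r t y - f r' t y'\<bar> \<le> K * (\<bar>r - r'\<bar> + \<bar>y - y'\<bar>)"
    and z: "\<forall>t\<in>{a..b}. (z has_real_derivative f 0 t (z t)) (at t within {a..b})"
    and p: "continuous_on {a..b} p" and q: "continuous_on {a..b} q"
    and lin: "\<And>e. 0 < e \<Longrightarrow> \<exists>\<delta>>0. \<forall>r y. \<forall>t\<in>{a..b}. \<bar>r\<bar> < \<delta> \<and> \<bar>y - z t\<bar> < \<delta> \<longrightarrow>
      \<bar>f r t y - f 0 t (z t) - r * q t - p t * (y - z t)\<bar> \<le> e * (\<bar>r\<bar> + \<bar>y - z t\<bar>)"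
    and T: "T \<in> {a..b}" and e: "0 < e"
  shows "\<exists>\<delta>>0. \<forall>r. \<bar>r\<bar> < \<delta> \<longrightarrow> (\<exists>w. w a = z a \<and>
    (\<forall>t\<in>{a..b}. (w has_real_derivative f r t (w t)) (at t within {a..b})) \<and>
    \<bar>exp (- integral {a..T} p) * (w T - z T) - r * integral {a..T} (\<lambda>t. exp (- integral {a..t} p) * q t)\<bar>
      \<le> e * \<bar>r\<bar>)"
proof -
  \<comment> \<open>The Lipschitz condition holds only within distance 1 of \<open>z\<close>.
    Clamping the deviation makes the equation globally Lipschitz, so that a solution on the whole
    interval exists; the estimate by \<open>C \<bar>r\<bar>\<close> shows afterwards that for small
    \<open>r\<close> the clamp is inactive.\<close>
  define cl where "cl y = max (-1) (min 1 (y::real))" for y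
  have cl: "\<bar>cl y\<bar> \<le> 1" "\<bar>cl y\<bar> \<le> \<bar>y\<bar>" "\<bar>cl y - cl y'\<bar> \<le> \<bar>y - y'\<bar>" "\<bar>y\<bar> \<le> 1 \<Longrightarrow> cl y = y" for y y'
    by (auto simp: cl_def)
  have zc: "continuous_on {a..b} z"
    using z by (auto intro!: has_field_derivative_imp_has_derivative has_derivative_continuous_on simp: has_field_derivative_def)
  \<comment> \<open>The rate comes from \<open>2 K \<bar>r\<bar> \<bar>E\<bar> \<le> K\<^sup>2
    r\<^sup>2 + E\<^sup>2\<close>: the derivative of \<open>E\<^sup>2\<close> is at most
    \<open>M E\<^sup>2 + K\<^sup>2 r\<^sup>2\<close>, and integrating this over the interval gives
    the constant \<open>C\<close>.\<close>
  define M where "M = 2 * K + 1"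
  define C where "C = sqrt (exp (M * (b - a)) * K\<^sup>2 * (b - a))"
  have C0: "0 \<le> C" using ab by (simp add: C_def)
  have ex: "\<exists>w. w a = z a \<and> (\<forall>t\<in>{a..b}. \<bar>w t - z t\<bar> \<le> C * \<bar>r\<bar>) \<and>
    (\<forall>t\<in>{a..b}. (w has_real_derivative f r t (z t + cl (w t - z t))) (at t within {a..b}))"
    if r: "\<bar>r\<bar> \<le> 1" for r
  proof -
    obtain w where w: "w a = z a"
      "\<forall>t\<in>{a..b}. (w has_real_derivative f r t (z t + cl (w t - z t))) (at t within {a..b})"
    proof (rule picard_lindeloef_global[of a b K "\<lambda>t y. f r t (z t + cl (y - z t))" "z a"])
      have "continuous_on ({a..b} \<times> UNIV) (\<lambda>p. (\<lambda>(t, y). f r t y) (fst p, z (fst p) + cl (snd p - z (fst p))))"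
        unfolding cl_def
        by (rule continuous_on_compose2[OF cont[OF r]])
           (auto intro!: continuous_intros continuous_on_compose2[OF zc])
      then show "continuous_on ({a..b} \<times> UNIV) (\<lambda>(t, y). f r t (z t + cl (y - z t)))"
        by (simp add: case_prod_beta')
      fix t y y' assume t: "t \<in> {a..b}"
      have "\<bar>f r t (z t + cl (y - z t)) - f r t (z t + cl (y' - z t))\<bar> \<le> K * \<bar>cl (y - z t) - cl (y' - z t)\<bar>"
        using lip[OF r r t, of "z t + cl (y - z t)" "z t + cl (y' - z t)"] cl(1) by simp
      also have "\<dots> \<le> K * \<bar>y - y'\<bar>"
        using cl(3)[of "y - z t" "y' - z t"] K by (intro mult_left_mono) auto
      finally show "\<bar>f r t (z t + cl (y - z t)) - f r t (z t + cl (y' - z t))\<bar> \<le> K * \<bar>y - y'\<bar>" .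
    qed (use ab K in auto)
    define E where "E t = w t - z t" for t
    define E' where "E' t = f r t (z t + cl (w t - z t)) - f 0 t (z t)" for t
    have dE: "(E has_real_derivative E' t) (at t within {a..b})" if "t \<in> {a..b}" for t
      unfolding E_def[abs_def] E'_def using w(2) z that by (auto intro!: derivative_intros)
    have E': "\<bar>E' t\<bar> \<le> K * (\<bar>r\<bar> + \<bar>E t\<bar>)" if t: "t \<in> {a..b}" for t
    proof -
      have "\<bar>E' t\<bar> \<le> K * (\<bar>r\<bar> + \<bar>cl (E t)\<bar>)"
        using lip[OF r _ t, of 0 "z t + cl (w t - z t)" "z t"] cl(1) by (simp add: E'_def E_def)
      also have "\<dots> \<le> K * (\<bar>r\<bar> + \<bar>E t\<bar>)" using K cl(2) by (intro mult_left_mono) auto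
      finally show ?thesis .
    qed
    have "\<bar>E t\<bar> \<le> C * \<bar>r\<bar>" if t: "t \<in> {a..b}" for t
    proof -
      define \<phi> where "\<phi> t = exp (- M * (t - a)) * (E t)\<^sup>2 - K\<^sup>2 * r\<^sup>2 * (t - a)" for t
      have "\<phi> t \<le> \<phi> a"
      proof (rule nonincreasing_if_deriv_within_nonpos[OF _ _ t])
        fix s assume s: "s \<in> {a..b}"
        show "(\<phi> has_real_derivative exp (- M * (s - a)) * (2 * E s * E' s - M * (E s)\<^sup>2) - K\<^sup>2 * r\<^sup>2) (at s within {a..b})"
          unfolding \<phi>_def[abs_def]
          by (auto intro!: derivative_eq_intros dE[OF s] simp: algebra_simps power2_eq_square)
        have "E s * E' s \<le> \<bar>E s\<bar> * (K * (\<bar>r\<bar> + \<bar>E s\<bar>))"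
          by (metis E'[OF s] abs_ge_self abs_ge_zero abs_mult mult_left_mono order_trans)
        moreover have "0 \<le> (\<bar>E s\<bar> - K * \<bar>r\<bar>)\<^sup>2" by simp
        ultimately have "2 * E s * E' s - M * (E s)\<^sup>2 \<le> K\<^sup>2 * r\<^sup>2"
          by (simp add: M_def power2_diff power_mult_distrib algebra_simps power2_eq_square abs_mult_self_eq)
        then have "exp (- M * (s - a)) * (2 * E s * E' s - M * (E s)\<^sup>2) \<le> exp (- M * (s - a)) * (K\<^sup>2 * r\<^sup>2)"
          by (intro mult_left_mono) auto
        moreover have "- M * (s - a) \<le> 0"
          using s K by (intro mult_nonpos_nonneg) (auto simp: M_def)
        then have "exp (- M * (s - a)) * (K\<^sup>2 * r\<^sup>2) \<le> 1 * (K\<^sup>2 * r\<^sup>2)"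
          by (intro mult_right_mono) auto
        ultimately have "exp (- M * (s - a)) * (2 * E s * E' s - M * (E s)\<^sup>2) \<le> K\<^sup>2 * r\<^sup>2"
          by linarith
        then show "exp (- M * (s - a)) * (2 * E s * E' s - M * (E s)\<^sup>2) - K\<^sup>2 * r\<^sup>2 \<le> 0" by simp
      qed
      then have "exp (- M * (t - a)) * (E t)\<^sup>2 \<le> K\<^sup>2 * r\<^sup>2 * (t - a)"
        by (simp add: \<phi>_def E_def w(1))
      then have "exp (M * (t - a)) * (exp (- M * (t - a)) * (E t)\<^sup>2) \<le> exp (M * (t - a)) * (K\<^sup>2 * r\<^sup>2 * (t - a))"
        by (intro mult_left_mono) auto
      also have "\<dots> \<le> exp (M * (b - a)) * (K\<^sup>2 * r\<^sup>2 * (b - a))"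
        using t K by (intro mult_mono) (auto simp: M_def intro!: mult_left_mono)
      finally have "(E t)\<^sup>2 \<le> (exp (M * (b - a)) * K\<^sup>2 * (b - a)) * r\<^sup>2"
        by (simp add: mult_exp_exp mult.assoc[symmetric]) (simp add: mult_ac)
      from real_sqrt_le_mono[OF this] show ?thesis by (simp add: C_def real_sqrt_mult)
    qed
    then show ?thesis using w by (auto simp: E_def)
  qed
  define \<Lambda> where "\<Lambda> t = exp (- integral {a..t} p)" for t
  have d\<Lambda>: "(\<Lambda> has_real_derivative - p t * \<Lambda> t) (at t within {a..b})" if t: "t \<in> {a..b}" for t
  proof -
    have "((\<lambda>t. integral {a..t} p) has_real_derivative p t) (at t within {a..b})"
      using integral_has_vector_derivative[OF p t] by (simp add: has_real_derivative_iff_has_vector_derivative)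
    then show ?thesis unfolding \<Lambda>_def[abs_def] by (auto intro!: derivative_eq_intros)
  qed
  have c\<Lambda>: "continuous_on {a..b} \<Lambda>"
    by (rule DERIV_continuous_on[OF d\<Lambda>])
  have "bounded (\<Lambda> ` {a..b})" by (intro compact_imp_bounded compact_continuous_image c\<Lambda>) simp
  then obtain N where N: "\<forall>t\<in>{a..b}. \<bar>\<Lambda> t\<bar> \<le> N" "0 < N" by (force simp: bounded_pos)
  \<comment> \<open>The factors are the bound of \<open>\<Lambda>\<close>, the passage from
    \<open>\<bar>r\<bar> + \<bar>w t - z t\<bar>\<close> to \<open>(1 + C) \<bar>r\<bar>\<close>,
    and the length in the mean value inequality.\<close>
  define e' where "e' = e / (N * (1 + C) * (b - a))"
  have e': "0 < e'" using e N C0 ab by (simp add: e'_def)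
  obtain \<delta>1 where \<delta>1: "0 < \<delta>1" "\<forall>r y. \<forall>t\<in>{a..b}. \<bar>r\<bar> < \<delta>1 \<and> \<bar>y - z t\<bar> < \<delta>1 \<longrightarrow>
      \<bar>f r t y - f 0 t (z t) - r * q t - p t * (y - z t)\<bar> \<le> e' * (\<bar>r\<bar> + \<bar>y - z t\<bar>)"
    using lin[OF e'] by blast
  define m where "m = min 1 \<delta>1"
  define \<delta> where "\<delta> = m / (C + 1)"
  have \<delta>: "0 < \<delta>" "\<delta> \<le> 1" "\<delta> \<le> \<delta>1" "C * \<delta> < 1" "C * \<delta> < \<delta>1"
  proof -
    have m: "0 < m" "m \<le> 1" "m \<le> \<delta>1" using \<delta>1(1) by (auto simp: m_def)
    show "0 < \<delta>" using m C0 by (simp add: \<delta>_def)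
    have "m * 1 \<le> m * (C + 1)" using m C0 by (intro mult_left_mono) auto
    then have "\<delta> \<le> m" using C0 by (simp add: \<delta>_def divide_le_eq)
    then show "\<delta> \<le> 1" "\<delta> \<le> \<delta>1" using m by auto
    have "C * m < m * (C + 1)" using m by (simp add: algebra_simps)
    then have "C * \<delta> < m" using C0 by (simp add: \<delta>_def divide_less_eq)
    then show "C * \<delta> < 1" "C * \<delta> < \<delta>1" using m by auto
  qed
  show ?thesis
  proof (intro exI[of _ \<delta>] conjI allI impI \<delta>(1))
    fix r assume r: "\<bar>r\<bar> < \<delta>"
    then have r1: "\<bar>r\<bar> \<le> 1" using \<delta> by simp
    obtain w where w: "w a = z a" "\<forall>t\<in>{a..b}. \<bar>w t - z t\<bar> \<le> C * \<bar>r\<bar>"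
      "\<forall>t\<in>{a..b}. (w has_real_derivative f r t (z t + cl (w t - z t))) (at t within {a..b})"
      using ex[OF r1] by blast
    have Cr: "C * \<bar>r\<bar> \<le> C * \<delta>" using r C0 by (intro mult_left_mono) auto
    have wz: "\<bar>w t - z t\<bar> \<le> 1" "\<bar>w t - z t\<bar> < \<delta>1" if "t \<in> {a..b}" for t
      using w(2) that Cr \<delta> by force+
    have dw: "(w has_real_derivative f r t (w t)) (at t within {a..b})" if "t \<in> {a..b}" for t
      using bspec[OF w(3) that] wz(1)[OF that] by (simp add: cl(4))
    define \<psi> where "\<psi> t = \<Lambda> t * (w t - z t) - r * integral {a..t} (\<lambda>t. \<Lambda> t * q t)" for t
    have "norm (\<psi> T - \<psi> a) \<le> N * e' * (1 + C) * \<bar>r\<bar> * norm (T - a)"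
    proof (rule field_differentiable_bound[of "{a..b}"])
      fix t assume t: "t \<in> {a..b}"
      have "((\<lambda>t. integral {a..t} (\<lambda>t. \<Lambda> t * q t)) has_real_derivative \<Lambda> t * q t) (at t within {a..b})"
        using integral_has_vector_derivative[OF continuous_on_mult[OF c\<Lambda> q] t]
        by (simp add: has_real_derivative_iff_has_vector_derivative)
      then show "(\<psi> has_real_derivative \<Lambda> t * (f r t (w t) - f 0 t (z t) - r * q t - p t * (w t - z t))) (at t within {a..b})"
        unfolding \<psi>_def[abs_def] using d\<Lambda>[OF t] dw[OF t] z t
        by (auto intro!: derivative_eq_intros simp: algebra_simps)
      have "\<bar>f r t (w t) - f 0 t (z t) - r * q t - p t * (w t - z t)\<bar> \<le> e' * (\<bar>r\<bar> + \<bar>w t - z t\<bar>)"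
        using \<delta>1(2) t wz(2)[OF t] r \<delta> by simp
      also have "\<dots> \<le> e' * ((1 + C) * \<bar>r\<bar>)"
        using w(2) t e' by (intro mult_left_mono) (auto simp: algebra_simps)
      finally have "\<bar>\<Lambda> t\<bar> * \<bar>f r t (w t) - f 0 t (z t) - r * q t - p t * (w t - z t)\<bar> \<le> N * (e' * ((1 + C) * \<bar>r\<bar>))"
        using N t by (intro mult_mono) auto
      then show "norm (\<Lambda> t * (f r t (w t) - f 0 t (z t) - r * q t - p t * (w t - z t))) \<le> N * e' * (1 + C) * \<bar>r\<bar>"
        by (simp add: abs_mult mult_ac)
    qed (use T ab in auto)
    also have "\<dots> \<le> N * e' * (1 + C) * \<bar>r\<bar> * (b - a)"
      using T N e' C0 by (intro mult_left_mono) auto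
    also have "\<dots> = e * \<bar>r\<bar>"
      using N C0 ab by (simp add: e'_def)
    finally have "\<bar>\<psi> T\<bar> \<le> e * \<bar>r\<bar>" by (simp add: \<psi>_def w(1))
    then show "\<exists>w. w a = z a \<and> (\<forall>t\<in>{a..b}. (w has_real_derivative f r t (w t)) (at t within {a..b})) \<and>
      \<bar>exp (- integral {a..T} p) * (w T - z T) - r * integral {a..T} (\<lambda>t. exp (- integral {a..t} p) * q t)\<bar> \<le> e * \<bar>r\<bar>"
      using w(1) dw by (intro exI[of _ w]) (auto simp: \<psi>_def \<Lambda>_def)
  qed
qed

section \<open>Uniform expansion of the Lagrangian and of its integral over the box\<close>

text \<open>On a compact set \<open>L'\<close> is uniformly continuous, so on a small ball it
  differs from \<open>L' u\<close> by less than \<open>e\<close>; the mean value inequality on the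
  convex intersection of \<open>W\<close> with that ball gives the estimate.\<close>

lemma uniform_linearization:
  fixes L :: "'e::euclidean_space \<Rightarrow> real" and L' :: "'e \<Rightarrow> 'e \<Rightarrow>\<^sub>L real"
  assumes L: "\<And>p. p \<in> W \<Longrightarrow> (L has_derivative blinfun_apply (L' p)) (at p within W)"
    and L': "continuous_on W L'" and W: "compact W" "convex W" and e: "0 < e"
  obtains \<delta> where "0 < \<delta>"
    and "\<And>u v. u \<in> W \<Longrightarrow> v \<in> W \<Longrightarrow> norm (v - u) < \<delta> \<Longrightarrow> \<bar>L v - L u - L' u (v - u)\<bar> \<le> e * norm (v - u)"
proof -
  have "uniformly_continuous_on W L'" using compact_uniformly_continuous[OF L' W(1)] .
  then obtain \<delta> where \<delta>: "0 < \<delta>" "\<And>u v. u \<in> W \<Longrightarrow> v \<in> W \<Longrightarrow> dist v u < \<delta> \<Longrightarrow> dist (L' v) (L' u) < e"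
    using e by (auto simp: uniformly_continuous_on_def)
  show thesis
  proof (rule that[OF \<delta>(1)])
    fix u v assume u: "u \<in> W" and v: "v \<in> W" and uv: "norm (v - u) < \<delta>"
    have "norm (L v - L u - L' u (v - u)) \<le> norm (v - u) * e"
    proof (rule differentiable_bound_linearization[where S = "W \<inter> ball u \<delta>" and f' = "\<lambda>p. blinfun_apply (L' p)"])
      fix t :: real assume t: "t \<in> {0..1}"
      have "convex (W \<inter> ball u \<delta>)" using W(2) by (intro convex_Int) auto
      moreover have "v \<in> W \<inter> ball u \<delta>" "u \<in> W \<inter> ball u \<delta>" using u v uv \<delta>(1) by (auto simp: dist_norm norm_minus_commute)
      ultimately have "(1 - t) *\<^sub>R u + t *\<^sub>R v \<in> W \<inter> ball u \<delta>" using t by (intro convexD) auto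
      then show "u + t *\<^sub>R (v - u) \<in> W \<inter> ball u \<delta>" by (simp add: algebra_simps)
    next
      fix x assume x: "x \<in> W \<inter> ball u \<delta>"
      then show "(L has_derivative blinfun_apply (L' x)) (at x within W \<inter> ball u \<delta>)"
        by (intro has_derivative_subset[OF L]) auto
      have "dist (L' x) (L' u) < e" using x u by (intro \<delta>(2)) (auto simp: dist_commute)
      then show "onorm (blinfun_apply (L' x) - blinfun_apply (L' u)) \<le> e"
        by (simp add: dist_norm norm_blinfun.rep_eq minus_blinfun.rep_eq fun_diff_def)
    next
      show "u \<in> W \<inter> ball u \<delta>" using u \<delta> by simp
    qed
    then show "\<bar>L v - L u - L' u (v - u)\<bar> \<le> e * norm (v - u)" by (simp add: mult.commute)
  qed
qed

text \<open>This applies \<open>ode_linearization\<close> to the Herglotz equation: \<open>A\<close>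
  is the argument along the reference trajectory, \<open>\<eta>\<close> the direction produced by a
  variation of \<open>x\<close>, and \<open>\<zeta>\<close> that of \<open>z\<close>. The directions
  used later leave \<open>t\<close> and \<open>s\<close> fixed, so the perturbed argument stays in
  the domain \<open>W\<close> for all parameters, as \<open>inW\<close> demands.\<close>

lemma lagrangian_variation:
  fixes L :: "'e::euclidean_space \<Rightarrow> real" and L' :: "'e \<Rightarrow> 'e \<Rightarrow>\<^sub>L real"
    and A \<eta> :: "real \<times> 'm::euclidean_space \<Rightarrow> 'e" and \<zeta> :: 'e
  assumes ab: "a < b"
    and L: "\<And>p. p \<in> W \<Longrightarrow> (L has_derivative blinfun_apply (L' p)) (at p within W)"
    and L': "continuous_on W L'" and W: "closed W" "convex W"
    and A: "continuous_on ({a..b} \<times> cbox lo hi) A" and \<eta>: "continuous_on ({a..b} \<times> cbox lo hi) \<eta>"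
    and inW: "\<And>p r q. p \<in> {a..b} \<times> cbox lo hi \<Longrightarrow> A p + r *\<^sub>R \<eta> p + q *\<^sub>R \<zeta> \<in> W"
    and z: "\<forall>t\<in>{a..b}. (z has_real_derivative integral (cbox lo hi) (\<lambda>s. L (A (t, s)))) (at t within {a..b})"
    and T: "T \<in> {a..b}" and e: "0 < e"
  defines "P \<equiv> \<lambda>t. integral (cbox lo hi) (\<lambda>s. L' (A (t, s)) \<zeta>)"
    and "Q \<equiv> \<lambda>t. integral (cbox lo hi) (\<lambda>s. L' (A (t, s)) (\<eta> (t, s)))"
  shows "\<exists>\<delta>>0. \<forall>r. \<bar>r\<bar> < \<delta> \<longrightarrow> (\<exists>w. w a = z a \<and>
    (\<forall>t\<in>{a..b}. (w has_real_derivative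
        integral (cbox lo hi) (\<lambda>s. L (A (t, s) + r *\<^sub>R \<eta> (t, s) + (w t - z t) *\<^sub>R \<zeta>))) (at t within {a..b})) \<and>
    \<bar>exp (- integral {a..T} P) * (w T - z T) - r * integral {a..T} (\<lambda>t. exp (- integral {a..t} P) * Q t)\<bar>
      \<le> e * \<bar>r\<bar>)"
proof -
  let ?D = "{a..b} \<times> cbox lo hi"
  define f where "f r t y = integral (cbox lo hi) (\<lambda>s. L (A (t, s) + r *\<^sub>R \<eta> (t, s) + (y - z t) *\<^sub>R \<zeta>))" for r t y
  have zc: "continuous_on {a..b} z"
    by (rule DERIV_continuous_on) (use z in blast)
  have Lc: "continuous_on W L"
    using L by (rule has_derivative_continuous_on)
  have D: "compact ?D" by (intro compact_Times) auto
  obtain RA where RA: "\<forall>p\<in>?D. norm (A p) \<le> RA" "0 < RA"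
    using compact_imp_bounded[OF compact_continuous_image[OF A D]] by (auto simp: bounded_pos)
  obtain R\<eta> where R\<eta>: "\<forall>p\<in>?D. norm (\<eta> p) \<le> R\<eta>" "0 < R\<eta>"
    using compact_imp_bounded[OF compact_continuous_image[OF \<eta> D]] by (auto simp: bounded_pos)
  define N where "N = R\<eta> + norm \<zeta>"
  have N: "0 < N" using R\<eta> by (simp add: N_def add_pos_nonneg)
  \<comment> \<open>All arguments with both parameters of absolute value at most 1 lie in this
    compact convex set, on which \<open>L\<close> is Lipschitz and uniformly linearizable.\<close>
  define W0 where "W0 = W \<inter> cball 0 (RA + 2 * N)"
  have W0: "compact W0" "convex W0" "W0 \<subseteq> W"
    using W by (auto simp: W0_def convex_Int)
  have dir: "norm (r *\<^sub>R \<eta> p + q *\<^sub>R \<zeta>) \<le> N * (\<bar>r\<bar> + \<bar>q\<bar>)" if p: "p \<in> ?D" for p r q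
  proof -
    have "norm (r *\<^sub>R \<eta> p + q *\<^sub>R \<zeta>) \<le> \<bar>r\<bar> * norm (\<eta> p) + \<bar>q\<bar> * norm \<zeta>"
      by (metis norm_scaleR norm_triangle_ineq)
    also have "\<dots> \<le> \<bar>r\<bar> * N + \<bar>q\<bar> * N"
    proof (intro add_mono mult_left_mono)
      show "norm (\<eta> p) \<le> N" using bspec[OF R\<eta>(1) p] by (simp add: N_def add_increasing2)
      show "norm \<zeta> \<le> N" using R\<eta>(2) by (simp add: N_def)
    qed auto
    finally show ?thesis by (simp add: algebra_simps)
  qed
  have inW0: "A p + r *\<^sub>R \<eta> p + q *\<^sub>R \<zeta> \<in> W0" if p: "p \<in> ?D" and rq: "\<bar>r\<bar> \<le> 1" "\<bar>q\<bar> \<le> 1" for p r q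
  proof -
    have "N * (\<bar>r\<bar> + \<bar>q\<bar>) \<le> N * 2"
      using rq N by (intro mult_left_mono) auto
    then have "norm (r *\<^sub>R \<eta> p + q *\<^sub>R \<zeta>) \<le> 2 * N"
      using dir[OF p, of r q] by linarith
    then have "norm (A p + (r *\<^sub>R \<eta> p + q *\<^sub>R \<zeta>)) \<le> RA + 2 * N"
      using bspec[OF RA(1) p] norm_triangle_ineq[of "A p" "r *\<^sub>R \<eta> p + q *\<^sub>R \<zeta>"] by linarith
    then show ?thesis using inW[OF p] by (simp add: W0_def add.assoc)
  qed
  have L0: "(L has_derivative blinfun_apply (L' p)) (at p within W0)" if "p \<in> W0" for p
    using W0(3) that by (intro has_derivative_subset[OF L]) auto
  have L0': "continuous_on W0 L'" using L' W0(3) by (rule continuous_on_subset)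
  obtain B where B: "\<forall>p\<in>W0. norm (L' p) \<le> B" "0 < B"
    using compact_imp_bounded[OF compact_continuous_image[OF L0' W0(1)]] by (auto simp: bounded_pos)
  have Llip: "\<bar>L u - L v\<bar> \<le> B * norm (u - v)" if "u \<in> W0" "v \<in> W0" for u v
    using differentiable_bound[OF W0(2) L0 _ that, of B] B(1) by (auto simp: norm_blinfun.rep_eq)
  define vol where "vol = measure lborel (cbox lo hi)"
  have vol: "0 \<le> vol" by (simp add: vol_def)
  have sec: "continuous_on (cbox lo hi) (\<lambda>s. G (t, s))" if "continuous_on ?D G" "t \<in> {a..b}"
    for G :: "real \<times> 'm \<Rightarrow> 'z::topological_space" and t
    by (rule continuous_on_compose2[OF that(1)]) (use that in \<open>auto intro!: continuous_intros\<close>)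
  have path: "continuous_on (cbox lo hi) (\<lambda>s. A (t, s) + r *\<^sub>R \<eta> (t, s) + q *\<^sub>R \<zeta>)" if "t \<in> {a..b}" for t r q
    using sec[OF A that] sec[OF \<eta> that] by (intro continuous_intros)
  have Lint: "(\<lambda>s. L (A (t, s) + r *\<^sub>R \<eta> (t, s) + q *\<^sub>R \<zeta>)) integrable_on cbox lo hi" if t: "t \<in> {a..b}" for t r q
    by (intro integrable_continuous continuous_on_compose2[OF Lc path[OF t]]) (use inW t in auto)
  have L'c: "continuous_on ?D (\<lambda>p. L' (A p))"
    by (rule continuous_on_compose2[OF L' A]) (use inW[of _ 0 0] in auto)
  have *: "continuous_on ?D (\<lambda>(t, s). L' (A (t, s)) \<zeta>)" "continuous_on ?D (\<lambda>(t, s). L' (A (t, s)) (\<eta> (t, s)))"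
    using L'c \<eta> by (auto simp: case_prod_beta' intro!: continuous_intros)
  have P: "continuous_on {a..b} P" and Q: "continuous_on {a..b} Q"
    unfolding P_def Q_def using *[THEN integral_continuous_on_param] .
  have LP: "(\<lambda>s. L' (A (t, s)) \<zeta>) integrable_on cbox lo hi" and LQ: "(\<lambda>s. L' (A (t, s)) (\<eta> (t, s))) integrable_on cbox lo hi"
    if t: "t \<in> {a..b}" for t
    using sec[OF L'c t] sec[OF \<eta> t] by (auto intro!: integrable_continuous continuous_intros)
  show ?thesis
    unfolding f_def[symmetric]
  proof (rule ode_linearization[where K = "vol * (B * N)" and z = z, OF ab _ _ _ _ P Q _ T e])
    show "0 \<le> vol * (B * N)" using vol B(2) N by simp
  next
    fix r :: real
    have "continuous_on (({a..b} \<times> UNIV) \<times> cbox lo hi)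
      (\<lambda>p. L (A (fst (fst p), snd p) + r *\<^sub>R \<eta> (fst (fst p), snd p) + (snd (fst p) - z (fst (fst p))) *\<^sub>R \<zeta>))"
      by (rule continuous_on_compose2[OF Lc])
         (use inW in \<open>auto intro!: continuous_intros continuous_on_compose2[OF A] continuous_on_compose2[OF \<eta>]
            continuous_on_compose2[OF zc]\<close>)
    then have "continuous_on (({a..b} \<times> UNIV) \<times> cbox lo hi)
      (\<lambda>(p, s). L (A (fst p, s) + r *\<^sub>R \<eta> (fst p, s) + (snd p - z (fst p)) *\<^sub>R \<zeta>))"
      by (simp add: case_prod_beta')
    from integral_continuous_on_param[OF this] show "continuous_on ({a..b} \<times> UNIV) (\<lambda>(t, y). f r t y)"
      by (simp add: f_def case_prod_beta')
  next
    fix r r' t y y' :: real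
    assume r: "\<bar>r\<bar> \<le> 1" "\<bar>r'\<bar> \<le> 1" and t: "t \<in> {a..b}" and y: "\<bar>y - z t\<bar> \<le> 1" "\<bar>y' - z t\<bar> \<le> 1"
    define u where "u s = A (t, s) + r *\<^sub>R \<eta> (t, s) + (y - z t) *\<^sub>R \<zeta>" for s
    define v where "v s = A (t, s) + r' *\<^sub>R \<eta> (t, s) + (y' - z t) *\<^sub>R \<zeta>" for s
    have int: "(\<lambda>s. L (u s)) integrable_on cbox lo hi" "(\<lambda>s. L (v s)) integrable_on cbox lo hi"
      unfolding u_def v_def by (rule Lint[OF t])+
    have "f r t y - f r' t y' = integral (cbox lo hi) (\<lambda>s. L (u s) - L (v s))"
      unfolding f_def using int by (simp add: integral_diff u_def v_def)
    also have "norm \<dots> \<le> integral (cbox lo hi) (\<lambda>s. B * (N * (\<bar>r - r'\<bar> + \<bar>y - y'\<bar>)))"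
    proof (rule integral_norm_bound_integral)
      fix s assume s: "s \<in> cbox lo hi"
      have ts: "(t, s) \<in> ?D" using s t by simp
      have "u s \<in> W0" "v s \<in> W0" unfolding u_def v_def using r y by (intro inW0[OF ts]; simp)+
      then have "norm (L (u s) - L (v s)) \<le> B * norm (u s - v s)" by (simp add: Llip)
      also have "u s - v s = (r - r') *\<^sub>R \<eta> (t, s) + (y - y') *\<^sub>R \<zeta>"
        by (simp add: u_def v_def algebra_simps)
      finally show "norm (L (u s) - L (v s)) \<le> B * (N * (\<bar>r - r'\<bar> + \<bar>y - y'\<bar>))"
        using mult_left_mono[OF dir[OF ts, of "r - r'" "y - y'"] less_imp_le[OF B(2)]] by linarith
    qed (use int in \<open>auto intro: integrable_diff\<close>)
    finally show "\<bar>f r t y - f r' t y'\<bar> \<le> vol * (B * N) * (\<bar>r - r'\<bar> + \<bar>y - y'\<bar>)"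
      by (simp add: vol_def mult_ac)
  next
    show "\<forall>t\<in>{a..b}. (z has_real_derivative f 0 t (z t)) (at t within {a..b})"
      using z by (simp add: f_def)
  next
    fix e :: real assume e: "0 < e"
    \<comment> \<open>The pointwise error is integrated over the box, whose volume may be 0 here;
      hence \<open>vol + 1\<close>.\<close>
    define e' where "e' = e / (N * (vol + 1))"
    have e': "0 < e'" using e N vol by (simp add: e'_def)
    obtain \<delta> where \<delta>: "0 < \<delta>"
      "\<And>u v. u \<in> W0 \<Longrightarrow> v \<in> W0 \<Longrightarrow> norm (v - u) < \<delta> \<Longrightarrow> \<bar>L v - L u - L' u (v - u)\<bar> \<le> e' * norm (v - u)"
      using uniform_linearization[OF L0 L0' W0(1,2) e'] by blast
    define \<delta>' where "\<delta>' = min 1 (\<delta> / (2 * N))"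
    have \<delta>': "0 < \<delta>'" "\<delta>' \<le> 1" "\<delta>' \<le> \<delta> / (2 * N)" using \<delta> N by (auto simp: \<delta>'_def)
    then have N\<delta>': "N * (2 * \<delta>') \<le> \<delta>" using N by (simp add: field_simps)
    have "\<bar>f r t y - f 0 t (z t) - r * Q t - P t * (y - z t)\<bar> \<le> e * (\<bar>r\<bar> + \<bar>y - z t\<bar>)"
      if t: "t \<in> {a..b}" and r: "\<bar>r\<bar> < \<delta>'" and y: "\<bar>y - z t\<bar> < \<delta>'" for r y t
    proof -
      define q where "q = y - z t"
      have q: "\<bar>q\<bar> < \<delta>'" using y by (simp add: q_def)
      define d where "d s = r *\<^sub>R \<eta> (t, s) + q *\<^sub>R \<zeta>" for s
      have int: "(\<lambda>s. L (A (t, s) + d s)) integrable_on cbox lo hi" "(\<lambda>s. L (A (t, s))) integrable_on cbox lo hi"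
        using Lint[OF t, of r q] Lint[OF t, of 0 0] by (simp_all add: d_def add.assoc)
      have "(\<lambda>s. r * L' (A (t, s)) (\<eta> (t, s)) + q * L' (A (t, s)) \<zeta>) integrable_on cbox lo hi"
        using LP[OF t] LQ[OF t] by (intro integrable_add integrable_on_mult_right)
      then have int': "(\<lambda>s. L' (A (t, s)) (d s)) integrable_on cbox lo hi"
        by (simp add: d_def blinfun.add_right blinfun.scaleR_right)
      have "integral (cbox lo hi) (\<lambda>s. L' (A (t, s)) (d s)) = r * Q t + q * P t"
        using LP[OF t] LQ[OF t] unfolding d_def Q_def P_def blinfun.add_right blinfun.scaleR_right real_scaleR_def
        by (subst integral_add) (auto intro: integrable_on_mult_right)
      then have "f r t y - f 0 t (z t) - r * Q t - P t * (y - z t)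
          = integral (cbox lo hi) (\<lambda>s. L (A (t, s) + d s) - L (A (t, s)) - L' (A (t, s)) (d s))"
        using int int' by (simp add: integral_diff integrable_diff f_def d_def q_def add.assoc mult.commute)
      also have "norm \<dots> \<le> integral (cbox lo hi) (\<lambda>s. e' * (N * (\<bar>r\<bar> + \<bar>q\<bar>)))"
      proof (rule integral_norm_bound_integral)
        fix s assume s: "s \<in> cbox lo hi"
        have ts: "(t, s) \<in> ?D" using s t by simp
        have W: "A (t, s) \<in> W0" "A (t, s) + d s \<in> W0"
          using inW0[OF ts, of 0 0] inW0[OF ts, of r q] r q \<delta>' by (simp_all add: d_def add.assoc)
        have d: "norm (d s) \<le> N * (\<bar>r\<bar> + \<bar>q\<bar>)" unfolding d_def by (rule dir[OF ts])
        also have "\<dots> < N * (2 * \<delta>')" using r q N by (intro mult_strict_left_mono) auto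
        finally have "norm (A (t, s) + d s - A (t, s)) < \<delta>" using N\<delta>' by simp
        from \<delta>(2)[OF W this] have "norm (L (A (t, s) + d s) - L (A (t, s)) - L' (A (t, s)) (d s)) \<le> e' * norm (d s)" by simp
        also have "\<dots> \<le> e' * (N * (\<bar>r\<bar> + \<bar>q\<bar>))" using d e' by (intro mult_left_mono) auto
        finally show "norm (L (A (t, s) + d s) - L (A (t, s)) - L' (A (t, s)) (d s)) \<le> e' * (N * (\<bar>r\<bar> + \<bar>q\<bar>))" .
      qed (use int int' in \<open>auto intro!: integrable_diff\<close>)
      also have "\<dots> = vol * (e' * (N * (\<bar>r\<bar> + \<bar>q\<bar>)))" by (simp add: vol_def)
      also have "\<dots> \<le> (vol + 1) * (e' * (N * (\<bar>r\<bar> + \<bar>q\<bar>)))"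
        using e' N by (intro mult_right_mono) auto
      also have "\<dots> = e * (\<bar>r\<bar> + \<bar>q\<bar>)" using N vol by (simp add: e'_def)
      finally show ?thesis by (simp add: q_def)
    qed
    then show "\<exists>\<delta>>0. \<forall>r y. \<forall>t\<in>{a..b}. \<bar>r\<bar> < \<delta> \<and> \<bar>y - z t\<bar> < \<delta> \<longrightarrow>
      \<bar>f r t y - f 0 t (z t) - r * Q t - P t * (y - z t)\<bar> \<le> e * (\<bar>r\<bar> + \<bar>y - z t\<bar>)"
      using \<delta>'(1) by blast
  qed
qed

section \<open>Variations of the Herglotz problem\<close>

lemma slice_s_eq: "slice_s i f t s = (\<lambda>\<sigma>. f (t, vec_upd s i \<sigma>))"
  by (simp add: slice_s_def vec_upd_def)

lemma slice_s_vec_upd [simp]: "slice_s i f t (vec_upd s i \<sigma>) = slice_s i f t s"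
proof -
  have "vec_upd (vec_upd s i \<sigma>) i \<sigma>' = vec_upd s i \<sigma>'" for \<sigma>'
    by (simp add: vec_eq_iff)
  then show ?thesis by (simp add: slice_s_eq)
qed

lemma slice_t_has_derivative:
  assumes "C1_on ({a..b} \<times> cbox lo hi) y" "s \<in> cbox lo hi"
  obtains y' where "has_deriv_on a b (slice_t y s) y'"
    and "continuous_on {a..b} y'"
proof -
  have "((\<lambda>\<tau>. (\<tau>, s)) has_vector_derivative (1, 0)) (at \<tau> within {a..b})" for \<tau>
    by (auto intro!: derivative_eq_intros has_vector_derivative_Pair)
  then show thesis
    using C1_on_line[OF assms(1), of a b "\<lambda>\<tau>. (\<tau>, s)" "(1, 0)"] assms(2) that
    unfolding slice_t_def by auto
qed

lemma slice_s_has_derivative: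
  assumes "C1_on ({a..b} \<times> cbox lo hi) y" "t \<in> {a..b}" "s \<in> cbox lo hi"
  obtains y' where "has_deriv_on (lo $ i) (hi $ i) (slice_s i y t s) y'"
    and "continuous_on {lo $ i..hi $ i} y'"
proof -
  have "((\<lambda>\<sigma>. (t, vec_upd s i \<sigma>)) has_vector_derivative (0, axis i 1)) (at \<sigma> within S)" for \<sigma> S
    unfolding vec_upd_eq by (auto intro!: derivative_eq_intros has_vector_derivative_Pair)
  note d = this
  show thesis
  proof (rule C1_on_line[OF assms(1), of "lo $ i" "hi $ i" "\<lambda>\<sigma>. (t, vec_upd s i \<sigma>)"])
    show "(t, vec_upd s i \<tau>) \<in> {a..b} \<times> cbox lo hi" if "\<tau> \<in> {lo $ i..hi $ i}" for \<tau>
      using assms(2) vec_upd_in_cbox[OF assms(3) that] by simp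
  qed (use d that in \<open>auto simp: slice_s_eq\<close>)
qed

lemma combined_caputo_slice_t_linear:
  assumes ab: "a < b" and C1: "C1_on ({a..b} \<times> cbox lo hi) x" "C1_on ({a..b} \<times> cbox lo hi) y"
    and t: "t \<in> {a..b}" and s: "s \<in> cbox lo hi"
    and ex: "combined_caputo_exists \<alpha> \<beta> a b (slice_t x s) t" "combined_caputo_exists \<alpha> \<beta> a b (slice_t y s) t"
    and h: "\<And>p. p \<in> {a..b} \<times> cbox lo hi \<Longrightarrow> h p = r * x p + q * y p"
  shows "combined_caputo_exists \<alpha> \<beta> a b (slice_t h s) t" (is ?ex)
    and "combined_caputo \<gamma> \<alpha> \<beta> a b (slice_t h s) t
      = r * combined_caputo \<gamma> \<alpha> \<beta> a b (slice_t x s) t + q * combined_caputo \<gamma> \<alpha> \<beta> a b (slice_t y s) t" (is ?eq)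
proof -
  obtain x' where x': "has_deriv_on a b (slice_t x s) x'"
    using slice_t_has_derivative[OF C1(1) s] by blast
  obtain y' where y': "has_deriv_on a b (slice_t y s) y'"
    using slice_t_has_derivative[OF C1(2) s] by blast
  have "slice_t h s \<tau> = r * slice_t x s \<tau> + q * slice_t y s \<tau>" if "\<tau> \<in> {a..b}" for \<tau>
    using h s that by (simp add: slice_t_def)
  from combined_caputo_linear[OF ab t x' y' ex this]
  show ?ex ?eq
    by blast+
qed

lemma combined_caputo_slice_s_linear:
  assumes lohi: "lo $ i < hi $ i" and C1: "C1_on ({a..b} \<times> cbox lo hi) x" "C1_on ({a..b} \<times> cbox lo hi) y"
    and t: "t \<in> {a..b}" and s: "s \<in> cbox lo hi"
    and ex: "combined_caputo_exists \<alpha> \<beta> (lo $ i) (hi $ i) (slice_s i x t s) (s $ i)"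
      "combined_caputo_exists \<alpha> \<beta> (lo $ i) (hi $ i) (slice_s i y t s) (s $ i)"
    and h: "\<And>p. p \<in> {a..b} \<times> cbox lo hi \<Longrightarrow> h p = r * x p + q * y p"
  shows "combined_caputo_exists \<alpha> \<beta> (lo $ i) (hi $ i) (slice_s i h t s) (s $ i)" (is ?ex)
    and "combined_caputo \<gamma> \<alpha> \<beta> (lo $ i) (hi $ i) (slice_s i h t s) (s $ i)
      = r * combined_caputo \<gamma> \<alpha> \<beta> (lo $ i) (hi $ i) (slice_s i x t s) (s $ i)
        + q * combined_caputo \<gamma> \<alpha> \<beta> (lo $ i) (hi $ i) (slice_s i y t s) (s $ i)" (is ?eq)
proof -
  obtain x' where x': "has_deriv_on (lo $ i) (hi $ i) (slice_s i x t s) x'"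
    using slice_s_has_derivative[OF C1(1) t s] by blast
  obtain y' where y': "has_deriv_on (lo $ i) (hi $ i) (slice_s i y t s) y'"
    using slice_s_has_derivative[OF C1(2) t s] by blast
  have si: "s $ i \<in> {lo $ i..hi $ i}" using s by (auto simp: mem_box_cart)
  have "slice_s i h t s \<tau> = r * slice_s i x t s \<tau> + q * slice_s i y t s \<tau>" if "\<tau> \<in> {lo $ i..hi $ i}" for \<tau>
    using h t vec_upd_in_cbox[OF s that] by (simp add: slice_s_eq)
  from combined_caputo_linear[OF lohi si x' y' ex this]
  show ?ex ?eq
    by blast+
qed

text \<open>Regularity is assumed for functions with the boundary values \<open>g\<close>. A
  variation with zero boundary values inherits it as the difference of two such functions.\<close>

lemma caputo_regular_diff:
  assumes ab: "a < b" and lohi: "\<And>i. lo $ i < hi $ i"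
    and C1: "C1_on ({a..b} \<times> cbox lo hi) x" "C1_on ({a..b} \<times> cbox lo hi) y"
    and reg: "caputo_regular a b lo hi \<gamma> \<gamma>s \<alpha> \<beta> \<alpha>s \<beta>s x" "caputo_regular a b lo hi \<gamma> \<gamma>s \<alpha> \<beta> \<alpha>s \<beta>s y"
    and h: "\<And>p. p \<in> {a..b} \<times> cbox lo hi \<Longrightarrow> h p = y p - x p"
  shows "caputo_regular a b lo hi \<gamma> \<gamma>s \<alpha> \<beta> \<alpha>s \<beta>s h"
proof -
  have h': "h p = (-1) * x p + 1 * y p" if "p \<in> {a..b} \<times> cbox lo hi" for p
    using h[OF that] by simp
  have ext: "combined_caputo_exists \<alpha> \<beta> a b (slice_t x s) t" "combined_caputo_exists \<alpha> \<beta> a b (slice_t y s) t"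
    if "t \<in> {a..b}" "s \<in> cbox lo hi" for t s
    using reg that by (auto simp: caputo_regular_def)
  have exs: "combined_caputo_exists (\<alpha>s i) (\<beta>s i) (lo $ i) (hi $ i) (slice_s i x t s) (s $ i)"
    "combined_caputo_exists (\<alpha>s i) (\<beta>s i) (lo $ i) (hi $ i) (slice_s i y t s) (s $ i)"
    if "t \<in> {a..b}" "s \<in> cbox lo hi" for t s i
    using reg that by (auto simp: caputo_regular_def)
  note T = combined_caputo_slice_t_linear[OF ab C1 _ _ ext h']
  note S = combined_caputo_slice_s_linear[OF lohi C1 _ _ exs h']
  show ?thesis
    unfolding caputo_regular_def
  proof (intro conjI allI ballI)
    show "combined_caputo_exists \<alpha> \<beta> a b (slice_t h s) t" if "t \<in> {a..b}" "s \<in> cbox lo hi" for t s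
      using that by (intro T(1))
    show "combined_caputo_exists (\<alpha>s i) (\<beta>s i) (lo $ i) (hi $ i) (slice_s i h t s) (s $ i)"
      if "t \<in> {a..b}" "s \<in> cbox lo hi" for t s i
      using that by (intro S(1))
    have "continuous_on ({a..b} \<times> cbox lo hi)
       (\<lambda>p. (-1) * (case p of (t, s) \<Rightarrow> combined_caputo \<gamma> \<alpha> \<beta> a b (slice_t x s) t)
          + 1 * (case p of (t, s) \<Rightarrow> combined_caputo \<gamma> \<alpha> \<beta> a b (slice_t y s) t))"
      using reg by (intro continuous_intros) (auto simp: caputo_regular_def)
    then show "continuous_on ({a..b} \<times> cbox lo hi) (\<lambda>(t, s). combined_caputo \<gamma> \<alpha> \<beta> a b (slice_t h s) t)"
      by (rule continuous_on_eq) (auto simp: T(2))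
    fix i
    have "continuous_on ({a..b} \<times> cbox lo hi)
       (\<lambda>p. (-1) * (case p of (t, s) \<Rightarrow> combined_caputo (\<gamma>s i) (\<alpha>s i) (\<beta>s i) (lo $ i) (hi $ i) (slice_s i x t s) (s $ i))
          + 1 * (case p of (t, s) \<Rightarrow> combined_caputo (\<gamma>s i) (\<alpha>s i) (\<beta>s i) (lo $ i) (hi $ i) (slice_s i y t s) (s $ i)))"
      using reg by (intro continuous_intros) (auto simp: caputo_regular_def)
    then show "continuous_on ({a..b} \<times> cbox lo hi)
       (\<lambda>(t, s). combined_caputo (\<gamma>s i) (\<alpha>s i) (\<beta>s i) (lo $ i) (hi $ i) (slice_s i h t s) (s $ i))"
      by (rule continuous_on_eq) (auto simp: S(2))
  qed
qed

text \<open>The argument of the Lagrangian depends linearly on \<open>x\<close> through the Caputo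
  derivatives, and on \<open>z\<close> through the last slot only. The perturbed argument is thus
  exactly of the form treated in \<open>lagrangian_variation\<close>, for any \<open>w\<close> and
  \<open>z\<close>.\<close>

lemma herglotz_arg_add:
  assumes ab: "a < b" and lohi: "\<And>i. lo $ i < hi $ i"
    and C1: "C1_on ({a..b} \<times> cbox lo hi) x" "C1_on ({a..b} \<times> cbox lo hi) h"
    and reg: "caputo_regular a b lo hi \<gamma> \<gamma>s \<alpha> \<beta> \<alpha>s \<beta>s x" "caputo_regular a b lo hi \<gamma> \<gamma>s \<alpha> \<beta> \<alpha>s \<beta>s h"
    and p: "t \<in> {a..b}" "s \<in> cbox lo hi"
  shows "herglotz_arg a b lo hi \<gamma> \<gamma>s \<alpha> \<beta> \<alpha>s \<beta>s (\<lambda>p. x p + \<epsilon> * h p) w (t, s)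
    = herglotz_arg a b lo hi \<gamma> \<gamma>s \<alpha> \<beta> \<alpha>s \<beta>s x z (t, s)
      + \<epsilon> *\<^sub>R (0, 0, h (t, s), combined_caputo \<gamma> \<alpha> \<beta> a b (slice_t h s) t,
        (\<chi> i. combined_caputo (\<gamma>s i) (\<alpha>s i) (\<beta>s i) (lo $ i) (hi $ i) (slice_s i h t s) (s $ i)), 0)
      + (w t - z t) *\<^sub>R (0, 0, 0, 0, 0, 1)"
proof -
  have ext: "combined_caputo_exists \<alpha> \<beta> a b (slice_t x s) t" "combined_caputo_exists \<alpha> \<beta> a b (slice_t h s) t"
    using reg p by (auto simp: caputo_regular_def)
  have exs: "combined_caputo_exists (\<alpha>s i) (\<beta>s i) (lo $ i) (hi $ i) (slice_s i x t s) (s $ i)"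
    "combined_caputo_exists (\<alpha>s i) (\<beta>s i) (lo $ i) (hi $ i) (slice_s i h t s) (s $ i)" for i
    using reg p by (auto simp: caputo_regular_def)
  have "x p + \<epsilon> * h p = 1 * x p + \<epsilon> * h p" for p by simp
  from combined_caputo_slice_t_linear(2)[OF ab C1 p ext this] combined_caputo_slice_s_linear(2)[OF lohi C1 p exs this]
  show ?thesis
    by (simp add: herglotz_arg_def vec_eq_iff)
qed

lemma continuous_on_herglotz_arg:
  assumes "continuous_on ({a..b} \<times> cbox lo hi) x" "continuous_on {a..b} z"
    and "caputo_regular a b lo hi \<gamma> \<gamma>s \<alpha> \<beta> \<alpha>s \<beta>s x"
  shows "continuous_on ({a..b} \<times> cbox lo hi) (herglotz_arg a b lo hi \<gamma> \<gamma>s \<alpha> \<beta> \<alpha>s \<beta>s x z)"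
proof -
  have "continuous_on ({a..b} \<times> cbox lo hi) (\<lambda>p. z (fst p))"
    by (rule continuous_on_compose2[OF assms(2)]) (auto intro!: continuous_intros)
  then show ?thesis
    using assms(1,3) unfolding herglotz_arg_def case_prod_beta' caputo_regular_def
    by (intro continuous_intros continuous_on_vec_lambda) (auto simp: case_prod_beta')
qed

text \<open>The differential is relative to the domain, where \<open>t\<close> and \<open>s\<close>
  may be boundary points. The remaining slots range over everything, so the coordinate lines in
  these directions stay inside the domain and yield two-sided derivatives.\<close>

lemma partial_derivatives:
  fixes L :: "('n::finite) lagrangian_arg \<Rightarrow> real"
  assumes L: "(L has_derivative blinfun_apply D) (at (t, s, x, u, v, z) within (S \<times> R \<times> UNIV))"
    and ts: "t \<in> S" "s \<in> R"
  shows "partial_x L (t, s, x, u, v, z) = D (0, 0, 1, 0, 0, 0)"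
    and "partial_Dt L (t, s, x, u, v, z) = D (0, 0, 0, 1, 0, 0)"
    and "partial_Ds i L (t, s, x, u, v, z) = D (0, 0, 0, 0, axis i 1, 0)"
    and "partial_z L (t, s, x, u, v, z) = D (0, 0, 0, 0, 0, 1)"
proof -
  have gen: "deriv (\<lambda>r. L (q r)) c = D e"
    if q: "(q has_vector_derivative e) (at c)" and qc: "q c = (t, s, x, u, v, z)" and im: "range q \<subseteq> S \<times> R \<times> UNIV" for q c e
  proof -
    have "(L has_derivative blinfun_apply D) (at (q c) within range q)"
      unfolding qc by (rule has_derivative_subset[OF L im])
    from vector_derivative_diff_chain_within[OF q this]
    have "((\<lambda>r. L (q r)) has_real_derivative D e) (at c)"
      by (simp add: o_def has_real_derivative_iff_has_vector_derivative)
    then show ?thesis by (rule DERIV_imp_deriv)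
  qed
  have "((\<lambda>r. (t, s, r, u, v, z)) has_vector_derivative (0, 0, 1, 0, 0, 0)) (at x)"
    by (auto intro!: derivative_eq_intros has_vector_derivative_Pair simp: zero_prod_def)
  then show "partial_x L (t, s, x, u, v, z) = D (0, 0, 1, 0, 0, 0)"
    unfolding partial_x_def prod.case by (rule gen) (use ts in auto)
  have "((\<lambda>r. (t, s, x, r, v, z)) has_vector_derivative (0, 0, 0, 1, 0, 0)) (at u)"
    by (auto intro!: derivative_eq_intros has_vector_derivative_Pair simp: zero_prod_def)
  then show "partial_Dt L (t, s, x, u, v, z) = D (0, 0, 0, 1, 0, 0)"
    unfolding partial_Dt_def prod.case by (rule gen) (use ts in auto)
  have "((\<lambda>r. (t, s, x, u, vec_upd v i r, z)) has_vector_derivative (0, 0, 0, 0, axis i 1, 0)) (at (v $ i))"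
    unfolding vec_upd_eq by (auto intro!: derivative_eq_intros has_vector_derivative_Pair simp: zero_prod_def)
  then show "partial_Ds i L (t, s, x, u, v, z) = D (0, 0, 0, 0, axis i 1, 0)"
    unfolding partial_Ds_def prod.case vec_upd_def[symmetric] by (rule gen) (use ts in auto)
  have "((\<lambda>r. (t, s, x, u, v, r)) has_vector_derivative (0, 0, 0, 0, 0, 1)) (at z)"
    by (auto intro!: derivative_eq_intros has_vector_derivative_Pair simp: zero_prod_def)
  then show "partial_z L (t, s, x, u, v, z) = D (0, 0, 0, 0, 0, 1)"
    unfolding partial_z_def prod.case by (rule gen) (use ts in auto)
qed

section \<open>Kernel bounds in each variable of the box\<close>

lemma caputo_kernel_bound_scaled:
  fixes \<gamma> :: "real \<times> real"
  assumes cd: "c < d" and \<alpha>: "variable_order c d \<alpha>" and \<beta>: "variable_order c d \<beta>"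
    and \<gamma>: "0 \<le> fst \<gamma>" "0 \<le> snd \<gamma>"
    and reg: "\<And>\<phi> \<phi>'. \<lbrakk>has_deriv_on c d \<phi> \<phi>'; continuous_on {c..d} \<phi>'; \<phi> c = 0; \<phi> d = 0\<rbrakk>
      \<Longrightarrow> \<exists>r>0. (\<forall>t\<in>{c..d}. combined_caputo_exists \<alpha> \<beta> c d (\<lambda>\<tau>. r * \<phi> \<tau>) t) \<and>
          continuous_on {c..d} (combined_caputo \<gamma> \<alpha> \<beta> c d (\<lambda>\<tau>. r * \<phi> \<tau>))"
  shows "\<exists>K. bounded_kernels \<gamma> \<alpha> \<beta> c d K"
proof (rule caputo_kernel_bound[OF cd \<alpha> \<beta> \<gamma>])
  fix \<phi> \<phi>' :: "real \<Rightarrow> real"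
  assume \<phi>: "has_deriv_on c d \<phi> \<phi>'" "continuous_on {c..d} \<phi>'" "\<phi> c = 0" "\<phi> d = 0"
  obtain r where r: "0 < r" and ex: "\<And>t. t \<in> {c..d} \<Longrightarrow> combined_caputo_exists \<alpha> \<beta> c d (\<lambda>\<tau>. r * \<phi> \<tau>) t"
    and cont: "continuous_on {c..d} (combined_caputo \<gamma> \<alpha> \<beta> c d (\<lambda>\<tau>. r * \<phi> \<tau>))"
    using reg[OF \<phi>] by blast
  have d: "has_deriv_on c d (\<lambda>\<tau>. r * \<phi> \<tau>) (\<lambda>\<tau>. r * \<phi>' \<tau>)"
    using \<phi>(1) by (auto intro!: derivative_eq_intros)
  \<comment> \<open>The factor \<open>r\<close> is what remains of the other factors of a product
    after freezing their variables; linearity with coefficients \<open>1 / r\<close> and 0 removes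
    it.\<close>
  have "\<phi> \<tau> = (1 / r) * (r * \<phi> \<tau>) + 0 * (r * \<phi> \<tau>)" for \<tau>
    using r by simp
  note * = combined_caputo_linear[OF cd _ d d ex ex this]
  have "continuous_on {c..d} (\<lambda>t. (1 / r) * combined_caputo \<gamma> \<alpha> \<beta> c d (\<lambda>\<tau>. r * \<phi> \<tau>) t)"
    by (intro continuous_intros cont)
  then have "continuous_on {c..d} (combined_caputo \<gamma> \<alpha> \<beta> c d \<phi>)"
    by (rule continuous_on_eq) (simp add: *(2))
  from compact_imp_bounded[OF compact_continuous_image[OF this]]
  have "\<exists>M. \<forall>t\<in>{c..d}. \<bar>combined_caputo \<gamma> \<alpha> \<beta> c d \<phi> t\<bar> \<le> M" by (auto simp: bounded_iff)
  then show "(\<forall>t\<in>{c..d}. combined_caputo_exists \<alpha> \<beta> c d \<phi> t) \<and>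
      (\<exists>M. \<forall>t\<in>{c..d}. \<bar>combined_caputo \<gamma> \<alpha> \<beta> c d \<phi> t\<bar> \<le> M)"
    using *(1) by blast
qed

text \<open>Multiplying \<open>\<phi>\<close> by bumps in the space variables gives a function
  vanishing on the whole boundary, so \<open>reg\<close> applies. At the centre \<open>s0\<close>
  all bumps are positive, and the slice there is a positive multiple of
  \<open>\<phi>\<close>.\<close>

lemma kernel_bound_t:
  fixes \<gamma> :: "real \<times> real"
  assumes ab: "a < b" and lohi: "\<And>i. lo $ i < hi $ i"
    and \<alpha>: "variable_order a b \<alpha>" and \<beta>: "variable_order a b \<beta>" and \<gamma>: "0 \<le> fst \<gamma>" "0 \<le> snd \<gamma>"
    and reg: "\<And>h. C1_on ({a..b} \<times> cbox lo hi) h \<Longrightarrow> (\<And>p. p \<in> frontier ({a..b} \<times> cbox lo hi) \<Longrightarrow> h p = 0)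
      \<Longrightarrow> caputo_regular a b lo hi \<gamma> \<gamma>s \<alpha> \<beta> \<alpha>s \<beta>s h"
  shows "\<exists>K. bounded_kernels \<gamma> \<alpha> \<beta> a b K"
proof (rule caputo_kernel_bound_scaled[OF ab \<alpha> \<beta> \<gamma>])
  fix \<phi> \<phi>' :: "real \<Rightarrow> real"
  assume d: "has_deriv_on a b \<phi> \<phi>'" "continuous_on {a..b} \<phi>'"
    and ends: "\<phi> a = 0" "\<phi> b = 0"
  define h where "h = tensor \<phi> (\<lambda>i. bump (lo $ i) (hi $ i))"
  define s0 where "s0 = (1 / 2) *\<^sub>R (lo + hi)"
  define c0 where "c0 = (\<Prod>i\<in>UNIV. bump (lo $ i) (hi $ i) (s0 $ i))"
  have s0: "lo $ i < s0 $ i" "s0 $ i < hi $ i" for i using lohi[of i] by (auto simp: s0_def)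
  then have s0': "s0 \<in> cbox lo hi" by (auto simp: mem_box_cart less_imp_le)
  have c0: "0 < c0" unfolding c0_def by (intro prod_pos bump_pos s0)
  have C1: "C1_on ({a..b} \<times> cbox lo hi) h"
    unfolding h_def by (rule C1_on_tensor[OF d]) (auto intro: bump_has_derivative continuous_on_bump')
  have "caputo_regular a b lo hi \<gamma> \<gamma>s \<alpha> \<beta> \<alpha>s \<beta>s h"
    using ends by (intro reg C1) (auto simp: h_def intro!: tensor_eq_0_on_frontier)
  then have ex: "\<And>t. t \<in> {a..b} \<Longrightarrow> combined_caputo_exists \<alpha> \<beta> a b (slice_t h s0) t"
    and cont: "continuous_on ({a..b} \<times> cbox lo hi) (\<lambda>(t, s). combined_caputo \<gamma> \<alpha> \<beta> a b (slice_t h s) t)"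
    using s0' by (auto simp: caputo_regular_def)
  have eq: "slice_t h s0 = (\<lambda>\<tau>. c0 * \<phi> \<tau>)"
    by (auto simp: slice_t_def h_def tensor_def c0_def)
  have "continuous_on {a..b} (\<lambda>t. (\<lambda>(t, s). combined_caputo \<gamma> \<alpha> \<beta> a b (slice_t h s) t) (t, s0))"
    by (rule continuous_on_compose2[OF cont]) (use s0' in \<open>auto intro!: continuous_intros\<close>)
  then show "\<exists>r>0. (\<forall>t\<in>{a..b}. combined_caputo_exists \<alpha> \<beta> a b (\<lambda>\<tau>. r * \<phi> \<tau>) t) \<and>
      continuous_on {a..b} (combined_caputo \<gamma> \<alpha> \<beta> a b (\<lambda>\<tau>. r * \<phi> \<tau>))"
    using c0 ex by (intro exI[of _ c0]) (simp add: eq)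
qed

text \<open>Now \<open>\<phi>\<close> takes the place of the \<open>i\<close>-th bump, and a bump in
  time is added. The line through the centre in direction \<open>i\<close> sees a positive multiple
  of \<open>\<phi>\<close>, and moving the \<open>i\<close>-th coordinate of the base point leaves
  that line unchanged.\<close>

lemma kernel_bound_s:
  fixes \<gamma>s :: "'n::finite \<Rightarrow> real \<times> real"
  assumes ab: "a < b" and lohi: "\<And>i. lo $ i < hi $ i"
    and \<alpha>: "variable_order (lo $ i) (hi $ i) (\<alpha>s i)" and \<beta>: "variable_order (lo $ i) (hi $ i) (\<beta>s i)"
    and \<gamma>: "0 \<le> fst (\<gamma>s i)" "0 \<le> snd (\<gamma>s i)"
    and reg: "\<And>h. C1_on ({a..b} \<times> cbox lo hi) h \<Longrightarrow> (\<And>p. p \<in> frontier ({a..b} \<times> cbox lo hi) \<Longrightarrow> h p = 0)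
      \<Longrightarrow> caputo_regular a b lo hi \<gamma> \<gamma>s \<alpha> \<beta> \<alpha>s \<beta>s h"
  shows "\<exists>K. bounded_kernels (\<gamma>s i) (\<alpha>s i) (\<beta>s i) (lo $ i) (hi $ i) K"
proof (rule caputo_kernel_bound_scaled[OF lohi \<alpha> \<beta> \<gamma>])
  fix \<phi> \<phi>' :: "real \<Rightarrow> real"
  assume d: "has_deriv_on (lo $ i) (hi $ i) \<phi> \<phi>'"
      "continuous_on {lo $ i..hi $ i} \<phi>'"
    and ends: "\<phi> (lo $ i) = 0" "\<phi> (hi $ i) = 0"
  define h where "h = tensor (bump a b) (\<lambda>j. if j = i then \<phi> else bump (lo $ j) (hi $ j))"
  define s0 where "s0 = (1 / 2) *\<^sub>R (lo + hi)"
  define t0 where "t0 = (a + b) / 2"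
  define c0 where "c0 = bump a b t0 * (\<Prod>j\<in>UNIV - {i}. bump (lo $ j) (hi $ j) (s0 $ j))"
  have s0: "lo $ i < s0 $ i" "s0 $ i < hi $ i" for i using lohi[of i] by (auto simp: s0_def)
  then have s0': "s0 \<in> cbox lo hi" by (auto simp: mem_box_cart less_imp_le)
  have t0: "a < t0" "t0 < b" using ab by (auto simp: t0_def)
  then have t0': "t0 \<in> {a..b}" by simp
  have c0: "0 < c0" unfolding c0_def by (intro mult_pos_pos prod_pos bump_pos s0 t0)
  have C1: "C1_on ({a..b} \<times> cbox lo hi) h"
    unfolding h_def
  proof (rule C1_on_tensor)
    show "has_deriv_on a b (bump a b) (bump' a b)"
      by (auto intro: bump_has_derivative)
    show "continuous_on {a..b} (bump' a b)" by (rule continuous_on_bump')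
    fix j
    show "\<forall>\<tau>\<in>{lo $ j..hi $ j}. ((if j = i then \<phi> else bump (lo $ j) (hi $ j)) has_vector_derivative
        (if j = i then \<phi>' \<tau> else bump' (lo $ j) (hi $ j) \<tau>)) (at \<tau> within {lo $ j..hi $ j})"
      using d(1) by (auto intro: bump_has_derivative)
    show "continuous_on {lo $ j..hi $ j} (\<lambda>\<tau>. if j = i then \<phi>' \<tau> else bump' (lo $ j) (hi $ j) \<tau>)"
      using d(2) continuous_on_bump' by (cases "j = i") auto
  qed
  have "caputo_regular a b lo hi \<gamma> \<gamma>s \<alpha> \<beta> \<alpha>s \<beta>s h"
    using ends by (intro reg C1) (auto simp: h_def intro!: tensor_eq_0_on_frontier)
  then have ex: "\<And>t s. t \<in> {a..b} \<Longrightarrow> s \<in> cbox lo hi \<Longrightarrow>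
      combined_caputo_exists (\<alpha>s i) (\<beta>s i) (lo $ i) (hi $ i) (slice_s i h t s) (s $ i)"
    and cont: "continuous_on ({a..b} \<times> cbox lo hi)
      (\<lambda>(t, s). combined_caputo (\<gamma>s i) (\<alpha>s i) (\<beta>s i) (lo $ i) (hi $ i) (slice_s i h t s) (s $ i))"
    by (auto simp: caputo_regular_def)
  have ex0: "combined_caputo_exists (\<alpha>s i) (\<beta>s i) (lo $ i) (hi $ i) (slice_s i h t0 s0) \<sigma>" if "\<sigma> \<in> {lo $ i..hi $ i}" for \<sigma>
    using ex[OF t0' vec_upd_in_cbox[OF s0' that]] by simp
  have eq: "slice_s i h t0 s0 = (\<lambda>\<tau>. c0 * \<phi> \<tau>)"
    unfolding slice_s_eq h_def tensor_def c0_def by (subst prod.remove[of _ i]) auto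
  have "continuous_on {lo $ i..hi $ i} (\<lambda>\<sigma>. (\<lambda>(t, s). combined_caputo (\<gamma>s i) (\<alpha>s i) (\<beta>s i) (lo $ i) (hi $ i)
      (slice_s i h t s) (s $ i)) (t0, vec_upd s0 i \<sigma>))"
    by (rule continuous_on_compose2[OF cont]) (use s0' t0' in \<open>auto intro!: continuous_intros vec_upd_in_cbox\<close>)
  then show "\<exists>r>0. (\<forall>t\<in>{lo $ i..hi $ i}. combined_caputo_exists (\<alpha>s i) (\<beta>s i) (lo $ i) (hi $ i) (\<lambda>\<tau>. r * \<phi> \<tau>) t) \<and>
      continuous_on {lo $ i..hi $ i} (combined_caputo (\<gamma>s i) (\<alpha>s i) (\<beta>s i) (lo $ i) (hi $ i) (\<lambda>\<tau>. r * \<phi> \<tau>))"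
    using c0 ex0 by (intro exI[of _ c0]) (simp add: eq)
qed

lemma integral_strip:
  fixes G :: "real \<times> 'm::euclidean_space \<Rightarrow> real"
  assumes "continuous_on ({c..d} \<times> cbox lo hi) G"
  shows "integral ({c..d} \<times> cbox lo hi) G = integral {c..d} (\<lambda>t. integral (cbox lo hi) (\<lambda>s. G (t, s)))"
    and "integral ({c..d} \<times> cbox lo hi) G = integral (cbox lo hi) (\<lambda>s. integral {c..d} (\<lambda>t. G (t, s)))"
proof -
  have c: "continuous_on (cbox (c, lo) (d, hi)) G" using assms by (simp add: cbox_Pair_eq)
  show 1: "integral ({c..d} \<times> cbox lo hi) G = integral {c..d} (\<lambda>t. integral (cbox lo hi) (\<lambda>s. G (t, s)))"
    using integral_prod_continuous[OF c] by (simp add: cbox_Pair_eq)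
  have "continuous_on (cbox (c, lo) (d, hi)) (\<lambda>(t, s). G (t, s))" using c by simp
  from integral_swap_continuous[OF this] 1
  show "integral ({c..d} \<times> cbox lo hi) G = integral (cbox lo hi) (\<lambda>s. integral {c..d} (\<lambda>t. G (t, s)))"
    by simp
qed

lemma C1_on_imp_continuous_on:
  assumes "C1_on S f"
  shows "continuous_on S f"
proof -
  obtain f' where "\<And>p. p \<in> S \<Longrightarrow> (f has_derivative blinfun_apply (f' p)) (at p within S)"
    using assms unfolding C1_on_def by blast
  then show ?thesis by (rule has_derivative_continuous_on)
qed

lemma frontier_box_memI:
  fixes a b t :: real and lo hi s :: "real ^ 'n"
  assumes "t \<in> {a..b}" "s \<in> cbox lo hi" and "t = a \<or> t = b \<or> s $ i = lo $ i \<or> s $ i = hi $ i"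
  shows "(t, s) \<in> frontier ({a..b} \<times> cbox lo hi)"
proof -
  have "t \<notin> {a<..<b} \<or> s \<notin> box lo hi"
  proof (rule ccontr)
    assume "\<not> ?thesis"
    then have "a < t" "t < b" "lo $ i < s $ i" "s $ i < hi $ i" by (auto simp: mem_box_cart)
    then show False using assms(3) by auto
  qed
  then show ?thesis
    using assms(1,2) closure_subset[of "{a..b} \<times> cbox lo hi"]
    by (auto simp: frontier_def interior_Times interior_cbox interior_atLeastAtMost_real)
qed

lemma lagrangian_differential:
  fixes D :: "('n::finite) lagrangian_arg \<Rightarrow>\<^sub>L real"
  shows "D (0, 0, r, u, v, 0) = r * D (0, 0, 1, 0, 0, 0) + u * D (0, 0, 0, 1, 0, 0)
    + (\<Sum>i\<in>UNIV. v $ i * D (0, 0, 0, 0, axis i 1, 0))"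
proof -
  define f where "f w = D (0, 0, 0, 0, w, 0)" for w
  have "linear f"
  proof (rule linearI)
    fix w w' and c :: real
    show "f (w + w') = f w + f w'"
      using blinfun.add_right[of D "(0, 0, 0, 0, w, 0)" "(0, 0, 0, 0, w', 0)"] by (simp add: f_def)
    show "f (c *\<^sub>R w) = c *\<^sub>R f w"
      using blinfun.scaleR_right[of D c "(0, 0, 0, 0, w, 0)"] by (simp add: f_def)
  qed
  then have "f (\<Sum>i\<in>UNIV. v $ i *\<^sub>R axis i 1) = (\<Sum>i\<in>UNIV. v $ i * f (axis i 1))"
    by (simp add: linear_sum linear_scale)
  moreover have "(\<Sum>i\<in>UNIV. v $ i *\<^sub>R axis i 1) = v"
    using basis_expansion[of v] by (simp add: scalar_mult_eq_scaleR)
  ultimately have "D (0, 0, 0, 0, v, 0) = (\<Sum>i\<in>UNIV. v $ i * D (0, 0, 0, 0, axis i 1, 0))"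
    by (simp add: f_def)
  moreover have "(0, 0, r, u, v, 0) = r *\<^sub>R (0, 0, 1, 0, 0, 0) + u *\<^sub>R (0, 0, 0, 1, 0, 0)
      + ((0, 0, 0, 0, v, 0) :: 'n lagrangian_arg)"
    by simp
  ultimately show ?thesis
    by (simp only: blinfun.add_right blinfun.scaleR_right real_scaleR_def)
qed

section \<open>The two Euler-Lagrange equations and stationarity in the final time\<close>

theorem theorem4p1:
  fixes a b :: real and lo hi :: "real ^ 'n"
    and \<alpha> \<beta> :: "real \<Rightarrow> real \<Rightarrow> real"
    and \<alpha>s \<beta>s :: "'n \<Rightarrow> real \<Rightarrow> real \<Rightarrow> real"
    and \<gamma> :: "real \<times> real" and \<gamma>s :: "'n \<Rightarrow> real \<times> real"
    and L :: "'n lagrangian_arg \<Rightarrow> real"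
    and g :: "real \<times> (real ^ 'n) \<Rightarrow> real" and za :: real
    and x :: "real \<times> (real ^ 'n) \<Rightarrow> real" and z :: "real \<Rightarrow> real" and T :: real
    and \<Omega> :: "(real ^ 'n) set"
    and br :: "(real \<times> (real ^ 'n) \<Rightarrow> real) \<Rightarrow> (real \<Rightarrow> real) \<Rightarrow> real \<times> (real ^ 'n) \<Rightarrow> 'n lagrangian_arg"
    and \<Lambda> :: "real \<Rightarrow> real"
    and F :: "real \<times> (real ^ 'n) \<Rightarrow> real" and Fs :: "'n \<Rightarrow> real \<times> (real ^ 'n) \<Rightarrow> real"
  defines "\<Omega> \<equiv> cbox lo hi"
    and "br \<equiv> herglotz_arg a b lo hi \<gamma> \<gamma>s \<alpha> \<beta> \<alpha>s \<beta>s"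
    and "\<Lambda> \<equiv> herglotz_multiplier L (br x z) a \<Omega>"
    and "F \<equiv> (\<lambda>(t, s). \<Lambda> t * partial_Dt L (br x z (t, s)))"
    and "Fs \<equiv> (\<lambda>i (t, s). \<Lambda> t * partial_Ds i L (br x z (t, s)))"
  assumes ab: "a < b" and lohi: "\<And>i. lo $ i < hi $ i"
    and orders: "variable_order a b \<alpha>" "variable_order a b \<beta>"
    and orders_s: "\<And>i. variable_order (lo $ i) (hi $ i) (\<alpha>s i)"
                  "\<And>i. variable_order (lo $ i) (hi $ i) (\<beta>s i)"
    and weights: "\<gamma> \<in> {0..1} \<times> {0..1}" "\<And>i. \<gamma>s i \<in> {0..1} \<times> {0..1}"
    and L_C1: "C1_on ({a..b} \<times> \<Omega> \<times> UNIV) L"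
    and caputo: "\<And>y. C1_on ({a..b} \<times> \<Omega>) y \<Longrightarrow> (\<And>p. p \<in> frontier ({a..b} \<times> \<Omega>) \<Longrightarrow> y p = g p)
                   \<Longrightarrow> caputo_regular a b lo hi \<gamma> \<gamma>s \<alpha> \<beta> \<alpha>s \<beta>s y"
    and extremizer: "herglotz_extremizer L br a b \<Omega> g za x z T"
    and left_ex: "\<And>s. s \<in> \<Omega> \<Longrightarrow> rl_left_deriv_exists \<beta> a b (slice_t F s)"
    and left_cont: "continuous_on ({a..b} \<times> \<Omega>) (\<lambda>(t, s). rl_left_deriv \<beta> a b (slice_t F s) t)"
    and right_ex: "\<And>s. s \<in> \<Omega> \<Longrightarrow> rl_right_deriv_exists \<alpha> a T (slice_t F s)"
    and right_cont: "continuous_on ({a..T} \<times> \<Omega>) (\<lambda>(t, s). rl_right_deriv \<alpha> a T (slice_t F s) t)"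
    and left_T_ex: "\<And>s. T < b \<Longrightarrow> s \<in> \<Omega> \<Longrightarrow> rl_left_deriv_exists \<beta> T b (slice_t F s)"
    and left_T_cont: "T < b \<Longrightarrow>
          continuous_on ({T..b} \<times> \<Omega>) (\<lambda>(t, s). rl_left_deriv \<beta> T b (slice_t F s) t)"
    and left_s_ex: "\<And>i t s. t \<in> {a..T} \<Longrightarrow> s \<in> \<Omega> \<Longrightarrow>
          rl_left_deriv_exists (\<beta>s i) (lo $ i) (hi $ i) (slice_s i (Fs i) t s)"
    and left_s_cont: "\<And>i. continuous_on ({a..T} \<times> \<Omega>)
          (\<lambda>(t, s). rl_left_deriv (\<beta>s i) (lo $ i) (hi $ i) (slice_s i (Fs i) t s) (s $ i))"
    and right_s_ex: "\<And>i t s. t \<in> {a..T} \<Longrightarrow> s \<in> \<Omega> \<Longrightarrow>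
          rl_right_deriv_exists (\<alpha>s i) (lo $ i) (hi $ i) (slice_s i (Fs i) t s)"
    and right_s_cont: "\<And>i. continuous_on ({a..T} \<times> \<Omega>)
          (\<lambda>(t, s). rl_right_deriv (\<alpha>s i) (lo $ i) (hi $ i) (slice_s i (Fs i) t s) (s $ i))"
  shows "(\<forall>t\<in>{a..T}. \<forall>s\<in>\<Omega>.
            partial_x L (br x z (t, s)) * \<Lambda> t
            + rl_combined (prod.swap \<gamma>) \<beta> \<alpha> a T (slice_t F s) t
            + (\<Sum>i\<in>UNIV. rl_combined (prod.swap (\<gamma>s i)) (\<beta>s i) (\<alpha>s i) (lo $ i) (hi $ i)
                           (slice_s i (Fs i) t s) (s $ i)) = 0)
       \<and> (T < b \<longrightarrow> (\<forall>t\<in>{T..b}. \<forall>s\<in>\<Omega>.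
            snd \<gamma> * (rl_left_deriv \<beta> a b (slice_t F s) t
                     - rl_left_deriv \<beta> T b (slice_t F s) t) = 0))
       \<and> (\<forall>s\<in>\<Omega>.
            fst \<gamma> * rl_right_integral (\<lambda>t \<tau>. 1 - \<alpha> t \<tau>) T (slice_t F s) T
            - snd \<gamma> * rl_left_integral (\<lambda>t \<tau>. 1 - \<beta> t \<tau>) T (slice_t F s) T = 0)
       \<and> (T < b \<longrightarrow> integral \<Omega> (\<lambda>s. L (br x z (T, s))) = 0)"
proof -
  let ?D = "{a..b} \<times> cbox lo hi"
  let ?DB = "{T..b} \<times> cbox lo hi"
  let ?DT = "{a..T} \<times> cbox lo hi"
  have lo_mem: "lo \<in> \<Omega>" using lohi by (auto simp: \<Omega>_def mem_box_cart less_imp_le)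
  \<comment> \<open>The final time \<open>a\<close> is excluded: existence of right derivatives on
    \<open>{a..T}\<close> includes nondegeneracy of this interval. The corner \<open>lo\<close>
    supplies a point of \<Omega>.\<close>
  have aT: "a < T" using right_ex[OF lo_mem] by (simp add: rl_right_deriv_exists_def)
  have traj: "herglotz_trajectory L br a b \<Omega> g za x z" and Tb: "T \<le> b"
    and opt: "(\<forall>y w S. herglotz_trajectory L br a b \<Omega> g za y w \<and> S \<in> {a..b} \<longrightarrow> z T \<le> w S) \<or>
      (\<forall>y w S. herglotz_trajectory L br a b \<Omega> g za y w \<and> S \<in> {a..b} \<longrightarrow> w S \<le> z T)"
    using extremizer by (auto simp: herglotz_extremizer_def)
  have Tab: "T \<in> {a..b}" using aT Tb by simp
  have C1x: "C1_on ?D x" and xg: "\<And>p. p \<in> frontier ?D \<Longrightarrow> x p = g p"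
    and dz: "\<forall>t\<in>{a..b}. (z has_real_derivative integral (cbox lo hi) (\<lambda>s. L (br x z (t, s)))) (at t within {a..b})"
    and za: "z a = za"
    using traj by (auto simp: herglotz_trajectory_def \<Omega>_def)
  have regx: "caputo_regular a b lo hi \<gamma> \<gamma>s \<alpha> \<beta> \<alpha>s \<beta>s x"
    using caputo C1x xg by (simp add: \<Omega>_def)
  have nn: "0 \<le> fst \<gamma>" "0 \<le> snd \<gamma>" "0 \<le> fst (\<gamma>s i)" "0 \<le> snd (\<gamma>s i)" for i
    using weights(1) weights(2)[of i] by (auto simp: mem_Times_iff)
  define adm where "adm h \<longleftrightarrow> C1_on ?D h \<and> (\<forall>p\<in>frontier ?D. h p = 0)"
    for h :: "real \<times> (real ^ 'n) \<Rightarrow> real"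
  have C1_var: "C1_on ?D (\<lambda>p. x p + r * h p)" if "adm h" for h r
    using that C1x by (auto simp: adm_def intro!: C1_on_add C1_on_mult C1_on_const)
  have regh: "caputo_regular a b lo hi \<gamma> \<gamma>s \<alpha> \<beta> \<alpha>s \<beta>s h" if h: "adm h" for h
  proof -
    have "caputo_regular a b lo hi \<gamma> \<gamma>s \<alpha> \<beta> \<alpha>s \<beta>s (\<lambda>p. x p + 1 * h p)"
      using C1_var[OF h, of 1] h xg by (intro caputo) (auto simp: adm_def \<Omega>_def)
    from caputo_regular_diff[OF ab lohi C1x C1_var[OF h, of 1] regx this] show ?thesis by simp
  qed
  define A where "A = br x z"
  have cx: "continuous_on ?D x"
    by (rule C1_on_imp_continuous_on[OF C1x])
  have cz: "continuous_on {a..b} z" by (rule DERIV_continuous_on) (use dz in blast)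
  have cA: "continuous_on ?D A"
    unfolding A_def br_def by (rule continuous_on_herglotz_arg[OF cx cz regx])
  let ?W = "{a..b} \<times> cbox lo hi \<times> (UNIV :: (real \<times> real \<times> (real ^ 'n) \<times> real) set)"
  obtain L' where L': "\<And>p. p \<in> ?W \<Longrightarrow> (L has_derivative blinfun_apply (L' p)) (at p within ?W)"
    and cL': "continuous_on ?W L'"
    using L_C1 unfolding C1_on_def \<Omega>_def by blast
  have AW: "A p \<in> ?W" if "p \<in> ?D" for p
    using that by (auto simp: A_def br_def herglotz_arg_def)
  have cL'A: "continuous_on ?D (\<lambda>p. L' (A p))"
    by (rule continuous_on_compose2[OF cL' cA]) (use AW in blast)
  have partials: "partial_x L (A p) = L' (A p) (0, 0, 1, 0, 0, 0)" "partial_Dt L (A p) = L' (A p) (0, 0, 0, 1, 0, 0)"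
    "partial_Ds i L (A p) = L' (A p) (0, 0, 0, 0, axis i 1, 0)" "partial_z L (A p) = L' (A p) (0, 0, 0, 0, 0, 1)"
    if p: "p \<in> ?D" for p i
  proof -
    obtain t s x0 u v z0 where eq: "A p = (t, s, x0, u, v, z0)" by (metis surj_pair)
    have ts: "t \<in> {a..b}" "s \<in> cbox lo hi" using AW[OF p] by (auto simp: eq)
    note * = partial_derivatives[OF L'[OF AW[OF p], unfolded eq] ts]
    show "partial_x L (A p) = L' (A p) (0, 0, 1, 0, 0, 0)" "partial_Dt L (A p) = L' (A p) (0, 0, 0, 1, 0, 0)"
      "partial_Ds i L (A p) = L' (A p) (0, 0, 0, 0, axis i 1, 0)" "partial_z L (A p) = L' (A p) (0, 0, 0, 0, 0, 1)"
      unfolding eq by (rule *)+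
  qed
  define pz where "pz t = integral (cbox lo hi) (\<lambda>s. L' (A (t, s)) (0, 0, 0, 0, 0, 1))" for t
  have "continuous_on ?D (\<lambda>(t, s). L' (A (t, s)) (0, 0, 0, 0, 0, 1))"
    using cL'A by (auto simp: case_prod_beta' intro!: continuous_intros)
  then have cpz: "continuous_on {a..b} pz"
    unfolding pz_def by (rule integral_continuous_on_param)
  have \<Lambda>: "\<Lambda> t = exp (- integral {a..t} pz)" if "t \<in> {a..b}" for t
    unfolding \<Lambda>_def herglotz_multiplier_def \<Omega>_def A_def[symmetric] pz_def using that
    by (intro arg_cong[where f = "\<lambda>r. exp (- r)"] integral_cong) (simp add: partials)
  have "continuous_on {a..b} (\<lambda>t. exp (- integral {a..t} pz))"
    using cpz by (intro continuous_intros indefinite_integral_continuous_1 integrable_continuous_real)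
  then have c\<Lambda>: "continuous_on {a..b} \<Lambda>" by (rule continuous_on_eq) (simp add: \<Lambda>)
  have c\<Lambda>': "continuous_on ?D (\<lambda>p. \<Lambda> (fst p))"
    by (rule continuous_on_compose2[OF c\<Lambda>]) (auto intro!: continuous_intros)
  have Feq: "F p = \<Lambda> (fst p) * partial_Dt L (A p)" and Fseq: "Fs i p = \<Lambda> (fst p) * partial_Ds i L (A p)" for p i
    by (simp_all add: F_def Fs_def A_def case_prod_beta')
  have "continuous_on ?D (\<lambda>p. \<Lambda> (fst p) * L' (A p) e)" for e
    using c\<Lambda>' cL'A by (intro continuous_intros)
  then have cX: "continuous_on ?D (\<lambda>p. \<Lambda> (fst p) * partial_x L (A p))"
    and cF: "continuous_on ?D F" and cFs: "continuous_on ?D (Fs i)" for i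
    by (auto intro: continuous_on_eq simp: partials Feq Fseq)
  define k where "k h p = combined_caputo \<gamma> \<alpha> \<beta> a b (slice_t h (snd p)) (fst p)"
    for h :: "real \<times> (real ^ 'n) \<Rightarrow> real" and p
  define ks where "ks h i p = combined_caputo (\<gamma>s i) (\<alpha>s i) (\<beta>s i) (lo $ i) (hi $ i) (slice_s i h (fst p) (snd p)) (snd p $ i)"
    for h :: "real \<times> (real ^ 'n) \<Rightarrow> real" and i p
  have ck: "continuous_on ?D (k h)" and cks: "continuous_on ?D (ks h i)" and ch: "continuous_on ?D h" if "adm h" for h i
    using regh[OF that] that
    by (auto simp: caputo_regular_def k_def ks_def case_prod_beta' adm_def intro: C1_on_imp_continuous_on)
  \<comment> \<open>The differential of \<open>L\<close> in the direction produced by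
    \<open>h\<close>, without the contribution of \<open>z\<close>, which the multiplier \<Lambda>
    accounts for.\<close>
  define V where "V h p = h p * partial_x L (A p) + k h p * partial_Dt L (A p)
      + (\<Sum>i\<in>UNIV. ks h i p * partial_Ds i L (A p))" for h p
  have variation: "integral {a..T} (\<lambda>t. \<Lambda> t * integral (cbox lo hi) (\<lambda>s. V h (t, s))) = 0"
    (is "?J = 0") if h: "adm h" for h
  proof (rule ccontr)
    assume J: "?J \<noteq> 0"
    define \<eta> where "\<eta> p = (0::real, 0::real^'n, h p, k h p, (\<chi> i. ks h i p), 0::real)" for p
    define Q where "Q t = integral (cbox lo hi) (\<lambda>s. L' (A (t, s)) (\<eta> (t, s)))" for t
    have c\<eta>: "continuous_on ?D \<eta>"
      unfolding \<eta>_def using ck[OF h] cks[OF h] ch[OF h] by (intro continuous_intros continuous_on_vec_lambda)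
    have "closed ?W" by (intro closed_Times) auto
    have "convex ?W" by (intro convex_Times) auto
    have inW: "A p + r *\<^sub>R \<eta> p + q *\<^sub>R (0, 0, 0, 0, 0, 1) \<in> ?W" if "p \<in> ?D" for p r q
      using AW[OF that] by (cases "A p") (auto simp: \<eta>_def)
    \<comment> \<open>An error of half the main term preserves its sign: \<open>w T - z T\<close>
      then has the sign of \<open>r ?J\<close>.\<close>
    have "\<bar>?J\<bar> / 2 > 0" using J by simp
    from lagrangian_variation[OF ab L' cL' \<open>closed ?W\<close> \<open>convex ?W\<close> cA c\<eta> inW dz[folded A_def] Tab this,
        folded pz_def Q_def]
    obtain \<delta> where \<delta>: "0 < \<delta>" "\<forall>r. \<bar>r\<bar> < \<delta> \<longrightarrow> (\<exists>w. w a = z a \<and>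
      (\<forall>t\<in>{a..b}. (w has_real_derivative integral (cbox lo hi)
        (\<lambda>s. L (A (t, s) + r *\<^sub>R \<eta> (t, s) + (w t - z t) *\<^sub>R (0, 0, 0, 0, 0, 1)))) (at t within {a..b})) \<and>
      \<bar>exp (- integral {a..T} pz) * (w T - z T) - r * integral {a..T} (\<lambda>t. exp (- integral {a..t} pz) * Q t)\<bar>
        \<le> \<bar>?J\<bar> / 2 * \<bar>r\<bar>)"
      by blast
    have Q: "Q t = integral (cbox lo hi) (\<lambda>s. V h (t, s))" if "t \<in> {a..b}" for t
      unfolding Q_def V_def using that
      by (intro integral_cong) (simp add: \<eta>_def lagrangian_differential[of _ "h _"] partials)
    have JQ: "integral {a..T} (\<lambda>t. exp (- integral {a..t} pz) * Q t) = ?J"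
      using Tb by (intro integral_cong) (simp add: \<Lambda> Q)
    have ex: "\<exists>w. herglotz_trajectory L br a b \<Omega> g za (\<lambda>p. x p + r * h p) w \<and>
        \<bar>\<Lambda> T * (w T - z T) - r * ?J\<bar> \<le> \<bar>?J\<bar> / 2 * \<bar>r\<bar>" if r: "\<bar>r\<bar> < \<delta>" for r
    proof -
      obtain w where w: "w a = z a" "\<forall>t\<in>{a..b}. (w has_real_derivative integral (cbox lo hi)
        (\<lambda>s. L (A (t, s) + r *\<^sub>R \<eta> (t, s) + (w t - z t) *\<^sub>R (0, 0, 0, 0, 0, 1)))) (at t within {a..b})"
        "\<bar>exp (- integral {a..T} pz) * (w T - z T) - r * ?J\<bar> \<le> \<bar>?J\<bar> / 2 * \<bar>r\<bar>"
        using \<delta>(2) r unfolding JQ by blast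
      have C1h: "C1_on ?D h" using h by (simp add: adm_def)
      have "br (\<lambda>p. x p + r * h p) w (t, s) = A (t, s) + r *\<^sub>R \<eta> (t, s) + (w t - z t) *\<^sub>R (0, 0, 0, 0, 0, 1)"
        if "t \<in> {a..b}" "s \<in> cbox lo hi" for t s
        using herglotz_arg_add[OF ab lohi C1x C1h regx regh[OF h] that]
        by (simp add: A_def br_def \<eta>_def k_def ks_def)
      then have "integral (cbox lo hi) (\<lambda>s. L (br (\<lambda>p. x p + r * h p) w (t, s))) = integral (cbox lo hi)
        (\<lambda>s. L (A (t, s) + r *\<^sub>R \<eta> (t, s) + (w t - z t) *\<^sub>R (0, 0, 0, 0, 0, 1)))" if "t \<in> {a..b}" for t
        using that by (intro integral_cong) simp
      then have "herglotz_trajectory L br a b \<Omega> g za (\<lambda>p. x p + r * h p) w"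
        using w(1,2) za C1_var[OF h] h xg by (auto simp: herglotz_trajectory_def \<Omega>_def adm_def)
      then show ?thesis using w(3) \<Lambda>[OF Tab] by auto
    qed
    \<comment> \<open>The parameters \<sigma> and \<open>- \<sigma>\<close> give competitors above
      and below \<open>z T\<close> at time \<open>T\<close>, which refutes a minimum and a maximum
      alike.\<close>
    define \<sigma> where "\<sigma> = \<delta> / 2 * sgn ?J"
    have \<sigma>: "\<bar>\<sigma>\<bar> < \<delta>" "\<bar>- \<sigma>\<bar> < \<delta>" "\<sigma> * ?J = \<bar>?J\<bar> * \<bar>\<sigma>\<bar>" "0 < \<bar>?J\<bar> * \<bar>\<sigma>\<bar>"
      using J \<delta>(1) by (auto simp: \<sigma>_def abs_mult sgn_if)
    have \<Lambda>T: "0 < \<Lambda> T" using \<Lambda>[OF Tab] by simp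
    obtain w1 where w1: "herglotz_trajectory L br a b \<Omega> g za (\<lambda>p. x p + \<sigma> * h p) w1"
      "\<bar>\<Lambda> T * (w1 T - z T) - \<sigma> * ?J\<bar> \<le> \<bar>?J\<bar> / 2 * \<bar>\<sigma>\<bar>" using ex[OF \<sigma>(1)] by blast
    obtain w2 where w2: "herglotz_trajectory L br a b \<Omega> g za (\<lambda>p. x p + (- \<sigma>) * h p) w2"
      "\<bar>\<Lambda> T * (w2 T - z T) - (- \<sigma>) * ?J\<bar> \<le> \<bar>?J\<bar> / 2 * \<bar>- \<sigma>\<bar>" using ex[OF \<sigma>(2)] by blast
    have sign: "\<bar>X - c\<bar> \<le> c / 2 \<Longrightarrow> 0 < c \<Longrightarrow> 0 < X" "\<bar>X + c\<bar> \<le> c / 2 \<Longrightarrow> 0 < c \<Longrightarrow> X < 0" for X c :: real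
      by linarith+
    have "0 < \<Lambda> T * (w1 T - z T)"
      by (rule sign(1)[OF _ \<sigma>(4)]) (use w1(2) \<sigma>(3) in simp)
    moreover have "\<Lambda> T * (w2 T - z T) < 0"
      by (rule sign(2)[OF _ \<sigma>(4)]) (use w2(2) \<sigma>(3) in simp)
    ultimately have "z T < w1 T" "w2 T < z T"
      using \<Lambda>T by (auto simp: zero_less_mult_iff mult_less_0_iff)
    then show False
      using opt w1(1) w2(1) Tab by (meson leD)
  qed
  have regadm: "caputo_regular a b lo hi \<gamma> \<gamma>s \<alpha> \<beta> \<alpha>s \<beta>s h"
    if "C1_on ?D h" "\<And>p. p \<in> frontier ?D \<Longrightarrow> h p = 0" for h
    using that by (intro regh) (simp add: adm_def)
  obtain K where Kt: "bounded_kernels \<gamma> \<alpha> \<beta> a b K"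
    using kernel_bound_t[OF ab lohi orders nn(1,2) regadm] by blast
  define E1 where "E1 p = rl_combined (prod.swap \<gamma>) \<beta> \<alpha> a T (slice_t F (snd p)) (fst p)" for p
  define E2 where "E2 p = snd \<gamma> * (rl_left_deriv \<beta> a b (slice_t F (snd p)) (fst p)
      - rl_left_deriv \<beta> T b (slice_t F (snd p)) (fst p))" for p
  define E3 where "E3 i p = rl_combined (prod.swap (\<gamma>s i)) (\<beta>s i) (\<alpha>s i) (lo $ i) (hi $ i)
      (slice_s i (Fs i) (fst p) (snd p)) (snd p $ i)" for i p
  have sub: "?DT \<subseteq> ?D" "?DB \<subseteq> ?D" using Tb aT by auto
  have cE1: "continuous_on ?DT E1"
  proof -
    \<comment> \<open>Continuity is assumed for the left derivative relative to
      \<open>{a..b}\<close>; on \<open>{a..T}\<close> it agrees with the one relative to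
      \<open>{a..T}\<close> that enters \<open>E1\<close>.\<close>
    have "continuous_on ?DT (\<lambda>(t, s). rl_left_deriv \<beta> a b (slice_t F s) t)"
      using left_cont sub(1) unfolding \<Omega>_def by (rule continuous_on_subset)
    then have "continuous_on ?DT (\<lambda>p. snd \<gamma> * rl_left_deriv \<beta> a b (slice_t F (snd p)) (fst p)
        + fst \<gamma> * rl_right_deriv \<alpha> a T (slice_t F (snd p)) (fst p))"
      using right_cont unfolding \<Omega>_def case_prod_beta' by (intro continuous_intros)
    then show ?thesis
      by (rule continuous_on_eq)
         (auto simp: E1_def rl_combined_def rl_left_deriv_subinterval[OF left_ex[unfolded \<Omega>_def] aT Tb])
  qed
  have cE2: "continuous_on ?DB E2" if "T < b"
  proof -
    have "continuous_on ?DB (\<lambda>(t, s). rl_left_deriv \<beta> a b (slice_t F s) t)"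
      using left_cont sub(2) unfolding \<Omega>_def by (rule continuous_on_subset)
    then show ?thesis
      using left_T_cont[OF that] unfolding E2_def \<Omega>_def case_prod_beta' by (intro continuous_intros)
  qed
  have cE3: "continuous_on ?DT (E3 i)" for i
    using left_s_cont[of i] right_s_cont[of i] unfolding E3_def rl_combined_def \<Omega>_def case_prod_beta'
    by (intro continuous_intros)
  have sec_t: "continuous_on {c..d} (\<lambda>t. G (t, s))" if "continuous_on ({c..d} \<times> cbox lo hi) G" "s \<in> cbox lo hi"
    for c d s and G :: "real \<times> (real ^ 'n) \<Rightarrow> real"
    by (rule continuous_on_compose2[OF that(1)]) (use that(2) in \<open>auto intro!: continuous_intros\<close>)
  have sec_s: "continuous_on (cbox lo hi) (\<lambda>s. G (t, s))" if "continuous_on ({c..d} \<times> cbox lo hi) G" "t \<in> {c..d}"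
    for c d t and G :: "real \<times> (real ^ 'n) \<Rightarrow> real"
    by (rule continuous_on_compose2[OF that(1)]) (use that(2) in \<open>auto intro!: continuous_intros\<close>)
  have int_s: "(\<lambda>s. integral {c..d} (\<lambda>t. G (t, s))) integrable_on cbox lo hi" if "continuous_on ({c..d} \<times> cbox lo hi) G"
    for c d and G :: "real \<times> (real ^ 'n) \<Rightarrow> real"
  proof -
    have "continuous_on (cbox lo hi \<times> cbox c d) (\<lambda>(s, t). G (t, s))"
      unfolding case_prod_beta' by (rule continuous_on_compose2[OF that]) (auto intro!: continuous_intros)
    from integral_continuous_on_param[OF this] show ?thesis by (auto intro: integrable_continuous)
  qed
  have int_DT: "G integrable_on ?DT" if "continuous_on ?DT G" for G :: "real \<times> (real ^ 'n) \<Rightarrow> real"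
    using that integrable_continuous[of "(a, lo)" "(T, hi)" G] by (simp add: cbox_Pair_eq)
  \<comment> \<open>The tail stays an iterated integral with \<open>s\<close> outside, as it comes
    from the identity on each slice; continuity of \<open>E2\<close> is at hand only for
    \<open>T < b\<close>, so the double integral is formed later.\<close>
  have parts_t: "integral ?DT (\<lambda>p. F p * k h p) = integral ?DT (\<lambda>p. h p * E1 p)
      + integral (cbox lo hi) (\<lambda>s. integral {T..b} (\<lambda>t. h (t, s) * E2 (t, s)))" if h: "adm h" for h
  proof -
    have c1: "continuous_on ?DT (\<lambda>p. F p * k h p)" "continuous_on ?DT (\<lambda>p. h p * E1 p)"
      using cF ck[OF h] ch[OF h] cE1 sub(1) by (auto intro!: continuous_on_mult intro: continuous_on_subset)
    have slice: "integral {a..T} (\<lambda>t. F (t, s) * k h (t, s)) - integral {a..T} (\<lambda>t. h (t, s) * E1 (t, s))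
        = integral {T..b} (\<lambda>t. h (t, s) * E2 (t, s))" if s: "s \<in> cbox lo hi" for s
    proof -
      obtain h' where h': "has_deriv_on a b (slice_t h s) h'"
        "continuous_on {a..b} h'"
        using slice_t_has_derivative h s unfolding adm_def by blast
      have ends: "slice_t h s a = 0" "slice_t h s b = 0"
        using h s ab frontier_box_memI[of a a b s lo hi] frontier_box_memI[of b a b s lo hi]
        by (auto simp: adm_def slice_t_def)
      have "continuous_on {a..T} (slice_t F s)"
        unfolding slice_t_def using cF sub(1) s by (intro sec_t) (auto intro: continuous_on_subset)
      from combined_fractional_parts[OF aT Tb orders nn(1,2) Kt this h' ends] left_ex left_T_ex right_ex s
      show ?thesis by (simp add: \<Omega>_def k_def E1_def E2_def slice_t_def)
    qed
    have "integral ?DT (\<lambda>p. F p * k h p) - integral ?DT (\<lambda>p. h p * E1 p)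
        = integral (cbox lo hi) (\<lambda>s. integral {a..T} (\<lambda>t. F (t, s) * k h (t, s)) - integral {a..T} (\<lambda>t. h (t, s) * E1 (t, s)))"
      using int_s[OF c1(1)] int_s[OF c1(2)] by (simp add: integral_diff integral_strip(2)[OF c1(1)] integral_strip(2)[OF c1(2)])
    also have "\<dots> = integral (cbox lo hi) (\<lambda>s. integral {T..b} (\<lambda>t. h (t, s) * E2 (t, s)))"
      by (intro integral_cong slice)
    finally show ?thesis by simp
  qed
  have parts_s: "integral ?DT (\<lambda>p. Fs i p * ks h i p) = integral ?DT (\<lambda>p. h p * E3 i p)" if h: "adm h" for h i
  proof -
    obtain K where Ks: "bounded_kernels (\<gamma>s i) (\<alpha>s i) (\<beta>s i) (lo $ i) (hi $ i) K"
      using kernel_bound_s[OF ab lohi orders_s nn(3,4) regadm] by blast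
    have c1: "continuous_on ?DT (\<lambda>p. Fs i p * ks h i p)" "continuous_on ?DT (\<lambda>p. h p * E3 i p)"
      using cFs cks[OF h] ch[OF h] cE3 sub(1) by (auto intro!: continuous_on_mult intro: continuous_on_subset)
    have c2: "continuous_on ?DT (\<lambda>p. Fs i p * ks h i p - h p * E3 i p)" by (intro continuous_on_diff c1)
    have zero: "integral (cbox lo hi) (\<lambda>s. Fs i (t, s) * ks h i (t, s) - h (t, s) * E3 i (t, s)) = 0"
      if t: "t \<in> {a..T}" for t
    proof (rule integral_cbox_eq_0_if_slices[OF sec_s[OF c2 t] lohi])
      fix s assume s: "s \<in> cbox lo hi"
      have tb: "t \<in> {a..b}" using t Tb by simp
      obtain h' where h': "has_deriv_on (lo $ i) (hi $ i) (slice_s i h t s) h'"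
        "continuous_on {lo $ i..hi $ i} h'"
        using slice_s_has_derivative h tb s unfolding adm_def by blast
      have "vec_upd s i (lo $ i) \<in> cbox lo hi" "vec_upd s i (hi $ i) \<in> cbox lo hi"
        using s lohi[of i] by (auto intro!: vec_upd_in_cbox)
      then have ends: "slice_s i h t s (lo $ i) = 0" "slice_s i h t s (hi $ i) = 0"
        using h frontier_box_memI[OF tb, of "vec_upd s i (lo $ i)" lo hi i] frontier_box_memI[OF tb, of "vec_upd s i (hi $ i)" lo hi i]
        by (auto simp: adm_def slice_s_eq)
      have line: "continuous_on {lo $ i..hi $ i} (\<lambda>\<sigma>. G (t, vec_upd s i \<sigma>))" if "continuous_on ?DT G"
        for G :: "real \<times> (real ^ 'n) \<Rightarrow> real"
        by (rule continuous_on_compose2[OF that]) (use s t in \<open>auto intro!: continuous_intros vec_upd_in_cbox\<close>)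
      have "continuous_on {lo $ i..hi $ i} (slice_s i (Fs i) t s)"
        unfolding slice_s_eq using cFs sub(1) by (intro line) (auto intro: continuous_on_subset)
      \<comment> \<open>In a space variable the role of \<open>T\<close> is played by the right end
        \<open>hi $ i\<close>, so the tail is an integral over one point and no second equation
        arises.\<close>
      from combined_fractional_parts[OF lohi order_refl orders_s nn(3,4) Ks this h' ends] left_s_ex right_s_ex s t
      have "integral {lo $ i..hi $ i} (\<lambda>\<sigma>. Fs i (t, vec_upd s i \<sigma>) * ks h i (t, vec_upd s i \<sigma>))
          = integral {lo $ i..hi $ i} (\<lambda>\<sigma>. h (t, vec_upd s i \<sigma>) * E3 i (t, vec_upd s i \<sigma>))"
        by (simp add: \<Omega>_def ks_def E3_def) (simp add: slice_s_eq)
      then show "integral {lo $ i..hi $ i} (\<lambda>\<sigma>. Fs i (t, vec_upd s i \<sigma>) * ks h i (t, vec_upd s i \<sigma>)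
          - h (t, vec_upd s i \<sigma>) * E3 i (t, vec_upd s i \<sigma>)) = 0"
        using line[OF c1(1)] line[OF c1(2)] by (simp add: integral_diff integrable_continuous_real)
    qed
    have "integral ?DT (\<lambda>p. Fs i p * ks h i p) - integral ?DT (\<lambda>p. h p * E3 i p)
        = integral ?DT (\<lambda>p. Fs i p * ks h i p - h p * E3 i p)"
      using c1[THEN int_DT] by (simp add: integral_diff)
    also have "\<dots> = integral {a..T} (\<lambda>t. 0)"
      unfolding integral_strip(1)[OF c2] by (intro integral_cong zero)
    finally show ?thesis by simp
  qed
  define E where "E p = partial_x L (A p) * \<Lambda> (fst p) + E1 p + (\<Sum>i\<in>UNIV. E3 i p)" for p
  have cE: "continuous_on ?DT E"
  proof -
    have "continuous_on ?DT (\<lambda>p. \<Lambda> (fst p) * partial_x L (A p) + E1 p + (\<Sum>i\<in>UNIV. E3 i p))"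
      by (intro continuous_on_add continuous_on_sum cE1 cE3 continuous_on_subset[OF cX sub(1)])
    then show ?thesis by (simp add: E_def[abs_def] mult.commute)
  qed
  have weak: "integral ?DT (\<lambda>p. h p * E p) + integral (cbox lo hi) (\<lambda>s. integral {T..b} (\<lambda>t. h (t, s) * E2 (t, s))) = 0"
    if h: "adm h" for h
  proof -
    have c: "continuous_on ?DT h" "continuous_on ?DT F" "continuous_on ?DT (Fs i)" "continuous_on ?DT (k h)"
      "continuous_on ?DT (ks h i)" "continuous_on ?DT (\<lambda>p. \<Lambda> (fst p) * partial_x L (A p))" for i
      using ch[OF h] cF cFs ck[OF h] cks[OF h] cX sub(1) by (auto intro: continuous_on_subset)
    let ?X = "\<lambda>p. h p * (\<Lambda> (fst p) * partial_x L (A p))"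
    have cS: "continuous_on ?DT (\<lambda>p. ?X p + F p * k h p + (\<Sum>i\<in>UNIV. Fs i p * ks h i p))"
      by (intro c continuous_on_add continuous_on_mult continuous_on_sum)
    have "0 = integral {a..T} (\<lambda>t. integral (cbox lo hi) (\<lambda>s. ?X (t, s) + F (t, s) * k h (t, s)
        + (\<Sum>i\<in>UNIV. Fs i (t, s) * ks h i (t, s))))"
      unfolding variation[OF h, symmetric] integral_mult_right[symmetric]
      by (intro integral_cong) (simp add: V_def Feq Fseq algebra_simps sum_distrib_left)
    also have "\<dots> = integral ?DT (\<lambda>p. ?X p + F p * k h p + (\<Sum>i\<in>UNIV. Fs i p * ks h i p))"
      by (rule integral_strip(1)[OF cS, symmetric])
    also have "\<dots> = integral ?DT ?X + integral ?DT (\<lambda>p. F p * k h p) + (\<Sum>i\<in>UNIV. integral ?DT (\<lambda>p. Fs i p * ks h i p))"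
      using c by (simp add: integral_add integral_sum integrable_add integrable_sum int_DT continuous_on_mult)
    also have "\<dots> = integral ?DT ?X + integral ?DT (\<lambda>p. h p * E1 p) + (\<Sum>i\<in>UNIV. integral ?DT (\<lambda>p. h p * E3 i p))
        + integral (cbox lo hi) (\<lambda>s. integral {T..b} (\<lambda>t. h (t, s) * E2 (t, s)))"
      by (simp add: parts_t[OF h] parts_s[OF h])
    also have "integral ?DT ?X + integral ?DT (\<lambda>p. h p * E1 p) + (\<Sum>i\<in>UNIV. integral ?DT (\<lambda>p. h p * E3 i p))
        = integral ?DT (\<lambda>p. ?X p + h p * E1 p + (\<Sum>i\<in>UNIV. h p * E3 i p))"
      using c cE1 cE3 by (simp add: integral_add integral_sum integrable_add integrable_sum int_DT continuous_on_mult)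
    also have "(\<lambda>p. ?X p + h p * E1 p + (\<Sum>i\<in>UNIV. h p * E3 i p)) = (\<lambda>p. h p * E p)"
      by (simp add: E_def algebra_simps sum_distrib_left)
    finally show ?thesis by simp
  qed
  have adm_bump: "adm (box_bump l u M U)"
    if "a \<le> l" "l < u" "u \<le> b" "\<And>i. lo $ i \<le> M $ i" "\<And>i. M $ i < U $ i" "\<And>i. U $ i \<le> hi $ i"
    for l u and M U :: "real ^ 'n"
    unfolding adm_def
  proof (intro conjI ballI)
    show "C1_on ?D (box_bump l u M U)"
      by (rule C1_on_tensor) (auto intro: bump_has_derivative continuous_on_bump')
    fix p assume p: "p \<in> frontier ?D"
    show "box_bump l u M U p = 0"
      by (rule tensor_eq_0_on_frontier[OF p]) (use that in \<open>simp_all add: bump_eq_0 less_imp_le\<close>)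
  qed
  have EL: "E p = 0" if p: "p \<in> ?DT" for p
  proof (rule fundamental_lemma_box[OF cE aT lohi _ p])
    fix l u :: real and M U :: "real ^ 'n"
    assume lu: "a \<le> l" "l < u" "u \<le> T" and MU: "\<And>i. lo $ i \<le> M $ i" "\<And>i. M $ i < U $ i" "\<And>i. U $ i \<le> hi $ i"
    \<comment> \<open>A bump supported before \<open>T\<close> isolates the first equation; in
      \<open>EL2\<close> a bump supported after \<open>T\<close> isolates the second.\<close>
    have "integral {T..b} (\<lambda>t. box_bump l u M U (t, s) * E2 (t, s)) = integral {T..b} (\<lambda>t. 0)" for s
      using lu by (intro integral_cong) (simp add: tensor_def bump_eq_0)
    then show "integral ?DT (\<lambda>p. box_bump l u M U p * E p) = 0"
      using weak[OF adm_bump[OF lu(1,2) _ MU]] lu(3) Tb by simp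
  qed
  have EL2: "E2 p = 0" if Tb': "T < b" and p: "p \<in> ?DB" for p
  proof (rule fundamental_lemma_box[OF cE2[OF Tb'] Tb' lohi _ p])
    fix l u :: real and M U :: "real ^ 'n"
    assume lu: "T \<le> l" "l < u" "u \<le> b" and MU: "\<And>i. lo $ i \<le> M $ i" "\<And>i. M $ i < U $ i" "\<And>i. U $ i \<le> hi $ i"
    have "integral ?DT (\<lambda>p. box_bump l u M U p * E p) = integral ?DT (\<lambda>p. 0)"
      using lu by (intro integral_cong) (auto simp: tensor_def bump_eq_0)
    moreover have "continuous_on ?DB (\<lambda>p. box_bump l u M U p * E2 p)"
      using cE2[OF Tb'] by (intro continuous_intros continuous_on_box_bump)
    ultimately show "integral ?DB (\<lambda>p. box_bump l u M U p * E2 p) = 0"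
      using weak[OF adm_bump[OF _ lu(2,3) MU]] lu(1) aT by (simp add: integral_strip(2))
  qed
  \<comment> \<open>Keeping the trajectory and varying only the final time makes \<open>T\<close>,
    which is interior by \<open>a < T < b\<close>, a local extremum of \<open>z\<close>; the
    integral is the derivative of \<open>z\<close> there.\<close>
  have stationary: "integral \<Omega> (\<lambda>s. L (br x z (T, s))) = 0" if Tb': "T < b"
  proof -
    have "(z has_real_derivative integral \<Omega> (\<lambda>s. L (br x z (T, s)))) (at T)"
      using bspec[OF dz Tab] unfolding at_within_Icc_at[OF aT Tb'] \<Omega>_def .
    moreover have "\<forall>S. \<bar>T - S\<bar> < min (T - a) (b - T) \<longrightarrow> S \<in> {a..b}" by auto
    moreover have "0 < min (T - a) (b - T)" using aT Tb' by simp
    ultimately show ?thesis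
      using opt traj DERIV_local_min[of z _ T "min (T - a) (b - T)"] DERIV_local_max[of z _ T "min (T - a) (b - T)"]
      by blast
  qed
  have "partial_x L (br x z (t, s)) * \<Lambda> t + rl_combined (prod.swap \<gamma>) \<beta> \<alpha> a T (slice_t F s) t
      + (\<Sum>i\<in>UNIV. rl_combined (prod.swap (\<gamma>s i)) (\<beta>s i) (\<alpha>s i) (lo $ i) (hi $ i)
        (slice_s i (Fs i) t s) (s $ i)) = 0" if "t \<in> {a..T}" "s \<in> \<Omega>" for t s
    using EL[of "(t, s)"] that by (simp add: \<Omega>_def E_def E1_def E3_def A_def)
  moreover have "snd \<gamma> * (rl_left_deriv \<beta> a b (slice_t F s) t - rl_left_deriv \<beta> T b (slice_t F s) t) = 0"
    if "T < b" "t \<in> {T..b}" "s \<in> \<Omega>" for t s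
    using EL2[OF that(1), of "(t, s)"] that by (simp add: \<Omega>_def E2_def)
  moreover have "fst \<gamma> * rl_right_integral (\<lambda>t \<tau>. 1 - \<alpha> t \<tau>) T (slice_t F s) T
      - snd \<gamma> * rl_left_integral (\<lambda>t \<tau>. 1 - \<beta> t \<tau>) T (slice_t F s) T = 0" for s
    by (simp add: rl_right_integral_def rl_left_integral_def)
  ultimately show ?thesis
    using stationary by blast
qed

end
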